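(* Let $\alpha>-1$, and let $\varphi:\mathbb{D}\to\mathbb{D}$ be a nonconstant analytic self-map. Suppose that $C_\varphi$ is bounded on $\mathcal{D}_\alpha$. Then, for every fixed $r>0$, $$\|C_\varphi\|_e^2=\|\widetilde C_\varphi\|_e^2=\|D_\varphi\|_e^2=\|T_{\widehat\mu_{\varphi,\alpha}}\|_e\asymp\limsup_{|z|\to1^-}\frac{\int_{D(z,r)}N_{\varphi,\alpha}(w)\,dA(w)}{A_\alpha(D(z,r))},$$ where $\asymp$ means two-sided inequality up to positive constants that depend only on $\alpha$ and $r$ and are independent of $z$.
   Context: $\mathbb{D}$ is the open unit disk and $dA$ is normalized area measure on $\mathbb{D}$. For $\alpha>-1$, $dA_\alpha(z)=(1+\alpha)(1-|z|^2)^\alpha dA(z)$ and $A_\alpha(E)=\int_E dA_\alpha$. The weighted Bergman space $A_\alpha^2$ consists of analytic $g$ on $\mathbb{D}$ with $\|g\|_{A_\alpha^2}^2=\int_{\mathbb{D}}|g|^2dA_\alpha<\infty$. The weighted Dirichlet space $\mathcal{D}_\alpha$ consists of analytic $f$ on $\mathbb{D}$ with $\|f\|_{\mathcal{D}_\alpha}^2=|f(0)|^2+\int_{\mathbb{D}}|f'|^2dA_\alpha<\infty$, and $\mathcal{D}_{\alpha,0}=\{f\in\mathcal{D}_\alpha:f(0)=0\}$. Operators: $C_\varphi f=f\circ\varphi$ on $\mathcal{D}_\alpha$; $\widetilde C_\varphi f=f\circ\varphi-f(\varphi(0))$ on $\mathcal{D}_{\alpha,0}$; $D_\varphi g=(g\circ\varphi)\varphi'$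 on $A_\alpha^2$. Counting function: $N_{\varphi,\alpha}(w)=\sum_{\varphi(z)=w}(1-|z|^2)^\alpha\in[0,+\infty]$, preimages counted with multiplicity, and $N_{\varphi,\alpha}(w)=0$ if $w\notin\varphi(\mathbb{D})$. The measure $\widehat\mu_{\varphi,\alpha}$ is $d\widehat\mu_{\varphi,\alpha}(w)=\frac{N_{\varphi,\alpha}(w)}{(1-|w|^2)^\alpha}\,dA_\alpha(w)=(1+\alpha)N_{\varphi,\alpha}(w)\,dA(w)$. For a positive Borel measure $\mu$ on $\mathbb{D}$ such that the embedding $A_\alpha^2\hookrightarrow L^2(\mu)$ is bounded, $T_\mu$ is the unique bounded positive operator on $A_\alpha^2$ with $\langle T_\mu f,g\rangle_{A_\alpha^2}=\int_{\mathbb{D}}f\overline g\,d\mu$ for all $f,g\in A_\alpha^2$. (When $C_\varphi$ is bounded on $\mathcal{D}_\alpha$, the embedding is bounded for $\mu=\widehat\mu_{\varphi,\alpha}$.) Bergman disks: $D(z,r)=\{w\in\mathbb{D}:\beta(z,w)<r\}$ with $\beta(z,w)=\operatorname{arctanh}\left|\frac{z-w}{1-\overline z w}\right|$. Essential norm of a bounded operator $T:H_1\to H_2$ between Hilbert spaces: $\|T\|_e=\inf\{\|T-K\|:K:H_1\to H_2\text{ compact}\}$. *)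

theory Defs
  imports "HOL-Complex_Analysis.Complex_Analysis"
begin

section \<open>Normed spaces of functions and essential norms\<close>

text \<open>
  The weight parameter makes it impossible to use types for the spaces below, so a complex normed
  space of functions is given by a carrier set together with a norm; the vector space operations
  are the pointwise ones.
\<close>

record fun_space =
  vecs :: "(complex \<Rightarrow> complex) set"
  vnorm :: "(complex \<Rightarrow> complex) \<Rightarrow> real"

type_synonym operator = "(complex \<Rightarrow> complex) \<Rightarrow> (complex \<Rightarrow> complex)"

definition linear_op :: "fun_space \<Rightarrow> fun_space \<Rightarrow> operator \<Rightarrow> bool" where
  "linear_op V W T \<longleftrightarrow>
     (\<forall>f\<in>vecs V. T f \<in> vecs W) \<and>
     (\<forall>f\<in>vecs V. \<forall>g\<in>vecs V. \<forall>a b.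
        T (\<lambda>z. a * f z + b * g z) = (\<lambda>z. a * T f z + b * T g z))"

definition bounded_op :: "fun_space \<Rightarrow> fun_space \<Rightarrow> operator \<Rightarrow> bool" where
  "bounded_op V W T \<longleftrightarrow>
     linear_op V W T \<and> (\<exists>C. \<forall>f\<in>vecs V. vnorm W (T f) \<le> C * vnorm V f)"

definition op_norm :: "fun_space \<Rightarrow> fun_space \<Rightarrow> operator \<Rightarrow> real" where
  "op_norm V W T = (SUP f\<in>{f \<in> vecs V. vnorm V f \<le> 1}. vnorm W (T f))"

definition compact_op :: "fun_space \<Rightarrow> fun_space \<Rightarrow> operator \<Rightarrow> bool" where
  "compact_op V W K \<longleftrightarrow>
     linear_op V W K \<and>
     (\<forall>f :: nat \<Rightarrow> complex \<Rightarrow> complex.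
        (\<forall>n. f n \<in> vecs V) \<and> (\<exists>B. \<forall>n. vnorm V (f n) \<le> B) \<longrightarrow>
        (\<exists>s h. strict_mono s \<and> h \<in> vecs W \<and>
           (\<lambda>n. vnorm W (\<lambda>z. K (f (s n)) z - h z)) \<longlonglongrightarrow> 0))"

text \<open>Only meaningful for bounded \<open>T\<close>, as \<open>op_norm\<close> is a real supremum.\<close>

definition ess_norm :: "fun_space \<Rightarrow> fun_space \<Rightarrow> operator \<Rightarrow> real" where
  "ess_norm V W T = (INF K\<in>{K. compact_op V W K}. op_norm V W (\<lambda>f z. T f z - K f z))"


section \<open>Weighted Bergman and Dirichlet spaces\<close>

abbreviation disk :: "complex set" where
  "disk \<equiv> ball 0 1"

definition area :: "complex measure" where
  "area = scale_measure (ennreal (1 / pi)) (restrict_space lborel disk)"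

definition warea :: "real \<Rightarrow> complex measure" where
  "warea \<alpha> = density area (\<lambda>z. ennreal ((1 + \<alpha>) * (1 - (cmod z)\<^sup>2) powr \<alpha>))"

text \<open>
  Functions on the disk are represented by their extension by zero to the complex plane, so that
  equality of elements of the spaces is equality of functions.
\<close>

definition disk_analytic :: "(complex \<Rightarrow> complex) set" where
  "disk_analytic = {f. f holomorphic_on disk \<and> (\<forall>z. z \<notin> disk \<longrightarrow> f z = 0)}"

definition on_disk :: "(complex \<Rightarrow> complex) \<Rightarrow> complex \<Rightarrow> complex" where
  "on_disk f z = (if z \<in> disk then f z else 0)"

definition bergman :: "real \<Rightarrow> fun_space" where
  "bergman \<alpha> =
     \<lparr>vecs = {g \<in> disk_analytic. integrable (warea \<alpha>) (\<lambda>z. (cmod (g z))\<^sup>2)},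
      vnorm = (\<lambda>g. sqrt (\<integral>z. (cmod (g z))\<^sup>2 \<partial>warea \<alpha>))\<rparr>"

definition bergman_inner ::
    "real \<Rightarrow> (complex \<Rightarrow> complex) \<Rightarrow> (complex \<Rightarrow> complex) \<Rightarrow> complex" where
  "bergman_inner \<alpha> f g = (\<integral>z. f z * cnj (g z) \<partial>warea \<alpha>)"

definition dirichlet :: "real \<Rightarrow> fun_space" where
  "dirichlet \<alpha> =
     \<lparr>vecs = {f \<in> disk_analytic. integrable (warea \<alpha>) (\<lambda>z. (cmod (deriv f z))\<^sup>2)},
      vnorm = (\<lambda>f. sqrt ((cmod (f 0))\<^sup>2 + (\<integral>z. (cmod (deriv f z))\<^sup>2 \<partial>warea \<alpha>)))\<rparr>"

definition dirichlet0 :: "real \<Rightarrow> fun_space" where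
  "dirichlet0 \<alpha> =
     \<lparr>vecs = {f \<in> vecs (dirichlet \<alpha>). f 0 = 0}, vnorm = vnorm (dirichlet \<alpha>)\<rparr>"


section \<open>Operators\<close>

definition comp_op :: "(complex \<Rightarrow> complex) \<Rightarrow> operator" where
  "comp_op \<phi> f = on_disk (\<lambda>z. f (\<phi> z))"

definition comp_op0 :: "(complex \<Rightarrow> complex) \<Rightarrow> operator" where
  "comp_op0 \<phi> f = on_disk (\<lambda>z. f (\<phi> z) - f (\<phi> 0))"

definition deriv_comp_op :: "(complex \<Rightarrow> complex) \<Rightarrow> operator" where
  "deriv_comp_op \<phi> g = on_disk (\<lambda>z. g (\<phi> z) * deriv \<phi> z)"

text \<open>
  Membership in \<open>extensional\<close> fixes the irrelevant values off the carrier, so that an operator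
  determined on the Bergman space is unique as a function.
\<close>

definition toeplitz :: "real \<Rightarrow> complex measure \<Rightarrow> operator" where
  "toeplitz \<alpha> \<mu> = (THE T.
     T \<in> extensional (vecs (bergman \<alpha>)) \<and>
     bounded_op (bergman \<alpha>) (bergman \<alpha>) T \<and>
     (\<forall>f\<in>vecs (bergman \<alpha>). bergman_inner \<alpha> (T f) f \<in> \<real>\<^sub>\<ge>\<^sub>0) \<and>
     (\<forall>f\<in>vecs (bergman \<alpha>). \<forall>g\<in>vecs (bergman \<alpha>).
        bergman_inner \<alpha> (T f) g = (\<integral>z. f z * cnj (g z) \<partial>\<mu>)))"


section \<open>Counting function and Bergman disks\<close>

text \<open>
  For nonconstant analytic \<open>\<phi>\<close> and \<open>\<phi> z = w\<close>, the multiplicity of \<open>z\<close> as a preimage of \<open>w\<close> is the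
  order of the zero of \<open>\<phi> - w\<close> at \<open>z\<close>. The infinite sum always exists in \<^typ>\<open>ennreal\<close>.
\<close>

definition counting_fun :: "(complex \<Rightarrow> complex) \<Rightarrow> real \<Rightarrow> complex \<Rightarrow> ennreal" where
  "counting_fun \<phi> \<alpha> w =
     (\<Sum>\<^sub>\<infinity>z\<in>{z \<in> disk. \<phi> z = w}.
        of_nat (nat (zorder (\<lambda>u. \<phi> u - w) z)) * ennreal ((1 - (cmod z)\<^sup>2) powr \<alpha>))"

definition counting_fun_measure :: "(complex \<Rightarrow> complex) \<Rightarrow> real \<Rightarrow> complex measure" where
  "counting_fun_measure \<phi> \<alpha> =
     density (warea \<alpha>) (\<lambda>w. counting_fun \<phi> \<alpha> w / ennreal ((1 - (cmod w)\<^sup>2) powr \<alpha>))"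

definition bergman_dist :: "complex \<Rightarrow> complex \<Rightarrow> real" where
  "bergman_dist z w = artanh (cmod ((z - w) / (1 - cnj z * w)))"

definition bergman_disk :: "complex \<Rightarrow> real \<Rightarrow> complex set" where
  "bergman_disk z r = {w \<in> disk. bergman_dist z w < r}"

text \<open>The filter \<open>filtercomap cmod (at_left 1)\<close> expresses \<open>|z| \<rightarrow> 1\<^sup>-\<close>.\<close>

definition limsup_average :: "(complex \<Rightarrow> complex) \<Rightarrow> real \<Rightarrow> real \<Rightarrow> ennreal" where
  "limsup_average \<phi> \<alpha> r =
     Limsup (filtercomap cmod (at_left 1))
       (\<lambda>z. (\<integral>\<^sup>+w\<in>bergman_disk z r. counting_fun \<phi> \<alpha> w \<partial>area) /
             emeasure (warea \<alpha>) (bergman_disk z r))"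

end

theory Submission imports Defs begin

text \<open>
  The four essential norms agree for soft reasons. Differentiation is a unitary map from the Dirichlet
  functions vanishing at \<open>0\<close> onto the Bergman space, and it carries \<open>comp_op0 \<phi>\<close> to \<open>deriv_comp_op \<phi>\<close>;
  passing from \<open>comp_op0 \<phi>\<close> to \<open>comp_op \<phi>\<close> only adds the constants and an operator of rank one. Each
  such relation gives an inequality between essential norms (\<open>ess_norm_transfer\<close>).

  By the area formula, \<open>counting_fun_measure \<phi> \<alpha>\<close> is the image of \<open>|\<phi>'|\<^sup>2 dA\<^sub>\<alpha>\<close> under \<open>\<phi>\<close>
  (\<open>counting_fun_measure_eq_distr\<close>). With \<open>\<mu>\<close> for this measure and \<open>D\<close> for \<open>deriv_comp_op \<phi>\<close> this reads
  \<open>\<integral> f cnj(g) d\<mu> = \<langle>D f, D g\<rangle>\<close>, so the Toeplitz operator is \<open>T = D\<^sup>*D\<close>. Let \<open>Q\<^sub>n\<close> delete the first \<open>n\<close>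
  Taylor coefficients. Since \<open>I - Q\<^sub>n\<close> has finite rank, and since \<open>\<parallel>K Q\<^sub>n\<parallel>\<close> tends to \<open>0\<close> for every
  compact \<open>K\<close> (\<open>compact_tail_small\<close>), the essential norm of a bounded operator \<open>S\<close> is the limit of
  \<open>\<parallel>S Q\<^sub>n\<parallel>\<close>. The identity \<open>\<parallel>D Q\<^sub>n\<parallel>\<^sup>2 = \<parallel>Q\<^sub>n T Q\<^sub>n\<parallel>\<close> then yields \<open>\<parallel>D\<parallel>\<^sub>e\<^sup>2 = \<parallel>T\<parallel>\<^sub>e\<close> (\<open>ess_norm_toeplitz\<close>).
  The Hilbert space arguments all run through Taylor coefficients: the monomials are orthogonal by
  rotation invariance, Parseval's identity describes the Bergman space as a weighted \<open>\<ell>\<^sup>2\<close>, and the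
  representation of bounded functionals (\<open>riesz\<close>) is read off from it.

  It remains to compare \<open>\<parallel>D\<parallel>\<^sub>e\<^sup>2\<close> with the averages, where \<open>\<parallel>D f\<parallel>\<^sup>2 = \<integral> |f|\<^sup>2 d\<mu>\<close>. Invariance under
  Moebius transformations shows that the Bergman disk \<open>D(z,r)\<close> has \<open>A\<^sub>\<alpha>\<close>-measure comparable to
  \<open>(1 - |z|\<^sup>2)\<^sup>2\<^sup>+\<^sup>\<alpha>\<close>. For the lower bound take \<open>f\<close> to be the normalized reproducing kernel
  at \<open>z\<close>: its norm does not depend on \<open>z\<close>, on \<open>D(z,r)\<close> its squared modulus is comparable to the
  reciprocal of that measure, and each of its Taylor coefficients tends to \<open>0\<close> as \<open>|z|\<close> tends to
  \<open>1\<close>, so that \<open>Q\<^sub>n\<close> hardly changes it. For the upper bound, the submean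
  value property over Bergman disks and Fubini's theorem bound \<open>\<integral> |f|\<^sup>2 d\<mu>\<close> by the integral of
  \<open>|f(w)|\<^sup>2 \<mu>(D(w,r)) / (1 - |w|\<^sup>2)\<^sup>2\<^sup>+\<^sup>\<alpha>\<close> against \<open>A\<^sub>\<alpha>\<close>. Near the circle the quotient is at most a
  constant times the upper limit of the averages, and on a compact set the functions \<open>Q\<^sub>n f\<close> with
  \<open>\<parallel>f\<parallel> \<le> 1\<close> are uniformly small in the mean.
\<close>

section \<open>Change of variables for injective holomorphic maps\<close>

text \<open>\<open>to_plane\<close> and \<open>of_plane\<close> carry the change of variables theorem for maps of \<open>real^2\<close> over to the
  complex plane.\<close>

definition to_plane :: "complex \<Rightarrow> real^2" where
  "to_plane z = vector [Re z, Im z]"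

definition of_plane :: "real^2 \<Rightarrow> complex" where
  "of_plane v = Complex (v $ 1) (v $ 2)"

lemma of_to_plane [simp]: "of_plane (to_plane z) = z"
  by (simp add: of_plane_def to_plane_def vector_2 complex_eq_iff)

lemma to_of_plane [simp]: "to_plane (of_plane v) = v"
  by (simp add: of_plane_def to_plane_def vec_eq_iff forall_2 vector_2)

lemma linear_to_plane: "linear to_plane"
  by (rule linearI) (simp_all add: to_plane_def vec_eq_iff forall_2 vector_2)

lemma linear_of_plane: "linear of_plane"
  by (rule linearI) (simp_all add: of_plane_def complex_eq_iff)

lemma measurable_to_plane [measurable]: "to_plane \<in> borel_measurable borel"
  by (intro borel_measurable_continuous_onI linear_continuous_on)
     (rule linear_conv_bounded_linear[THEN iffD1, OF linear_to_plane])

lemma measurable_of_plane [measurable]: "of_plane \<in> borel_measurable borel"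
  by (intro borel_measurable_continuous_onI linear_continuous_on)
     (rule linear_conv_bounded_linear[THEN iffD1, OF linear_of_plane])

lemma Basis_real2: "(Basis :: (real^2) set) = {axis 1 1, axis 2 1}"
proof -
  have "(UNIV :: 2 set) = {1, 2}" using exhaust_2 by auto
  then have "(Basis :: (real^2) set) = (\<Union>i\<in>{1, 2}. {axis i 1})"
    by (simp add: Basis_vec_def)
  then show ?thesis by auto
qed

text \<open>Lebesgue measure is determined by the volumes of boxes, and boxes correspond to boxes.\<close>

lemma distr_to_plane: "distr lborel borel to_plane = (lborel :: (real^2) measure)"
proof (rule sym, rule lborel_eqI)
  fix l u :: "real^2"
  assume le: "\<And>b. b \<in> Basis \<Longrightarrow> l \<bullet> b \<le> u \<bullet> b"
  have ne: "axis 1 1 \<noteq> (axis 2 1 :: real^2)" by (simp add: axis_eq_axis)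
  have le': "l $ 1 \<le> u $ 1" "l $ 2 \<le> u $ 2"
    using le[of "axis 1 1"] le[of "axis 2 1"] by (simp_all add: Basis_real2 inner_axis)
  have eq: "to_plane -` box l u = box (of_plane l) (of_plane u)"
    by (auto simp: box_def Basis_real2 Basis_complex_def inner_axis of_plane_def to_plane_def vector_2)
  have "emeasure (distr lborel borel to_plane) (box l u) = emeasure lborel (box (of_plane l) (of_plane u))"
    by (subst emeasure_distr) (auto simp: eq)
  also have "\<dots> = (\<Prod>b\<in>Basis. (u - l) \<bullet> b)"
    using le' ne
    by (subst emeasure_lborel_box) (auto simp: Basis_complex_def Basis_real2 of_plane_def inner_axis)
  finally show "emeasure (distr lborel borel to_plane) (box l u) = (\<Prod>b\<in>Basis. (u - l) \<bullet> b)" .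
qed simp

lemma emeasure_to_plane_image:
  assumes "S \<in> sets borel"
  shows "emeasure lborel (to_plane ` S) = emeasure lborel S" "to_plane ` S \<in> sets borel"
proof -
  have im: "to_plane ` S = of_plane -` S" by (auto simp: image_iff) (metis to_of_plane)
  show b: "to_plane ` S \<in> sets borel"
    unfolding im using measurable_sets[OF measurable_of_plane assms] by simp
  have vi: "to_plane -` (to_plane ` S) = S"
    by (auto simp: image_iff) (metis of_to_plane)
  have "emeasure lborel (to_plane ` S) = emeasure (distr lborel borel to_plane) (to_plane ` S)"
    by (simp add: distr_to_plane)
  also have "\<dots> = emeasure lborel S" using b by (subst emeasure_distr) (auto simp: vi)
  finally show "emeasure lborel (to_plane ` S) = emeasure lborel S" .
qed

lemma nn_integral_to_plane:
  assumes [measurable]: "f \<in> borel_measurable borel"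
  shows "(\<integral>\<^sup>+x. f (of_plane x) \<partial>lborel) = (\<integral>\<^sup>+z. f z \<partial>lborel)"
proof -
  have "(\<integral>\<^sup>+x. f (of_plane x) \<partial>lborel) = (\<integral>\<^sup>+x. f (of_plane x) \<partial>distr lborel borel to_plane)"
    by (simp add: distr_to_plane)
  also have "\<dots> = (\<integral>\<^sup>+z. f z \<partial>lborel)" by (subst nn_integral_distr) auto
  finally show ?thesis .
qed

text \<open>Multiplication by \<open>c\<close> is a rotation followed by a dilation by \<open>|c|\<close>. This turns the real
  Jacobian of a holomorphic map into the square of the modulus of its derivative.\<close>

lemma det_plane_mult: "det (matrix (\<lambda>h. to_plane (c * of_plane h))) = (cmod c)\<^sup>2"
  by (simp add: det_2 matrix_def to_plane_def of_plane_def vector_2 axis_def cmod_power2)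
     (simp add: power2_eq_square)

text \<open>The image of a Borel set is Borel because the inverse is continuous.\<close>

lemma injective_holomorphic_image_borel:
  assumes "open U" "\<phi> holomorphic_on U" "inj_on \<phi> U" "E \<in> sets borel" "E \<subseteq> U"
  shows "\<phi> ` E \<in> sets borel"
proof -
  obtain g where g: "g holomorphic_on (\<phi> ` U)" "\<And>z. z \<in> U \<Longrightarrow> g (\<phi> z) = z"
    using holomorphic_has_inverse[OF assms(2,1,3)] by metis
  have op: "open (\<phi> ` U)" using open_mapping_thm3[OF assms(2,1,3)] .
  have "continuous_on (\<phi> ` U) g" using g(1) by (rule holomorphic_on_imp_continuous_on)
  then have m: "g \<in> borel_measurable (restrict_space borel (\<phi> ` U))"
    by (rule borel_measurable_continuous_on_restrict)
  have "g -` E \<inter> space (restrict_space borel (\<phi> ` U)) \<in> sets (restrict_space borel (\<phi> ` U))"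
    by (rule measurable_sets[OF m assms(4)])
  moreover have "g -` E \<inter> space (restrict_space borel (\<phi> ` U)) = \<phi> ` E"
    using g(2) assms(5) by (auto simp: space_restrict_space)
  ultimately show ?thesis using op by (auto simp: sets_restrict_space_iff)
qed

text \<open>The real change of variables theorem, with the Jacobian computed in \<open>det_plane_mult\<close>. That
  theorem also says that the image has finite measure exactly if the Jacobian is integrable, which
  settles the case of an infinite value.\<close>

lemma emeasure_injective_holomorphic_image:
  assumes U: "open U" "\<phi> holomorphic_on U" "inj_on \<phi> U" and E: "E \<in> sets borel" "E \<subseteq> U"
  shows "emeasure lborel (\<phi> ` E) = (\<integral>\<^sup>+z. ennreal ((cmod (deriv \<phi> z))\<^sup>2 * indicator E z) \<partial>lborel)"
proof -
  define F where "F = (\<lambda>x. to_plane (\<phi> (of_plane x)))"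
  define F' where "F' = (\<lambda>x h. to_plane (deriv \<phi> (of_plane x) * of_plane h))"
  define S where "S = to_plane ` E"
  define J where "J = (\<lambda>z. (cmod (deriv \<phi> z))\<^sup>2 * indicator E z)"
  have Sb: "S \<in> sets borel" unfolding S_def using E by (intro emeasure_to_plane_image)
  have FS: "F ` S = to_plane ` (\<phi> ` E)" by (auto simp: F_def S_def image_image)
  have phiE: "\<phi> ` E \<in> sets borel" by (rule injective_holomorphic_image_borel[OF U E])
  have FSb: "F ` S \<in> sets borel" unfolding FS by (intro emeasure_to_plane_image phiE)
  have bl1: "bounded_linear to_plane" "bounded_linear of_plane"
    by (rule linear_conv_bounded_linear[THEN iffD1, OF linear_to_plane],
        rule linear_conv_bounded_linear[THEN iffD1, OF linear_of_plane])
  have der: "(F has_derivative F' x) (at x within S)" if "x \<in> S" for x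
  proof -
    have xU: "of_plane x \<in> U" using that E by (auto simp: S_def)
    have "(\<phi> has_field_derivative deriv \<phi> (of_plane x)) (at (of_plane x))"
      using U xU by (metis holomorphic_derivI)
    then have "(\<phi> has_derivative (\<lambda>h. deriv \<phi> (of_plane x) * h)) (at (of_plane x))"
      by (simp add: has_field_derivative_def)
    then have "((\<lambda>x. \<phi> (of_plane x)) has_derivative (\<lambda>h. deriv \<phi> (of_plane x) * of_plane h)) (at x)"
      by (rule has_derivative_compose[OF bounded_linear_imp_has_derivative[OF bl1(2)]])
    then have "(F has_derivative F' x) (at x)"
      unfolding F_def F'_def by (rule bounded_linear.has_derivative[OF bl1(1)])
    then show ?thesis by (rule has_derivative_at_withinI)
  qed
  have inj: "inj_on F S"
  proof (rule inj_onI)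
    fix x y assume "x \<in> S" "y \<in> S" "F x = F y"
    then have "\<phi> (of_plane x) = \<phi> (of_plane y)" unfolding F_def by (metis of_to_plane)
    moreover have "of_plane x \<in> U" "of_plane y \<in> U"
      using E(2) \<open>x \<in> S\<close> \<open>y \<in> S\<close> by (auto simp: S_def)
    ultimately have "of_plane x = of_plane y" by (rule inj_onD[OF U(3)])
    then have "to_plane (of_plane x) = to_plane (of_plane y)" by (rule arg_cong)
    then show "x = y" unfolding to_of_plane .
  qed
  have detF: "\<bar>det (matrix (F' x))\<bar> = (cmod (deriv \<phi> (of_plane x)))\<^sup>2" for x
    unfolding F'_def det_plane_mult by simp
  have "S \<in> sets lebesgue" using Sb by simp
  from has_measure_differentiable_image[OF this der inj]
  have key: "F ` S \<in> lmeasurable \<and> measure lebesgue (F ` S) = m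
     \<longleftrightarrow> ((\<lambda>x. (cmod (deriv \<phi> (of_plane x)))\<^sup>2) has_integral m) S" for m
    unfolding detF .
  have memS: "x \<in> S \<longleftrightarrow> of_plane x \<in> E" for x
    unfolding S_def using to_of_plane[of x] of_to_plane by force
  have Jres: "(\<lambda>x. J (of_plane x)) = (\<lambda>x. if x \<in> S then (cmod (deriv \<phi> (of_plane x)))\<^sup>2 else 0)"
    by (simp add: J_def memS fun_eq_iff indicator_def)
  have key2: "F ` S \<in> lmeasurable \<and> measure lebesgue (F ` S) = m
     \<longleftrightarrow> ((\<lambda>x. J (of_plane x)) has_integral m) UNIV" for m
    unfolding key Jres by (rule has_integral_restrict_UNIV[symmetric])
  have "continuous_on U (deriv \<phi>)"
    by (intro holomorphic_on_imp_continuous_on holomorphic_deriv U)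
  then have "(\<lambda>z. indicator U z *\<^sub>R deriv \<phi> z) \<in> borel_measurable borel"
    by (rule borel_measurable_continuous_on_indicator[rotated]) (use U in auto)
  then have mJ: "(\<lambda>z. (cmod (indicator U z *\<^sub>R deriv \<phi> z))\<^sup>2 * indicator E z) \<in> borel_measurable borel"
    using E by measurable
  have JU: "J z = (cmod (indicator U z *\<^sub>R deriv \<phi> z))\<^sup>2 * indicator E z" for z
    unfolding J_def using E(2) by (cases "z \<in> E") (auto simp: indicator_def)
  have [measurable]: "J \<in> borel_measurable borel" using mJ unfolding JU[symmetric] .
  have J0: "J z \<ge> 0" for z by (simp add: J_def)
  have em: "emeasure lborel (\<phi> ` E) = emeasure lebesgue (F ` S)"
  proof -
    have "emeasure lebesgue (F ` S) = emeasure lborel (F ` S)"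
      by (simp add: FSb)
    then show ?thesis by (simp only: FS emeasure_to_plane_image(1)[OF phiE])
  qed
  have Ieq: "(\<integral>\<^sup>+z. J z \<partial>lborel) = (\<integral>\<^sup>+x. J (of_plane x) \<partial>lborel)"
    by (rule nn_integral_to_plane[symmetric]) simp
  show ?thesis
  proof (cases "emeasure lebesgue (F ` S) < \<infinity>")
    case True
    then have "F ` S \<in> lmeasurable" using FSb by (simp add: fmeasurable_def)
    then have hi: "((\<lambda>x. J (of_plane x)) has_integral measure lebesgue (F ` S)) UNIV"
      using key2 by blast
    have "(\<integral>\<^sup>+x. J (of_plane x) \<partial>lborel) = measure lebesgue (F ` S)"
      by (rule nn_integral_has_integral_lborel[OF _ _ hi]) (auto simp: J0)
    also have "\<dots> = emeasure lebesgue (F ` S)"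
      using True by (simp add: emeasure_eq_ennreal_measure)
    finally show ?thesis using em Ieq unfolding J_def by (simp only:)
  next
    case False
    have "(\<integral>\<^sup>+x. J (of_plane x) \<partial>lborel) = \<infinity>"
    proof (rule ccontr)
      assume "(\<integral>\<^sup>+x. J (of_plane x) \<partial>lborel) \<noteq> \<infinity>"
      then obtain m where m: "(\<integral>\<^sup>+x. J (of_plane x) \<partial>lborel) = ennreal m" "0 \<le> m"
        by (cases "\<integral>\<^sup>+x. J (of_plane x) \<partial>lborel") auto
      have "((\<lambda>x. J (of_plane x)) has_integral m) UNIV"
        by (rule nn_integral_has_integral) (use m J0 in auto)
      then have "F ` S \<in> lmeasurable" using key2 by blast
      then have "emeasure lebesgue (F ` S) \<noteq> top" by (rule fmeasurableD2)
      then show False using False unfolding infinity_ennreal_def by (metis top.not_eq_extremum)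
    qed
    then show ?thesis using em Ieq False unfolding J_def infinity_ennreal_def by (metis top.not_eq_extremum)
  qed
qed

text \<open>The measure with density \<open>|\<phi>'|\<^sup>2\<close> on \<open>U\<close> and the image of Lebesgue measure on \<open>\<phi> ` U\<close> under the
  inverse \<open>g\<close> agree on Borel sets; integrating \<open>G\<close> against both gives the substitution rule.\<close>

lemma nn_integral_injective_holomorphic:
  assumes U: "open U" "\<phi> holomorphic_on U" "inj_on \<phi> U"
    and g: "\<And>z. z \<in> U \<Longrightarrow> g (\<phi> z) = z"
    and G [measurable]: "G \<in> borel_measurable borel"
  shows "(\<integral>\<^sup>+z. G z * (ennreal ((cmod (deriv \<phi> z))\<^sup>2) * indicator U z) \<partial>lborel) =
         (\<integral>\<^sup>+w. G (g w) * indicator (\<phi> ` U) w \<partial>lborel)"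
    and "(\<lambda>w. if w \<in> \<phi> ` U then g w else 0) \<in> borel_measurable borel"
proof -
  define g0 where "g0 = (\<lambda>w. if w \<in> \<phi> ` U then g w else 0)"
  have op: "open (\<phi> ` U)" using open_mapping_thm3[OF U(2,1,3)] .
  obtain g1 where g1: "g1 holomorphic_on (\<phi> ` U)" "\<And>z. z \<in> U \<Longrightarrow> g1 (\<phi> z) = z"
    using holomorphic_has_inverse[OF U(2,1,3)] by metis
  have "continuous_on (\<phi> ` U) g1" using g1(1) by (rule holomorphic_on_imp_continuous_on)
  then have "(\<lambda>w. indicator (\<phi> ` U) w *\<^sub>R g1 w) \<in> borel_measurable borel"
    by (rule borel_measurable_continuous_on_indicator[rotated]) (use op in auto)
  also have "(\<lambda>w. indicator (\<phi> ` U) w *\<^sub>R g1 w) = g0"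
    using g g1 by (auto simp: g0_def fun_eq_iff indicator_def)
  finally have [measurable]: "g0 \<in> borel_measurable borel" .
  then show "(\<lambda>w. if w \<in> \<phi> ` U then g w else 0) \<in> borel_measurable borel"
    unfolding g0_def .
  have "continuous_on U (deriv \<phi>)"
    by (intro holomorphic_on_imp_continuous_on holomorphic_deriv U)
  then have "(\<lambda>z. indicator U z *\<^sub>R deriv \<phi> z) \<in> borel_measurable borel"
    by (rule borel_measurable_continuous_on_indicator[rotated]) (use U in auto)
  then have "(\<lambda>z. ennreal ((cmod (indicator U z *\<^sub>R deriv \<phi> z))\<^sup>2)) \<in> borel_measurable borel"
    by measurable
  also have "(\<lambda>z. ennreal ((cmod (indicator U z *\<^sub>R deriv \<phi> z))\<^sup>2)) =
     (\<lambda>z. ennreal ((cmod (deriv \<phi> z))\<^sup>2) * indicator U z)"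
    by (auto simp: fun_eq_iff indicator_def)
  finally have [measurable]: "(\<lambda>z. ennreal ((cmod (deriv \<phi> z))\<^sup>2) * indicator U z) \<in> borel_measurable borel" .
  have [measurable]: "\<phi> ` U \<in> sets borel" using op by simp
  let ?A = "density lborel (\<lambda>z. ennreal ((cmod (deriv \<phi> z))\<^sup>2) * indicator U z)"
  let ?B = "distr (density lborel (indicator (\<phi> ` U))) borel g0"
  have "?A = ?B"
  proof (rule measure_eqI)
    fix E assume "E \<in> sets ?A"
    then have E [measurable]: "E \<in> sets borel" by simp
    have g0E: "g0 -` E \<in> sets borel"
      using measurable_sets[OF \<open>g0 \<in> borel_measurable borel\<close> E] by simp
    have EU: "E \<inter> U \<in> sets borel" "E \<inter> U \<subseteq> U" using U(1) by auto
    have "emeasure ?A E = (\<integral>\<^sup>+z. ennreal ((cmod (deriv \<phi> z))\<^sup>2 * indicator (E \<inter> U) z) \<partial>lborel)"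
      by (subst emeasure_density) (auto intro!: nn_integral_cong split: split_indicator)
    also have "\<dots> = emeasure lborel (\<phi> ` (E \<inter> U))"
      by (rule emeasure_injective_holomorphic_image[OF U EU, symmetric])
    also have "\<phi> ` (E \<inter> U) = g0 -` E \<inter> \<phi> ` U" using g by (auto simp: g0_def)
    also have "emeasure lborel \<dots> = (\<integral>\<^sup>+z. indicator (g0 -` E \<inter> \<phi> ` U) z \<partial>lborel)"
      using g0E by (subst nn_integral_indicator) auto
    also have "\<dots> = (\<integral>\<^sup>+z. indicator (\<phi> ` U) z * indicator (g0 -` E) z \<partial>lborel)"
      by (intro nn_integral_cong) (auto split: split_indicator)
    also have "\<dots> = emeasure ?B E"
      using g0E by (simp add: emeasure_distr emeasure_density)
    finally show "emeasure ?A E = emeasure ?B E" .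
  qed simp
  then have "(\<integral>\<^sup>+z. G z \<partial>?A) = (\<integral>\<^sup>+z. G z \<partial>?B)" by simp
  moreover have "(\<integral>\<^sup>+z. G z \<partial>?A) =
    (\<integral>\<^sup>+z. G z * (ennreal ((cmod (deriv \<phi> z))\<^sup>2) * indicator U z) \<partial>lborel)"
    by (subst nn_integral_density) (auto simp: mult.commute[of "G _"])
  moreover have "(\<integral>\<^sup>+z. G z \<partial>?B) = (\<integral>\<^sup>+w. indicator (\<phi> ` U) w * G (g0 w) \<partial>lborel)"
    by (simp add: nn_integral_distr nn_integral_density)
  moreover have "(\<integral>\<^sup>+w. indicator (\<phi> ` U) w * G (g0 w) \<partial>lborel) =
    (\<integral>\<^sup>+w. G (g w) * indicator (\<phi> ` U) w \<partial>lborel)"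
    by (intro nn_integral_cong) (auto simp: g0_def indicator_def)
  ultimately show "(\<integral>\<^sup>+z. G z * (ennreal ((cmod (deriv \<phi> z))\<^sup>2) * indicator U z) \<partial>lborel) =
    (\<integral>\<^sup>+w. G (g w) * indicator (\<phi> ` U) w \<partial>lborel)" by metis
qed

section \<open>The area formula\<close>

lemma zorder_simple:
  assumes "open S" "z \<in> S" "\<phi> holomorphic_on S" "deriv \<phi> z \<noteq> 0"
  shows "zorder (\<lambda>u. \<phi> u - \<phi> z) z = 1"
proof (rule zorder_zero_eqI)
  show "(\<lambda>u. \<phi> u - \<phi> z) holomorphic_on S" by (intro holomorphic_intros assms)
  have "\<phi> field_differentiable at z" using assms by (metis holomorphic_on_imp_differentiable_at)
  then have "deriv (\<lambda>u. \<phi> u - \<phi> z) z = deriv \<phi> z" by simp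
  then show "(deriv ^^ nat 1) (\<lambda>u. \<phi> u - \<phi> z) z \<noteq> 0" using assms(4) by simp
qed (use assms in auto)

text \<open>Points of the fibre count with their multiplicities. For \<open>h(z) = (1 - |z|\<^sup>2)\<^sup>\<alpha>\<close> on the disk it
  is the counting function.\<close>

definition valency_sum :: "complex set \<Rightarrow> (complex \<Rightarrow> complex) \<Rightarrow> (complex \<Rightarrow> ennreal) \<Rightarrow> complex \<Rightarrow> ennreal" where
  "valency_sum \<Omega> \<phi> h w = (\<Sum>\<^sub>\<infinity>z\<in>{z \<in> \<Omega>. \<phi> z = w}. of_nat (nat (zorder (\<lambda>u. \<phi> u - w) z)) * h z)"

lemma infsum_ennreal_eq_suminf: "infsum (f :: nat \<Rightarrow> ennreal) UNIV = suminf f"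
  by (intro sums_unique has_sum_imp_sums has_sum_infsum nonneg_summable_on_complete) simp

text \<open>Lindelof's theorem extracts a countable family from the collection of all open sets of
  injectivity. The empty set is added only so that the family can be enumerated.\<close>

lemma locally_injective_cover:
  assumes "open \<Omega>" "\<phi> holomorphic_on \<Omega>"
  obtains U :: "nat \<Rightarrow> complex set" where "\<And>i. open (U i)" "\<And>i. U i \<subseteq> \<Omega>" "\<And>i. inj_on \<phi> (U i)"
    "{z \<in> \<Omega>. deriv \<phi> z \<noteq> 0} \<subseteq> (\<Union>i. U i)"
proof -
  define F where "F = {V. open V \<and> V \<subseteq> \<Omega> \<and> inj_on \<phi> V}"
  obtain F' where F': "F' \<subseteq> F" "countable F'" "\<Union>F' = \<Union>F"
    by (rule Lindelof[of F]) (auto simp: F_def)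
  define U where "U = from_nat_into (insert {} F')"
  have rU: "range U = insert {} F'"
    unfolding U_def by (rule range_from_nat_into) (use F' in auto)
  have "U i \<in> F" for i
    using rU F'(1) by (metis (no_types, lifting) F_def empty_subsetI inj_on_empty insert_iff mem_Collect_eq open_empty rangeI subsetD)
  moreover have "{z \<in> \<Omega>. deriv \<phi> z \<noteq> 0} \<subseteq> (\<Union>i. U i)"
  proof
    fix z assume "z \<in> {z \<in> \<Omega>. deriv \<phi> z \<noteq> 0}"
    then obtain r where "r > 0" "ball z r \<subseteq> \<Omega>" "inj_on \<phi> (ball z r)"
      using has_complex_derivative_locally_injective[OF assms(2) _ assms(1), of z] by auto
    then have "z \<in> \<Union>F" unfolding F_def by (auto intro!: exI[of _ "ball z r"])
    then show "z \<in> (\<Union>i. U i)" using rU F'(3) by auto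
  qed
  ultimately show ?thesis by (intro that[of U]) (auto simp: F_def)
qed

lemma open_imp_fsigma:
  fixes S :: "'a::euclidean_space set"
  assumes "open S"
  shows "fsigma S"
proof -
  obtain D where D: "countable D" "\<And>X. X \<in> D \<Longrightarrow> \<exists>a b. X = cbox a b" "\<Union>D = S"
    using open_countable_Union_open_cbox[OF assms] by metis
  define F where "F = from_nat_into (insert {} D)"
  have r: "range F = insert {} D"
    unfolding F_def by (rule range_from_nat_into) (use D in auto)
  have "closed (F n)" for n
  proof -
    have "F n \<in> insert {} D" using r by blast
    then show ?thesis using D(2)[of "F n"] closed_cbox by auto
  qed
  then have "fsigma (\<Union>(F ` UNIV))" by (rule fsigma.intros)
  then show ?thesis using r D(3) by simp
qed

lemma critical_points_countable:
  assumes "open \<Omega>" "connected \<Omega>" "\<phi> holomorphic_on \<Omega>" "\<not> \<phi> constant_on \<Omega>"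
  shows "countable {z \<in> \<Omega>. deriv \<phi> z = 0}"
proof (cases "deriv \<phi> constant_on \<Omega>")
  case True
  then obtain c where c: "\<And>z. z \<in> \<Omega> \<Longrightarrow> deriv \<phi> z = c" by (auto simp: constant_on_def)
  have "c \<noteq> 0"
  proof
    assume "c = 0"
    then have "\<And>z. z \<in> \<Omega> \<Longrightarrow> (\<phi> has_field_derivative 0) (at z)"
      using c assms by (metis holomorphic_derivI)
    then show False
      using has_field_derivative_0_imp_constant_on[of \<Omega> \<phi>] assms by auto
  qed
  then show ?thesis using c by (metis (mono_tags, lifting) countable_empty empty_Collect_eq)
next
  case False
  then show ?thesis
    using assms by (intro holomorphic_countable_zeros holomorphic_deriv open_imp_fsigma) auto
qed

text \<open>Cut the complement of the critical points into countably many disjoint Borel pieces \<open>E i\<close> on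
  which \<open>\<phi>\<close> is injective. If \<open>w\<close> is not a critical value, each point above \<open>w\<close> has multiplicity one and
  lies in exactly one piece, so the fibre sum is a countable sum of Borel functions, and the
  substitution rule applies to each piece. Critical points do not contribute to the left-hand side
  because \<open>\<phi>'\<close> vanishes there, and the critical values form a countable, hence null, set.\<close>

theorem area_formula:
  assumes \<Omega>: "open \<Omega>" "connected \<Omega>" "\<phi> holomorphic_on \<Omega>" "\<not> \<phi> constant_on \<Omega>"
    and h [measurable]: "h \<in> borel_measurable borel"
  shows "valency_sum \<Omega> \<phi> h \<in> borel_measurable borel"
    and "\<And>F. F \<in> borel_measurable borel \<Longrightarrow>
      (\<integral>\<^sup>+z. F (\<phi> z) * h z * ennreal ((cmod (deriv \<phi> z))\<^sup>2) * indicator \<Omega> z \<partial>lborel) =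
      (\<integral>\<^sup>+w. F w * valency_sum \<Omega> \<phi> h w \<partial>lborel)"
proof -
  define Crit where "Crit = {z \<in> \<Omega>. deriv \<phi> z = 0}"
  have Crit: "countable Crit" unfolding Crit_def by (rule critical_points_countable[OF \<Omega>])
  obtain U :: "nat \<Rightarrow> complex set" where U: "\<And>i. open (U i)" "\<And>i. U i \<subseteq> \<Omega>" "\<And>i. inj_on \<phi> (U i)"
    and cover: "{z \<in> \<Omega>. deriv \<phi> z \<noteq> 0} \<subseteq> (\<Union>i. U i)"
    using locally_injective_cover[OF \<Omega>(1,3)] by metis
  have holU: "\<phi> holomorphic_on U i" for i using \<Omega>(3) U(2) by (rule holomorphic_on_subset)
  define g where "g = (\<lambda>i. inv_into (U i) \<phi>)"
  have g: "g i (\<phi> z) = z" if "z \<in> U i" for i z using U(3) that by (simp add: g_def)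
  have g': "g i w \<in> U i" "\<phi> (g i w) = w" if "w \<in> \<phi> ` U i" for i w
    using that unfolding g_def by (auto intro: inv_into_into f_inv_into_f)
  have g\<Omega>: "g i w \<in> \<Omega>" if "w \<in> \<phi> ` U i" for i w
    using g'(1)[OF that] U(2)[of i] by blast
  define E where "E = (\<lambda>i. disjointed U i - Crit)"
  have EU: "E i \<subseteq> U i" for i using disjointed_subset[of U i] by (auto simp: E_def)
  have Eb [measurable]: "E i \<in> sets borel" for i
  proof -
    have "range (disjointed U) \<subseteq> sets borel" by (rule sets.range_disjointed_sets) (use U in auto)
    moreover have "Crit \<in> sets borel" by (rule sets.countable[OF _ Crit]) auto
    ultimately show ?thesis by (auto simp: E_def)
  qed
  have UE: "(\<Union>i. E i) = \<Omega> - Crit"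
  proof -
    have "(\<Union>i. E i) = (\<Union>i. disjointed U i) - Crit" by (auto simp: E_def)
    also have "\<dots> = \<Omega> - Crit" using cover U(2) unfolding UN_disjointed_eq by (auto simp: Crit_def)
    finally show ?thesis .
  qed
  have disj: "i = j" if "z \<in> E i" "z \<in> E j" for i j z
    using disjoint_family_disjointed[of U] that unfolding E_def disjoint_family_on_def by auto
  \<comment> \<open>the local inverses, extended by zero to Borel functions on the plane\<close>
  define G where "G = (\<lambda>i w. if w \<in> \<phi> ` U i then g i w else 0)"
  have Gm [measurable]: "G i \<in> borel_measurable borel" for i
    unfolding G_def by (rule nn_integral_injective_holomorphic(2)[OF U(1) holU U(3) g measurable_const[of 0]]) auto
  have opU: "open (\<phi> ` U i)" for i using open_mapping_thm3[OF holU U(1) U(3)] .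
  then have [measurable]: "\<phi> ` U i \<in> sets borel" for i by auto
  define S0 where "S0 = (\<lambda>w. \<Sum>i. h (g i w) * indicator (E i) (g i w) * indicator (\<phi> ` U i) w)"
  have S0_alt: "S0 w = (\<Sum>i. h (G i w) * indicator (E i) (G i w) * indicator (\<phi> ` U i) w)" for w
    unfolding S0_def by (intro suminf_cong) (auto simp: G_def indicator_def)
  have S0m [measurable]: "S0 \<in> borel_measurable borel"
    unfolding S0_alt[abs_def] by measurable
  have S_eq: "valency_sum \<Omega> \<phi> h w = S0 w" if w: "w \<notin> \<phi> ` Crit" for w
  proof -
    define I where "I = {i. w \<in> \<phi> ` U i \<and> g i w \<in> E i}"
    have bij: "bij_betw (\<lambda>i. g i w) I {z \<in> \<Omega>. \<phi> z = w}"
    proof (rule bij_betwI')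
      fix i j assume "i \<in> I" "j \<in> I"
      then show "(g i w = g j w) = (i = j)" using disj by (auto simp: I_def)
    next
      fix i assume "i \<in> I"
      then show "g i w \<in> {z \<in> \<Omega>. \<phi> z = w}" using g'[of w i] U(2)[of i] by (auto simp: I_def)
    next
      fix z assume z: "z \<in> {z \<in> \<Omega>. \<phi> z = w}"
      then have "z \<in> \<Omega> - Crit" using w by auto
      then obtain i where i: "z \<in> E i" using UE by auto
      then have "z \<in> U i" using EU by auto
      moreover from this have "w \<in> \<phi> ` U i" using z by blast
      moreover from \<open>z \<in> U i\<close> have "g i w = z" using z g[of z i] by simp
      ultimately have "i \<in> I" "z = g i w" using z i by (auto simp: I_def)
      then show "\<exists>i\<in>I. z = g i w" by blast
    qed
    have "valency_sum \<Omega> \<phi> h w = (\<Sum>\<^sub>\<infinity>z\<in>{z \<in> \<Omega>. \<phi> z = w}. h z)"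
      unfolding valency_sum_def
    proof (rule infsum_cong)
      fix z assume z: "z \<in> {z \<in> \<Omega>. \<phi> z = w}"
      then have "deriv \<phi> z \<noteq> 0" using w by (auto simp: Crit_def)
      then have "zorder (\<lambda>u. \<phi> u - w) z = 1" using zorder_simple[OF \<Omega>(1) _ \<Omega>(3)] z by auto
      then show "of_nat (nat (zorder (\<lambda>u. \<phi> u - w) z)) * h z = h z" by simp
    qed
    also have "\<dots> = (\<Sum>\<^sub>\<infinity>i\<in>I. h (g i w))" by (rule infsum_reindex_bij_betw[OF bij, symmetric])
    also have "\<dots> = (\<Sum>\<^sub>\<infinity>i. h (g i w) * indicator (E i) (g i w) * indicator (\<phi> ` U i) w)"
      by (rule infsum_cong_neutral) (auto simp: I_def)
    also have "\<dots> = S0 w" unfolding S0_def by (rule infsum_ennreal_eq_suminf)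
    finally show ?thesis .
  qed
  show Sm: "valency_sum \<Omega> \<phi> h \<in> borel_measurable borel"
    by (rule measurable_discrete_difference[OF S0m, of "\<phi> ` Crit"]) (use Crit S_eq in auto)
  fix F :: "complex \<Rightarrow> ennreal" assume F [measurable]: "F \<in> borel_measurable borel"
  define \<phi>0 where "\<phi>0 = (\<lambda>z. if z \<in> \<Omega> then \<phi> z else 0)"
  have "(\<lambda>z. indicator \<Omega> z *\<^sub>R \<phi> z) \<in> borel_measurable borel"
    by (rule borel_measurable_continuous_on_indicator) (use \<Omega> in \<open>auto intro: holomorphic_on_imp_continuous_on\<close>)
  also have "(\<lambda>z. indicator \<Omega> z *\<^sub>R \<phi> z) = \<phi>0" by (auto simp: \<phi>0_def fun_eq_iff indicator_def)
  finally have [measurable]: "\<phi>0 \<in> borel_measurable borel" .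
  have "(\<lambda>z. indicator \<Omega> z *\<^sub>R deriv \<phi> z) \<in> borel_measurable borel"
    by (rule borel_measurable_continuous_on_indicator)
       (use \<Omega> in \<open>auto intro!: holomorphic_on_imp_continuous_on holomorphic_deriv\<close>)
  then have dm: "(\<lambda>z. ennreal ((cmod (indicator \<Omega> z *\<^sub>R deriv \<phi> z))\<^sup>2)) \<in> borel_measurable borel"
    by measurable
  let ?J = "\<lambda>z. ennreal ((cmod (indicator \<Omega> z *\<^sub>R deriv \<phi> z))\<^sup>2)"
  note [measurable] = dm
  have ind: "indicator \<Omega> z * ?J z = (\<Sum>i. indicator (E i) z * ?J z)" for z
  proof (cases "z \<in> \<Omega> - Crit")
    case True
    then obtain i where i: "z \<in> E i" using UE by auto
    then have "(\<lambda>j. indicator (E j) z * ?J z) = (\<lambda>j. if j = i then ?J z else 0)"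
      using disj by (auto simp: fun_eq_iff indicator_def)
    then show ?thesis using True sums_unique[OF sums_single[of i "\<lambda>_. ?J z"]] by simp
  next
    case False
    then show ?thesis using UE by (auto simp: indicator_def Crit_def)
  qed
  have "(\<integral>\<^sup>+z. F (\<phi> z) * h z * ennreal ((cmod (deriv \<phi> z))\<^sup>2) * indicator \<Omega> z \<partial>lborel)
      = (\<integral>\<^sup>+z. F (\<phi>0 z) * h z * (indicator \<Omega> z * ?J z) \<partial>lborel)"
    by (intro nn_integral_cong) (auto simp: \<phi>0_def indicator_def)
  also have "\<dots> = (\<integral>\<^sup>+z. (\<Sum>i. F (\<phi>0 z) * h z * (indicator (E i) z * ?J z)) \<partial>lborel)"
    unfolding ind by simp
  also have "\<dots> = (\<Sum>i. \<integral>\<^sup>+z. F (\<phi>0 z) * h z * (indicator (E i) z * ?J z) \<partial>lborel)"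
    by (rule nn_integral_suminf) measurable
  also have "\<dots> = (\<Sum>i. \<integral>\<^sup>+w. F w * (h (G i w) * indicator (E i) (G i w) * indicator (\<phi> ` U i) w) \<partial>lborel)"
  proof (rule suminf_cong)
    fix i
    have "(\<integral>\<^sup>+z. F (\<phi>0 z) * h z * (indicator (E i) z * ?J z) \<partial>lborel) =
      (\<integral>\<^sup>+z. (F (\<phi>0 z) * h z * indicator (E i) z) * (ennreal ((cmod (deriv \<phi> z))\<^sup>2) * indicator (U i) z) \<partial>lborel)"
      using EU[of i] U(2)[of i] by (intro nn_integral_cong) (auto simp: indicator_def)
    also have "\<dots> = (\<integral>\<^sup>+w. (F (\<phi>0 (g i w)) * h (g i w) * indicator (E i) (g i w)) * indicator (\<phi> ` U i) w \<partial>lborel)"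
      by (rule nn_integral_injective_holomorphic[OF U(1) holU U(3) g]) auto
    also have "\<dots> = (\<integral>\<^sup>+w. F w * (h (G i w) * indicator (E i) (G i w) * indicator (\<phi> ` U i) w) \<partial>lborel)"
    proof (rule nn_integral_cong)
      fix w
      show "(F (\<phi>0 (g i w)) * h (g i w) * indicator (E i) (g i w)) * indicator (\<phi> ` U i) w =
        F w * (h (G i w) * indicator (E i) (G i w) * indicator (\<phi> ` U i) w)"
        using g'(2)[of w i] g\<Omega>[of w i]
        by (cases "w \<in> \<phi> ` U i") (simp_all add: G_def \<phi>0_def mult.assoc)
    qed
    finally show "(\<integral>\<^sup>+z. F (\<phi>0 z) * h z * (indicator (E i) z * ?J z) \<partial>lborel) = \<dots>" .
  qed
  also have "\<dots> = (\<integral>\<^sup>+w. (\<Sum>i. F w * (h (G i w) * indicator (E i) (G i w) * indicator (\<phi> ` U i) w)) \<partial>lborel)"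
    by (rule nn_integral_suminf[symmetric]) measurable
  also have "\<dots> = (\<integral>\<^sup>+w. F w * S0 w \<partial>lborel)" by (simp add: S0_alt)
  also have "\<dots> = (\<integral>\<^sup>+w. F w * valency_sum \<Omega> \<phi> h w \<partial>lborel)"
  proof (rule nn_integral_cong_AE)
    have "AE w in lborel. w \<notin> \<phi> ` Crit"
      using Crit by (intro AE_not_in countable_imp_null_set_lborel) auto
    then show "AE w in lborel. F w * S0 w = F w * valency_sum \<Omega> \<phi> h w"
      by eventually_elim (simp add: S_eq)
  qed
  finally show "(\<integral>\<^sup>+z. F (\<phi> z) * h z * ennreal ((cmod (deriv \<phi> z))\<^sup>2) * indicator \<Omega> z \<partial>lborel) =
      (\<integral>\<^sup>+w. F w * valency_sum \<Omega> \<phi> h w \<partial>lborel)" .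
qed

section \<open>The weighted area measure\<close>

text \<open>The density of \<open>warea \<alpha>\<close> with respect to Lebesgue measure.\<close>

definition wdens :: "real \<Rightarrow> complex \<Rightarrow> ennreal" where
  "wdens \<alpha> z = ennreal ((1 + \<alpha>) / pi * (1 - (cmod z)\<^sup>2) powr \<alpha>)"

lemma wdens_measurable [measurable]: "wdens \<alpha> \<in> borel_measurable borel"
  unfolding wdens_def by measurable

lemma space_warea [simp]: "space (warea \<alpha>) = disk"
  by (simp add: warea_def area_def space_restrict_space space_scale_measure)

lemma sets_warea [simp, measurable_cong]: "sets (warea \<alpha>) = sets (restrict_space borel disk)"
  by (simp add: warea_def area_def sets_restrict_space)

lemma measurable_warea [measurable (raw)]:
  "f \<in> borel_measurable borel \<Longrightarrow> f \<in> borel_measurable (warea \<alpha>)"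
  by (subst measurable_cong_sets[OF sets_warea refl]) (rule measurable_restrict_space1)

lemma in_sets_warea: "E \<in> sets (warea \<alpha>) \<longleftrightarrow> E \<in> sets borel \<and> E \<subseteq> disk"
  by (auto simp: sets_restrict_space_iff)

lemma sets_area [simp, measurable_cong]: "sets area = sets (restrict_space borel disk)"
  by (simp add: area_def sets_restrict_space)

lemma measurable_area [measurable (raw)]:
  "f \<in> borel_measurable borel \<Longrightarrow> f \<in> borel_measurable area"
  by (subst measurable_cong_sets[OF sets_area refl]) (rule measurable_restrict_space1)

lemma nn_integral_area:
  assumes [measurable]: "f \<in> borel_measurable borel"
  shows "(\<integral>\<^sup>+z. f z \<partial>area) = (\<integral>\<^sup>+z. ennreal (1 / pi) * f z * indicator disk z \<partial>lborel)"
proof -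
  have "disk \<in> sets (borel :: complex measure)" by simp
  then have m: "(\<lambda>z. f z * indicator disk z) \<in> borel_measurable lborel" by measurable
  have "(\<integral>\<^sup>+z. f z \<partial>area) = ennreal (1 / pi) * (\<integral>\<^sup>+z. f z \<partial>restrict_space lborel disk)"
    unfolding area_def by (intro nn_integral_scale_measure measurable_restrict_space1) simp
  also have "\<dots> = (\<integral>\<^sup>+z. ennreal (1 / pi) * (f z * indicator disk z) \<partial>lborel)"
    by (subst nn_integral_restrict_space, simp, rule nn_integral_cmult[symmetric]) (rule m)
  finally show ?thesis by (simp add: mult.assoc)
qed

lemma nn_integral_warea:
  assumes "\<alpha> > -1" "f \<in> borel_measurable borel"
  shows "(\<integral>\<^sup>+z. f z \<partial>warea \<alpha>) = (\<integral>\<^sup>+z. f z * wdens \<alpha> z * indicator disk z \<partial>lborel)"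
proof -
  note [measurable] = assms(2)
  have "(\<integral>\<^sup>+z. f z \<partial>warea \<alpha>) = (\<integral>\<^sup>+z. ennreal ((1 + \<alpha>) * (1 - (cmod z)\<^sup>2) powr \<alpha>) * f z \<partial>area)"
    unfolding warea_def by (intro nn_integral_density) measurable
  also have "\<dots> = (\<integral>\<^sup>+z. ennreal (1 / pi) * (ennreal ((1 + \<alpha>) * (1 - (cmod z)\<^sup>2) powr \<alpha>) * f z) * indicator disk z \<partial>lborel)"
    by (rule nn_integral_area) measurable
  also have "\<dots> = (\<integral>\<^sup>+z. f z * wdens \<alpha> z * indicator disk z \<partial>lborel)"
  proof (rule nn_integral_cong)
    fix z :: complex
    have "wdens \<alpha> z = ennreal (1 / pi) * ennreal ((1 + \<alpha>) * (1 - (cmod z)\<^sup>2) powr \<alpha>)"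
      unfolding wdens_def using assms(1) by (subst ennreal_mult[symmetric]) auto
    then show "ennreal (1 / pi) * (ennreal ((1 + \<alpha>) * (1 - (cmod z)\<^sup>2) powr \<alpha>) * f z) * indicator disk z =
       f z * wdens \<alpha> z * indicator disk z" by (simp add: mult_ac)
  qed
  finally show ?thesis .
qed

lemma disk_analytic_borel:
  assumes "f \<in> disk_analytic" shows "f \<in> borel_measurable borel"
proof -
  have "(\<lambda>z. indicator disk z *\<^sub>R f z) \<in> borel_measurable borel"
    by (rule borel_measurable_continuous_on_indicator)
       (use assms in \<open>auto simp: disk_analytic_def intro: holomorphic_on_imp_continuous_on\<close>)
  also have "(\<lambda>z. indicator disk z *\<^sub>R f z) = f"
    using assms by (auto simp: disk_analytic_def fun_eq_iff indicator_def)
  finally show ?thesis .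
qed

lemma on_disk_analytic: "f holomorphic_on disk \<Longrightarrow> on_disk f \<in> disk_analytic"
  unfolding disk_analytic_def
  using holomorphic_transform[of f disk "on_disk f"] by (auto simp: on_disk_def)

lemma holomorphic_measurable_warea:
  assumes "f holomorphic_on disk" shows "f \<in> borel_measurable (warea \<alpha>)"
proof -
  have "on_disk f \<in> borel_measurable (warea \<alpha>)"
    using disk_analytic_borel[OF on_disk_analytic[OF assms]] by measurable
  then show ?thesis
    by (rule measurable_cong[THEN iffD1, rotated]) (auto simp: on_disk_def)
qed

text \<open>On the dyadic annulus \<open>2\<^sup>-\<^sup>n\<^sup>-\<^sup>1 < 1 - |z|\<^sup>2 \<le> 2\<^sup>-\<^sup>n\<close>, whose area is proportional to \<open>2\<^sup>-\<^sup>n\<close>, the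
  weight is at most a constant times \<open>2\<^sup>-\<^sup>n\<^sup>\<alpha>\<close>. The resulting geometric series converges because
  \<open>1 + \<alpha> > 0\<close>.\<close>

lemma warea_finite:
  assumes "\<alpha> > -1"
  shows "emeasure (warea \<alpha>) disk < \<infinity>"
proof -
  \<comment> \<open>\<open>A n\<close> is the annulus \<open>a (Suc n) < 1 - |z|\<^sup>2 \<le> a n\<close>, written as a difference of disks\<close>
  define a where "a = (\<lambda>n. (1/2 :: real) ^ n)"
  define B where "B = (\<lambda>n. ball (0::complex) (sqrt (1 - a n)))"
  define A where "A = (\<lambda>n. B (Suc n) - B n)"
  have a: "0 < a n" "a n \<le> 1" "a (Suc n) = a n / 2" for n by (auto simp: a_def power_le_one)
  have Bm: "z \<in> B n \<longleftrightarrow> a n < 1 - (cmod z)\<^sup>2" for z n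
  proof -
    have "z \<in> B n \<longleftrightarrow> cmod z < sqrt (1 - a n)" by (simp add: B_def)
    also have "\<dots> \<longleftrightarrow> (cmod z)\<^sup>2 < 1 - a n" using real_sqrt_less_iff[of "(cmod z)\<^sup>2" "1 - a n"] by simp
    finally show ?thesis by linarith
  qed
  have cover: "\<exists>n. z \<in> A n" if "z \<in> disk" for z
  proof -
    have p: "0 < 1 - (cmod z)\<^sup>2" using that by (simp add: abs_square_less_1)
    then obtain n where n: "a n < 1 - (cmod z)\<^sup>2" unfolding a_def using real_arch_pow_inv[OF p, of "1/2"] by auto
    define m where "m = (LEAST n. z \<in> B n)"
    have m: "z \<in> B m" unfolding m_def using n Bm by (metis LeastI)
    have "z \<notin> B 0" by (simp add: B_def a_def)
    then obtain k where k: "m = Suc k" using m by (cases m) auto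
    have "z \<notin> B k" using k unfolding m_def by (metis not_less_Least lessI)
    then show ?thesis using m k by (auto simp: A_def)
  qed
  have emB: "emeasure lborel (B n) = ennreal (pi * (1 - a n))" for n
    unfolding B_def using a[of n] by (subst emeasure_ball) (auto simp: unit_ball_vol_2)
  have emA: "emeasure lborel (A n) = ennreal (pi * a (Suc n))" for n
  proof -
    have "B n \<subseteq> B (Suc n)" using Bm a(3)[of n] a(1)[of n] by (auto simp: subset_iff)
    then have "emeasure lborel (A n) = emeasure lborel (B (Suc n)) - emeasure lborel (B n)"
      unfolding A_def using emB[of n] by (intro emeasure_Diff) (auto simp: B_def)
    also have "\<dots> = ennreal (pi * (1 - a (Suc n)) - pi * (1 - a n))"
      unfolding emB using a[of n] by (intro ennreal_minus) auto
    also have "pi * (1 - a (Suc n)) - pi * (1 - a n) = pi * a (Suc n)"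
      by (simp add: a(3) field_simps)
    finally show ?thesis .
  qed
  define K where "K = (1 + \<alpha>) / pi * 2 powr \<bar>\<alpha>\<bar>"
  have K: "K \<ge> 0" using assms by (simp add: K_def)
  have wt: "wdens \<alpha> z \<le> ennreal (K * a n powr \<alpha>)" if "z \<in> A n" for z n
  proof -
    let ?t = "1 - (cmod z)\<^sup>2"
    have t: "a n / 2 < ?t" "?t \<le> a n" using that Bm[of z n] Bm[of z "Suc n"] a(3)[of n] by (auto simp: A_def)
    have "?t powr \<alpha> \<le> 2 powr \<bar>\<alpha>\<bar> * a n powr \<alpha>"
    proof (cases "\<alpha> \<ge> 0")
      case True
      then have "?t powr \<alpha> \<le> a n powr \<alpha>" using t a[of n] by (intro powr_mono2) auto
      moreover have "(1::real) \<le> 2 powr \<bar>\<alpha>\<bar>" by (rule ge_one_powr_ge_zero) auto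
      then have "1 * a n powr \<alpha> \<le> 2 powr \<bar>\<alpha>\<bar> * a n powr \<alpha>" by (intro mult_right_mono) auto
      ultimately show ?thesis by simp
    next
      case False
      then have "?t powr \<alpha> \<le> (a n / 2) powr \<alpha>" using t a[of n] by (intro powr_mono2') auto
      also have "\<dots> = 2 powr \<bar>\<alpha>\<bar> * a n powr \<alpha>"
        using False a[of n] by (simp add: powr_divide powr_minus field_simps)
      finally show ?thesis .
    qed
    then have "(1 + \<alpha>) / pi * ?t powr \<alpha> \<le> (1 + \<alpha>) / pi * (2 powr \<bar>\<alpha>\<bar> * a n powr \<alpha>)"
      using assms by (intro mult_left_mono) auto
    then show ?thesis by (simp add: wdens_def K_def mult.assoc ennreal_leI)
  qed
  have Am [measurable]: "A n \<in> sets borel" for n by (simp add: A_def B_def)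
  define q where "q = (1/2 :: real) powr (1 + \<alpha>)"
  have q: "0 < q" "q < 1" using assms powr_less_mono'[of "1/2" 0 "1+\<alpha>"] by (auto simp: q_def powr_less_one)
  have anq: "a n powr \<alpha> * a n = q ^ n" for n
  proof -
    have "a n powr \<alpha> * a n = a n powr (1 + \<alpha>)" using a[of n] by (simp add: powr_add)
    also have "\<dots> = ((1/2) powr real n) powr (1 + \<alpha>)" by (simp add: a_def powr_realpow)
    also have "\<dots> = q powr real n" by (simp add: q_def powr_powr mult.commute)
    also have "\<dots> = q ^ n" using q by (simp add: powr_realpow)
    finally show ?thesis .
  qed
  have "emeasure (warea \<alpha>) disk = (\<integral>\<^sup>+z. 1 \<partial>warea \<alpha>)" by simp
  also have "\<dots> = (\<integral>\<^sup>+z. wdens \<alpha> z * indicator disk z \<partial>lborel)"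
    using nn_integral_warea[OF assms, of "\<lambda>_. 1"] by simp
  also have "\<dots> \<le> (\<integral>\<^sup>+z. (\<Sum>n. ennreal (K * a n powr \<alpha>) * indicator (A n) z) \<partial>lborel)"
  proof (rule nn_integral_mono)
    fix z :: complex
    show "wdens \<alpha> z * indicator disk z \<le> (\<Sum>n. ennreal (K * a n powr \<alpha>) * indicator (A n) z)"
    proof (cases "z \<in> disk")
      case True
      then obtain n where n: "z \<in> A n" using cover by auto
      have "wdens \<alpha> z * indicator disk z \<le> ennreal (K * a n powr \<alpha>) * indicator (A n) z"
        using wt[OF n] n True by simp
      also have "\<dots> \<le> (\<Sum>n. ennreal (K * a n powr \<alpha>) * indicator (A n) z)"
        using sum_le_suminf[of "\<lambda>n. ennreal (K * a n powr \<alpha>) * indicator (A n) z" "{n}"]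
        by (simp only: finite.intros summableI zero_le sum.insert sum.empty empty_iff not_False_eq_True add_0_right)
      finally show ?thesis .
    qed simp
  qed
  also have "\<dots> = (\<Sum>n. \<integral>\<^sup>+z. ennreal (K * a n powr \<alpha>) * indicator (A n) z \<partial>lborel)"
    by (rule nn_integral_suminf) measurable
  also have "\<dots> = (\<Sum>n. ennreal (K * pi / 2 * q ^ n))"
  proof (rule suminf_cong)
    fix n
    have "(\<integral>\<^sup>+z. ennreal (K * a n powr \<alpha>) * indicator (A n) z \<partial>lborel) = ennreal (K * a n powr \<alpha>) * ennreal (pi * a (Suc n))"
      by (simp add: nn_integral_cmult_indicator emA)
    also have "\<dots> = ennreal ((K * a n powr \<alpha>) * (pi * a (Suc n)))"
      using K a[of "Suc n"] by (intro ennreal_mult[symmetric]) auto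
    also have "(K * a n powr \<alpha>) * (pi * a (Suc n)) = K * pi / 2 * q ^ n"
      unfolding anq[symmetric] a(3) by (simp add: field_simps)
    finally show "(\<integral>\<^sup>+z. ennreal (K * a n powr \<alpha>) * indicator (A n) z \<partial>lborel) = ennreal (K * pi / 2 * q ^ n)" .
  qed
  also have "\<dots> < \<infinity>"
    using q K by (subst suminf_ennreal2) (auto intro!: summable_mult summable_geometric)
  finally show ?thesis .
qed

lemma finite_measure_warea: "\<alpha> > -1 \<Longrightarrow> finite_measure (warea \<alpha>)"
  using warea_finite[of \<alpha>] by (intro finite_measureI) (auto simp: top.not_eq_extremum)

section \<open>Moebius transformations\<close>

text \<open>The involutive automorphism of the disk that exchanges \<open>0\<close> and \<open>u\<close>.\<close>

definition mob :: "complex \<Rightarrow> complex \<Rightarrow> complex" where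
  "mob u v = (u - v) / (1 - cnj u * v)"

lemma mob_denom_bound:
  assumes "cmod u < 1" "cmod v \<le> 1" shows "1 - cmod u \<le> cmod (1 - cnj u * v)" "1 - cnj u * v \<noteq> 0"
proof -
  have "cmod u * cmod v \<le> cmod u * 1" using assms by (intro mult_left_mono) auto
  then have "cmod (cnj u * v) \<le> cmod u" by (simp add: norm_mult)
  then show "1 - cmod u \<le> cmod (1 - cnj u * v)"
    using norm_triangle_ineq2[of 1 "cnj u * v"] by simp
  then show "1 - cnj u * v \<noteq> 0" using assms by auto
qed

lemma mob_measurable [measurable]: "mob u \<in> borel_measurable borel"
  unfolding mob_def by measurable

text \<open>This identity makes the weight \<open>(1 - |z|\<^sup>2)\<^sup>\<alpha>\<close> transform by a factor under \<open>mob u\<close>, and it shows that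
  \<open>mob u\<close> preserves the disk.\<close>

lemma one_minus_mob:
  assumes "cmod u < 1" "cmod v < 1"
  shows "1 - (cmod (mob u v))\<^sup>2 = (1 - (cmod u)\<^sup>2) * (1 - (cmod v)\<^sup>2) / (cmod (1 - cnj u * v))\<^sup>2"
proof -
  have nz: "1 - cnj u * v \<noteq> 0" using mob_denom_bound[of u v] assms by auto
  have "(cmod (1 - cnj u * v))\<^sup>2 - (cmod (u - v))\<^sup>2 = (1 - (cmod u)\<^sup>2) * (1 - (cmod v)\<^sup>2)"
    unfolding cmod_power2 by (simp add: algebra_simps power2_eq_square)
  then show ?thesis using nz by (simp add: mob_def norm_divide power_divide field_simps)
qed

lemma mob_in_disk:
  assumes "cmod u < 1" "cmod v < 1" shows "cmod (mob u v) < 1"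
proof -
  have nz: "1 - cnj u * v \<noteq> 0" using mob_denom_bound[of u v] assms by auto
  have "0 < 1 - (cmod (mob u v))\<^sup>2"
    unfolding one_minus_mob[OF assms] using assms nz
    by (intro divide_pos_pos mult_pos_pos) (auto simp: abs_square_less_1)
  then show ?thesis by (simp add: abs_square_less_1)
qed

lemma mob_mob:
  assumes "cmod u < 1" "cmod v < 1" shows "mob u (mob u v) = v"
proof -
  have nz: "1 - cnj u * v \<noteq> 0" using mob_denom_bound[of u v] assms by auto
  have nu: "1 - cnj u * u \<noteq> 0" using mob_denom_bound[of u u] assms by auto
  have "u - mob u v = v * (1 - cnj u * u) / (1 - cnj u * v)"
    using nz by (simp add: mob_def field_simps)
  moreover have "1 - cnj u * mob u v = (1 - cnj u * u) / (1 - cnj u * v)"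
    using nz by (simp add: mob_def field_simps)
  ultimately show ?thesis using nz nu by (simp add: mob_def[of u "mob u v"])
qed

lemma mob_deriv:
  assumes "cmod u < 1" "cmod v < 1"
  shows "(mob u has_field_derivative - of_real (1 - (cmod u)\<^sup>2) / (1 - cnj u * v)\<^sup>2) (at v)"
proof -
  have nz: "1 - cnj u * v \<noteq> 0" using mob_denom_bound[of u v] assms by auto
  have sq: "complex_of_real (1 - (cmod u)\<^sup>2) = 1 - u * cnj u"
    by (simp only: of_real_diff of_real_1 complex_norm_square)
  show ?thesis unfolding mob_def sq
    by (rule derivative_eq_intros refl nz)+
       (use nz in \<open>simp add: field_simps power2_eq_square\<close>)
qed

text \<open>The density of the image of \<open>A\<^sub>\<alpha>\<close> under \<open>mob u\<close>, which is also the squared modulus of the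
  normalized reproducing kernel at \<open>u\<close>.\<close>

definition mob_jac :: "real \<Rightarrow> complex \<Rightarrow> complex \<Rightarrow> real" where
  "mob_jac \<alpha> u w = ((1 - (cmod u)\<^sup>2) / (cmod (1 - cnj u * w))\<^sup>2) powr (2 + \<alpha>)"

text \<open>The exponent \<open>2 + \<alpha>\<close> in \<open>mob_jac\<close> is the sum of \<open>2\<close>, contributed by the squared modulus of the
  derivative of \<open>mob u\<close>, and \<open>\<alpha>\<close>, contributed by the weight.\<close>

lemma nn_integral_mob:
  assumes "\<alpha> > -1" "cmod u < 1" and F [measurable]: "F \<in> borel_measurable borel"
  shows "(\<integral>\<^sup>+v. F (mob u v) \<partial>warea \<alpha>) = (\<integral>\<^sup>+w. F w * ennreal (mob_jac \<alpha> u w) \<partial>warea \<alpha>)"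
proof -
  have hol: "mob u holomorphic_on disk"
    by (rule holomorphic_onI) (metis assms(2) mob_deriv field_differentiable_def field_differentiable_at_within mem_ball_0)
  have inj: "inj_on (mob u) disk" by (rule inj_on_inverseI[of _ "mob u"]) (use assms mob_mob in auto)
  have im: "mob u ` disk = disk"
  proof
    show "mob u ` disk \<subseteq> disk" using mob_in_disk assms by auto
    show "disk \<subseteq> mob u ` disk"
    proof
      fix z :: complex assume "z \<in> disk"
      then have "z = mob u (mob u z)" "mob u z \<in> disk" using mob_mob mob_in_disk assms by auto
      then show "z \<in> mob u ` disk" by blast
    qed
  qed
  have [measurable]: "mob_jac \<alpha> u \<in> borel_measurable borel" unfolding mob_jac_def by measurable
  have "(\<integral>\<^sup>+w. F w * ennreal (mob_jac \<alpha> u w) \<partial>warea \<alpha>) =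
    (\<integral>\<^sup>+w. (F w * ennreal (mob_jac \<alpha> u w)) * wdens \<alpha> w * indicator disk w \<partial>lborel)"
    by (rule nn_integral_warea[OF assms(1)]) measurable
  also have "\<dots> = (\<integral>\<^sup>+z. (F z * wdens \<alpha> (mob u z)) * (ennreal ((cmod (deriv (mob u) z))\<^sup>2) * indicator disk z) \<partial>lborel)"
  proof (rule nn_integral_cong)
    fix z :: complex
    show "F z * ennreal (mob_jac \<alpha> u z) * wdens \<alpha> z * indicator disk z =
      (F z * wdens \<alpha> (mob u z)) * (ennreal ((cmod (deriv (mob u) z))\<^sup>2) * indicator disk z)"
    proof (cases "z \<in> disk")
      case True
      then have z: "cmod z < 1" by simp
      define s t d where "s = 1 - (cmod u)\<^sup>2" and "t = 1 - (cmod z)\<^sup>2" and "d = (cmod (1 - cnj u * z))\<^sup>2"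
      have pos: "s > 0" "t > 0" "d > 0"
        using assms z mob_denom_bound[of u z] by (auto simp: s_def t_def d_def abs_square_less_1)
      have dd: "(cmod (deriv (mob u) z))\<^sup>2 = (s / d)\<^sup>2"
        using pos unfolding DERIV_imp_deriv[OF mob_deriv[OF assms(2) z]] s_def[symmetric]
          norm_divide norm_minus_cancel norm_of_real norm_power d_def[symmetric] by simp
      have "mob_jac \<alpha> u z * ((1 + \<alpha>) / pi * t powr \<alpha>) = ((1 + \<alpha>) / pi * (s * t / d) powr \<alpha>) * (s / d)\<^sup>2"
        unfolding mob_jac_def s_def[symmetric] d_def[symmetric]
        using pos by (simp add: powr_add powr_mult powr_divide power_divide) (simp add: mult_ac)
      then have "ennreal (mob_jac \<alpha> u z) * wdens \<alpha> z = wdens \<alpha> (mob u z) * ennreal ((s / d)\<^sup>2)"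
        unfolding wdens_def one_minus_mob[OF assms(2) z] s_def[symmetric] t_def[symmetric] d_def[symmetric]
        using assms(1) by (simp add: ennreal_mult[symmetric] mob_jac_def)
      then show ?thesis unfolding dd using True by (simp add: mult.assoc)
    qed simp
  qed
  also have "\<dots> = (\<integral>\<^sup>+w. (F (mob u w) * wdens \<alpha> (mob u (mob u w))) * indicator (mob u ` disk) w \<partial>lborel)"
    by (rule nn_integral_injective_holomorphic[OF _ hol inj]) (use mob_mob assms in auto)
  also have "\<dots> = (\<integral>\<^sup>+w. F (mob u w) * wdens \<alpha> w * indicator disk w \<partial>lborel)"
    unfolding im using mob_mob assms by (intro nn_integral_cong) (auto simp: indicator_def)
  also have "\<dots> = (\<integral>\<^sup>+w. F (mob u w) \<partial>warea \<alpha>)"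
    by (rule nn_integral_warea[OF assms(1), symmetric]) measurable
  finally show ?thesis ..
qed

section \<open>The counting measure as a pushforward\<close>

lemma self_map_measurable:
  assumes "\<phi> holomorphic_on disk" "\<phi> ` disk \<subseteq> disk"
  shows "\<phi> \<in> measurable (warea \<alpha>) (warea \<alpha>)"
proof -
  have "\<phi> \<in> measurable (warea \<alpha>) (restrict_space borel disk)"
    using assms holomorphic_measurable_warea[OF assms(1)] by (intro measurable_restrict_space2) auto
  then show ?thesis by (subst measurable_cong_sets[OF refl sets_warea])
qed

lemma counting_fun_eq_valency_sum:
  "counting_fun \<phi> \<alpha> = valency_sum disk \<phi> (\<lambda>z. ennreal ((1 - (cmod z)\<^sup>2) powr \<alpha>))"
  by (simp add: counting_fun_def valency_sum_def fun_eq_iff)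

lemma counting_fun_measurable:
  assumes "\<phi> holomorphic_on disk" "\<not> \<phi> constant_on disk"
  shows "counting_fun \<phi> \<alpha> \<in> borel_measurable borel"
  unfolding counting_fun_eq_valency_sum by (rule area_formula(1)) (use assms in auto)

lemma sets_counting_fun_measure [simp, measurable_cong]:
  "sets (counting_fun_measure \<phi> \<alpha>) = sets (restrict_space borel disk)"
  by (simp add: counting_fun_measure_def)

lemma space_counting_fun_measure [simp]: "space (counting_fun_measure \<phi> \<alpha>) = disk"
  by (simp add: counting_fun_measure_def)

lemma nn_integral_counting_fun_measure_area:
  assumes "\<alpha> > -1" "\<phi> holomorphic_on disk" "\<not> \<phi> constant_on disk"
    and [measurable]: "F \<in> borel_measurable borel"
  shows "(\<integral>\<^sup>+w. F w \<partial>counting_fun_measure \<phi> \<alpha>) =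
    (\<integral>\<^sup>+w. ennreal ((1 + \<alpha>) / pi) * (F w * counting_fun \<phi> \<alpha> w * indicator disk w) \<partial>lborel)"
proof -
  note [measurable] = counting_fun_measurable[OF assms(2,3), of \<alpha>]
  have "(\<integral>\<^sup>+w. F w \<partial>counting_fun_measure \<phi> \<alpha>) =
    (\<integral>\<^sup>+w. (counting_fun \<phi> \<alpha> w / ennreal ((1 - (cmod w)\<^sup>2) powr \<alpha>)) * F w \<partial>warea \<alpha>)"
    unfolding counting_fun_measure_def by (rule nn_integral_density) measurable
  also have "\<dots> = (\<integral>\<^sup>+w. (counting_fun \<phi> \<alpha> w / ennreal ((1 - (cmod w)\<^sup>2) powr \<alpha>)) * F w * wdens \<alpha> w * indicator disk w \<partial>lborel)"
    by (rule nn_integral_warea[OF assms(1)]) measurable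
  also have "\<dots> = (\<integral>\<^sup>+w. ennreal ((1 + \<alpha>) / pi) * (F w * counting_fun \<phi> \<alpha> w * indicator disk w) \<partial>lborel)"
  proof (rule nn_integral_cong)
    fix w :: complex
    show "(counting_fun \<phi> \<alpha> w / ennreal ((1 - (cmod w)\<^sup>2) powr \<alpha>)) * F w * wdens \<alpha> w * indicator disk w =
      ennreal ((1 + \<alpha>) / pi) * (F w * counting_fun \<phi> \<alpha> w * indicator disk w)"
    proof (cases "w \<in> disk")
      case True
      define p where "p = (1 - (cmod w)\<^sup>2) powr \<alpha>"
      have "0 < 1 - (cmod w)\<^sup>2" using True by (simp add: abs_square_less_1)
      then have p: "p > 0" by (simp add: p_def)
      have w: "wdens \<alpha> w = ennreal ((1 + \<alpha>) / pi) * ennreal p"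
        unfolding wdens_def p_def using assms(1) by (intro ennreal_mult) auto
      have "(counting_fun \<phi> \<alpha> w / ennreal p) * ennreal p = counting_fun \<phi> \<alpha> w"
        using p by (simp add: ennreal_divide_times ennreal_divide_self)
      moreover have "counting_fun \<phi> \<alpha> w / ennreal p * F w * (ennreal ((1 + \<alpha>) / pi) * ennreal p) =
        ennreal ((1 + \<alpha>) / pi) * (F w * (counting_fun \<phi> \<alpha> w / ennreal p * ennreal p))"
        by (simp only: mult_ac)
      ultimately show ?thesis unfolding w p_def[symmetric] using True by simp
    qed simp
  qed
  finally show ?thesis .
qed

text \<open>The area formula with \<open>h(z) = (1 - |z|\<^sup>2)\<^sup>\<alpha>\<close>: the factor \<open>(1 - |w|\<^sup>2)\<^sup>\<alpha>\<close> by which the counting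
  function is divided cancels against the density of \<open>A\<^sub>\<alpha>\<close>.\<close>

theorem counting_fun_measure_eq_distr:
  assumes "\<alpha> > -1" "\<phi> holomorphic_on disk" "\<phi> ` disk \<subseteq> disk" "\<not> \<phi> constant_on disk"
  shows "counting_fun_measure \<phi> \<alpha> =
    distr (density (warea \<alpha>) (\<lambda>z. ennreal ((cmod (deriv \<phi> z))\<^sup>2))) (warea \<alpha>) \<phi>"
proof (rule measure_eqI)
  fix E assume "E \<in> sets (counting_fun_measure \<phi> \<alpha>)"
  then have E: "E \<in> sets (warea \<alpha>)" and [measurable]: "E \<in> sets borel" and "E \<subseteq> disk"
    using in_sets_warea[of E \<alpha>] by auto
  have \<phi>m [measurable]: "\<phi> \<in> measurable (warea \<alpha>) (warea \<alpha>)" by (rule self_map_measurable[OF assms(2,3)])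
  have d: "deriv \<phi> holomorphic_on disk" using assms(2) by (intro holomorphic_deriv) auto
  have d0 [measurable]: "on_disk (deriv \<phi>) \<in> borel_measurable borel"
    by (intro disk_analytic_borel on_disk_analytic d)
  have \<phi>0 [measurable]: "on_disk \<phi> \<in> borel_measurable borel"
    by (intro disk_analytic_borel on_disk_analytic assms)
  have dm [measurable]: "deriv \<phi> \<in> borel_measurable (warea \<alpha>)" by (rule holomorphic_measurable_warea[OF d])
  have "emeasure (distr (density (warea \<alpha>) (\<lambda>z. ennreal ((cmod (deriv \<phi> z))\<^sup>2))) (warea \<alpha>) \<phi>) E =
    (\<integral>\<^sup>+w. indicator E w \<partial>distr (density (warea \<alpha>) (\<lambda>z. ennreal ((cmod (deriv \<phi> z))\<^sup>2))) (warea \<alpha>) \<phi>)"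
    using E by (subst nn_integral_indicator) (auto simp: in_sets_warea)
  also have "\<dots> = (\<integral>\<^sup>+z. ennreal ((cmod (deriv \<phi> z))\<^sup>2) * indicator E (\<phi> z) \<partial>warea \<alpha>)"
  proof -
    have im: "(\<lambda>z. indicator E (\<phi> z)) \<in> borel_measurable (warea \<alpha>)"
      by (rule measurable_compose[OF \<phi>m borel_measurable_indicator[OF E]])
    have fm: "(\<lambda>z. ennreal ((cmod (deriv \<phi> z))\<^sup>2)) \<in> borel_measurable (warea \<alpha>)" by measurable
    show ?thesis
      using borel_measurable_indicator[OF E] im
      by (subst nn_integral_distr) (simp_all add: nn_integral_density[OF fm im])
  qed
  also have "\<dots> = (\<integral>\<^sup>+z. ennreal ((cmod (on_disk (deriv \<phi>) z))\<^sup>2) * indicator E (on_disk \<phi> z) \<partial>warea \<alpha>)"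
    by (intro nn_integral_cong) (auto simp: on_disk_def)
  also have "\<dots> = (\<integral>\<^sup>+z. ennreal ((cmod (on_disk (deriv \<phi>) z))\<^sup>2) * indicator E (on_disk \<phi> z) * wdens \<alpha> z * indicator disk z \<partial>lborel)"
    by (rule nn_integral_warea[OF assms(1)]) measurable
  also have "\<dots> = (\<integral>\<^sup>+z. (ennreal ((1 + \<alpha>) / pi) * indicator E (\<phi> z)) * ennreal ((1 - (cmod z)\<^sup>2) powr \<alpha>) *
      ennreal ((cmod (deriv \<phi> z))\<^sup>2) * indicator disk z \<partial>lborel)"
  proof (rule nn_integral_cong)
    fix z :: complex
    have w: "wdens \<alpha> z = ennreal ((1 + \<alpha>) / pi) * ennreal ((1 - (cmod z)\<^sup>2) powr \<alpha>)"
      unfolding wdens_def using assms(1) by (intro ennreal_mult) auto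
    show "ennreal ((cmod (on_disk (deriv \<phi>) z))\<^sup>2) * indicator E (on_disk \<phi> z) * wdens \<alpha> z * indicator disk z =
      (ennreal ((1 + \<alpha>) / pi) * indicator E (\<phi> z)) * ennreal ((1 - (cmod z)\<^sup>2) powr \<alpha>) *
      ennreal ((cmod (deriv \<phi> z))\<^sup>2) * indicator disk z"
      unfolding w by (cases "z \<in> disk") (simp_all add: on_disk_def mult_ac)
  qed
  also have "\<dots> = (\<integral>\<^sup>+w. (ennreal ((1 + \<alpha>) / pi) * indicator E w) * counting_fun \<phi> \<alpha> w \<partial>lborel)"
    unfolding counting_fun_eq_valency_sum
    by (rule area_formula(2)) (use assms in auto)
  also have "\<dots> = (\<integral>\<^sup>+w. ennreal ((1 + \<alpha>) / pi) * (indicator E w * counting_fun \<phi> \<alpha> w * indicator disk w) \<partial>lborel)"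
    using \<open>E \<subseteq> disk\<close> by (intro nn_integral_cong) (auto simp: indicator_def)
  also have "\<dots> = (\<integral>\<^sup>+w. indicator E w \<partial>counting_fun_measure \<phi> \<alpha>)"
    by (rule nn_integral_counting_fun_measure_area[OF assms(1,2,4), symmetric]) measurable
  also have "\<dots> = emeasure (counting_fun_measure \<phi> \<alpha>) E"
    using E by (subst nn_integral_indicator) (auto simp: in_sets_warea)
  finally show "emeasure (counting_fun_measure \<phi> \<alpha>) E =
    emeasure (distr (density (warea \<alpha>) (\<lambda>z. ennreal ((cmod (deriv \<phi> z))\<^sup>2))) (warea \<alpha>) \<phi>) E" ..
qed simp

section \<open>Square-integrable functions\<close>

definition l2 :: "'a measure \<Rightarrow> ('a \<Rightarrow> complex) \<Rightarrow> bool" where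
  "l2 M f \<longleftrightarrow> f \<in> borel_measurable M \<and> integrable M (\<lambda>z. (cmod (f z))\<^sup>2)"

definition l2norm :: "'a measure \<Rightarrow> ('a \<Rightarrow> complex) \<Rightarrow> real" where
  "l2norm M f = sqrt (\<integral>z. (cmod (f z))\<^sup>2 \<partial>M)"

definition ip :: "'a measure \<Rightarrow> ('a \<Rightarrow> complex) \<Rightarrow> ('a \<Rightarrow> complex) \<Rightarrow> complex" where
  "ip M f g = (\<integral>z. f z * cnj (g z) \<partial>M)"

lemma l2norm_nonneg [simp]: "0 \<le> l2norm M f"
  by (simp add: l2norm_def)

lemma l2norm_power2: "(l2norm M f)\<^sup>2 = (\<integral>z. (cmod (f z))\<^sup>2 \<partial>M)"
  by (simp add: l2norm_def)

lemma l2norm_ennreal: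
  assumes "l2 M f" shows "ennreal ((l2norm M f)\<^sup>2) = (\<integral>\<^sup>+z. ennreal ((cmod (f z))\<^sup>2) \<partial>M)"
  unfolding l2norm_power2 using assms by (intro nn_integral_eq_integral[symmetric]) (auto simp: l2_def)

lemma l2_iff_nn_integral:
  assumes "f \<in> borel_measurable M"
  shows "l2 M f \<longleftrightarrow> (\<integral>\<^sup>+z. ennreal ((cmod (f z))\<^sup>2) \<partial>M) < \<infinity>"
  using assms by (auto simp: l2_def integrable_iff_bounded)

lemma borel_measurable_cnj [measurable (raw)]:
  "f \<in> borel_measurable M \<Longrightarrow> (\<lambda>z. cnj (f z)) \<in> borel_measurable M"
  by (rule measurable_compose[of f M borel cnj], assumption)
     (intro borel_measurable_continuous_onI continuous_intros)

lemma l2_mult_integrable: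
  assumes "l2 M f" "l2 M g" shows "integrable M (\<lambda>z. f z * cnj (g z))"
proof -
  have [measurable]: "f \<in> borel_measurable M" "g \<in> borel_measurable M" using assms by (auto simp: l2_def)
  show ?thesis
  proof (rule Bochner_Integration.integrable_bound)
    show "integrable M (\<lambda>z. (cmod (f z))\<^sup>2 + (cmod (g z))\<^sup>2)" using assms by (auto simp: l2_def)
    show "AE z in M. norm (f z * cnj (g z)) \<le> norm ((cmod (f z))\<^sup>2 + (cmod (g z))\<^sup>2)"
    proof (rule AE_I2)
      fix z
      have "0 \<le> (cmod (f z) - cmod (g z))\<^sup>2 + (cmod (f z))\<^sup>2 + (cmod (g z))\<^sup>2" by simp
      then show "norm (f z * cnj (g z)) \<le> norm ((cmod (f z))\<^sup>2 + (cmod (g z))\<^sup>2)"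
        by (simp add: norm_mult power2_eq_square algebra_simps)
    qed
  qed measurable
qed

lemma l2_lincomb:
  assumes "l2 M f" "l2 M g" shows "l2 M (\<lambda>z. a * f z + b * g z)"
proof -
  have [measurable]: "f \<in> borel_measurable M" "g \<in> borel_measurable M" using assms by (auto simp: l2_def)
  have "integrable M (\<lambda>z. (cmod (a * f z + b * g z))\<^sup>2)"
  proof (rule Bochner_Integration.integrable_bound)
    show "integrable M (\<lambda>z. 2 * (cmod a)\<^sup>2 * (cmod (f z))\<^sup>2 + 2 * (cmod b)\<^sup>2 * (cmod (g z))\<^sup>2)"
      using assms by (auto simp: l2_def)
    show "AE z in M. norm ((cmod (a * f z + b * g z))\<^sup>2) \<le> norm (2 * (cmod a)\<^sup>2 * (cmod (f z))\<^sup>2 + 2 * (cmod b)\<^sup>2 * (cmod (g z))\<^sup>2)"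
    proof (rule AE_I2)
      fix z
      define x y where "x = cmod a * cmod (f z)" and "y = cmod b * cmod (g z)"
      have "cmod (a * f z + b * g z) \<le> x + y"
        unfolding x_def y_def norm_mult[symmetric] by (rule norm_triangle_ineq)
      then have "(cmod (a * f z + b * g z))\<^sup>2 \<le> (x + y)\<^sup>2" by (intro power_mono) auto
      also have "\<dots> \<le> (x + y)\<^sup>2 + (x - y)\<^sup>2" by simp
      also have "\<dots> = 2 * x\<^sup>2 + 2 * y\<^sup>2" by (simp add: power2_eq_square algebra_simps)
      finally show "norm ((cmod (a * f z + b * g z))\<^sup>2) \<le> norm (2 * (cmod a)\<^sup>2 * (cmod (f z))\<^sup>2 + 2 * (cmod b)\<^sup>2 * (cmod (g z))\<^sup>2)"
        by (simp add: x_def y_def power_mult_distrib)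
    qed
  qed measurable
  then show ?thesis by (simp add: l2_def)
qed

lemma ip_lincomb:
  assumes "l2 M f" "l2 M g" "l2 M h"
  shows "ip M (\<lambda>z. a * f z + b * g z) h = a * ip M f h + b * ip M g h"
proof -
  have "ip M (\<lambda>z. a * f z + b * g z) h = (\<integral>z. a * (f z * cnj (h z)) + b * (g z * cnj (h z)) \<partial>M)"
    unfolding ip_def by (intro Bochner_Integration.integral_cong) (auto simp: algebra_simps)
  also have "\<dots> = a * ip M f h + b * ip M g h"
    unfolding ip_def using l2_mult_integrable[OF assms(1,3)] l2_mult_integrable[OF assms(2,3)]
    by (subst Bochner_Integration.integral_add) (auto simp: integrable_mult_right)
  finally show ?thesis .
qed

lemma ip_commute: "ip M g f = cnj (ip M f g)"
proof -
  have "ip M g f = (\<integral>z. cnj (f z * cnj (g z)) \<partial>M)"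
    unfolding ip_def by (simp add: mult.commute)
  then show ?thesis by (simp only: Bochner_Integration.integral_cnj ip_def)
qed

lemma ip_self: "ip M f f = of_real ((l2norm M f)\<^sup>2)"
  unfolding ip_def l2norm_power2 by (simp add: complex_norm_square[symmetric] flip: of_real_power)

lemma ip_Cauchy_Schwarz:
  assumes "l2 M f" "l2 M g" shows "cmod (ip M f g) \<le> l2norm M f * l2norm M g"
proof -
  have [measurable]: "f \<in> borel_measurable M" "g \<in> borel_measurable M" using assms by (auto simp: l2_def)
  have "ennreal (cmod (ip M f g)) \<le> (\<integral>\<^sup>+z. norm (f z * cnj (g z)) \<partial>M)"
    unfolding ip_def by (rule integral_norm_bound_ennreal[OF l2_mult_integrable[OF assms]])
  also have "\<dots> = (\<integral>\<^sup>+z. ennreal (cmod (f z)) * ennreal (cmod (g z)) \<partial>M)"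
    by (simp add: norm_mult ennreal_mult)
  finally have "(ennreal (cmod (ip M f g)))\<^sup>2 \<le> (\<integral>\<^sup>+z. ennreal (cmod (f z)) * ennreal (cmod (g z)) \<partial>M)\<^sup>2"
    by (intro power_mono) auto
  also have "\<dots> \<le> (\<integral>\<^sup>+z. (ennreal (cmod (f z)))\<^sup>2 \<partial>M) * (\<integral>\<^sup>+z. (ennreal (cmod (g z)))\<^sup>2 \<partial>M)"
    by (rule Cauchy_Schwarz_nn_integral) measurable
  also have "\<dots> = ennreal ((l2norm M f)\<^sup>2) * ennreal ((l2norm M g)\<^sup>2)"
    using assms by (simp add: l2norm_ennreal ennreal_power)
  also have "\<dots> = ennreal ((l2norm M f * l2norm M g)\<^sup>2)"
    by (simp add: ennreal_mult[symmetric] power_mult_distrib)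
  finally have "(cmod (ip M f g))\<^sup>2 \<le> (l2norm M f * l2norm M g)\<^sup>2"
    by (simp add: ennreal_power)
  then show ?thesis by (rule power2_le_imp_le) simp
qed

lemma l2norm_scale: "l2norm M (\<lambda>z. a * f z) = cmod a * l2norm M f"
  by (simp add: l2norm_def norm_mult power_mult_distrib real_sqrt_mult)

lemma l2norm_triangle:
  assumes "l2 M f" "l2 M g"
  shows "l2norm M (\<lambda>z. a * f z + b * g z) \<le> cmod a * l2norm M f + cmod b * l2norm M g"
proof -
  let ?s = "\<lambda>z. a * f z + b * g z"
  have s: "l2 M ?s" by (rule l2_lincomb[OF assms])
  have "of_real ((l2norm M ?s)\<^sup>2) = ip M ?s ?s" by (rule ip_self[symmetric])
  also have "\<dots> = a * ip M f ?s + b * ip M g ?s" by (rule ip_lincomb[OF assms s])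
  finally have "(l2norm M ?s)\<^sup>2 = cmod (a * ip M f ?s + b * ip M g ?s)"
    by (metis norm_of_real abs_power2)
  also have "\<dots> \<le> cmod a * cmod (ip M f ?s) + cmod b * cmod (ip M g ?s)"
    unfolding norm_mult[symmetric] by (rule norm_triangle_ineq)
  also have "\<dots> \<le> cmod a * (l2norm M f * l2norm M ?s) + cmod b * (l2norm M g * l2norm M ?s)"
    by (intro add_mono mult_left_mono ip_Cauchy_Schwarz assms s) auto
  finally have "l2norm M ?s * l2norm M ?s \<le> (cmod a * l2norm M f + cmod b * l2norm M g) * l2norm M ?s"
    by (simp add: power2_eq_square algebra_simps)
  then show ?thesis
    by (cases "l2norm M ?s = 0") (auto dest: mult_right_le_imp_le simp: less_le)
qed

section \<open>Power series and the Bergman norm\<close>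

lemma warea_rotate:
  assumes "\<alpha> > -1" "cmod c = 1"
  shows "distr (warea \<alpha>) (warea \<alpha>) (\<lambda>z. c * z) = warea \<alpha>"
proof (rule measure_eqI)
  have c0: "c \<noteq> 0" using assms(2) by auto
  have im: "(\<lambda>z. c * z) ` disk = disk"
  proof
    show "(\<lambda>z. c * z) ` disk \<subseteq> disk" using assms by (auto simp: norm_mult)
    show "disk \<subseteq> (\<lambda>z. c * z) ` disk"
    proof
      fix z :: complex assume "z \<in> disk"
      then have "z = c * (z / c)" "z / c \<in> disk" using c0 assms by (auto simp: norm_divide)
      then show "z \<in> (\<lambda>z. c * z) ` disk" by blast
    qed
  qed
  fix E assume "E \<in> sets (distr (warea \<alpha>) (warea \<alpha>) (\<lambda>z. c * z))"
  then have E: "E \<in> sets (warea \<alpha>)" and [measurable]: "E \<in> sets borel" using in_sets_warea by auto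
  have m: "(\<lambda>z. c * z) \<in> measurable (warea \<alpha>) (warea \<alpha>)"
    by (rule self_map_measurable) (use im in \<open>auto intro!: holomorphic_intros\<close>)
  have "emeasure (distr (warea \<alpha>) (warea \<alpha>) (\<lambda>z. c * z)) E =
    (\<integral>\<^sup>+z. indicator E z \<partial>distr (warea \<alpha>) (warea \<alpha>) (\<lambda>z. c * z))"
    using E by (subst nn_integral_indicator) auto
  also have "\<dots> = (\<integral>\<^sup>+z. indicator E (c * z) \<partial>warea \<alpha>)"
    using borel_measurable_indicator[OF E] by (subst nn_integral_distr[OF m]) auto
  also have "\<dots> = (\<integral>\<^sup>+z. indicator E (c * z) * wdens \<alpha> z * indicator disk z \<partial>lborel)"
    by (rule nn_integral_warea[OF assms(1)]) measurable
  also have "\<dots> = (\<integral>\<^sup>+z. (indicator E (c * z) * wdens \<alpha> z) * (ennreal ((cmod (deriv (\<lambda>z. c * z) z))\<^sup>2) * indicator disk z) \<partial>lborel)"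
    using assms by simp
  also have "\<dots> = (\<integral>\<^sup>+w. (indicator E (c * (w / c)) * wdens \<alpha> (w / c)) * indicator ((\<lambda>z. c * z) ` disk) w \<partial>lborel)"
    by (rule nn_integral_injective_holomorphic)
       (use c0 in \<open>auto intro!: holomorphic_intros inj_onI\<close>)
  also have "\<dots> = (\<integral>\<^sup>+w. indicator E w * wdens \<alpha> w * indicator disk w \<partial>lborel)"
    unfolding im using c0 assms by (intro nn_integral_cong) (simp add: wdens_def norm_divide)
  also have "\<dots> = (\<integral>\<^sup>+w. indicator E w \<partial>warea \<alpha>)"
    by (rule nn_integral_warea[OF assms(1), symmetric]) measurable
  also have "\<dots> = emeasure (warea \<alpha>) E" using E by (subst nn_integral_indicator) auto
  finally show "emeasure (distr (warea \<alpha>) (warea \<alpha>) (\<lambda>z. c * z)) E = emeasure (warea \<alpha>) E" .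
qed simp

lemma bounded_integrable_warea:
  fixes f :: "complex \<Rightarrow> 'b :: {banach, second_countable_topology}"
  assumes "\<alpha> > -1" "f \<in> borel_measurable (warea \<alpha>)" "\<And>z. cmod z < 1 \<Longrightarrow> norm (f z) \<le> B"
  shows "integrable (warea \<alpha>) f"
proof -
  interpret finite_measure "warea \<alpha>" by (rule finite_measure_warea[OF assms(1)])
  show ?thesis by (rule integrable_const_bound[where B = B]) (use assms in auto)
qed

text \<open>The moments of \<open>A\<^sub>\<alpha>\<close> restricted to a smaller disk are the squared norms of the monomials there.\<close>

definition ball_moment :: "real \<Rightarrow> real \<Rightarrow> nat \<Rightarrow> real" where
  "ball_moment \<alpha> \<rho> k = (\<integral>z. (cmod z) ^ (2 * k) * indicator (ball 0 \<rho>) z \<partial>warea \<alpha>)"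

lemma power_indicator_integrable:
  assumes "\<alpha> > -1"
  shows "integrable (warea \<alpha>) (\<lambda>z. z ^ j * cnj z ^ k * indicator (ball 0 \<rho>) z)"
    "integrable (warea \<alpha>) (\<lambda>z. (cmod z) ^ (2 * k) * indicator (ball 0 \<rho>) z)"
proof -
  have [measurable]: "ball 0 \<rho> \<in> sets (borel :: complex measure)" by simp
  have "(\<lambda>z. z ^ j * cnj z ^ k * indicator (ball 0 \<rho>) z) \<in> borel_measurable (warea \<alpha>)"
    by measurable
  then show "integrable (warea \<alpha>) (\<lambda>z. z ^ j * cnj z ^ k * indicator (ball 0 \<rho>) z)"
    by (rule bounded_integrable_warea[OF assms, where B = 1])
       (auto simp: norm_mult norm_power indicator_def power_le_one mult_le_one)
  have "(\<lambda>z. (cmod z) ^ (2 * k) * indicator (ball 0 \<rho>) z) \<in> borel_measurable (warea \<alpha>)"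
    by measurable
  then show "integrable (warea \<alpha>) (\<lambda>z. (cmod z) ^ (2 * k) * indicator (ball 0 \<rho>) z)"
    by (rule bounded_integrable_warea[OF assms, where B = 1])
       (auto simp: indicator_def power_le_one)
qed

text \<open>A rotation by \<open>c\<close> multiplies the integral by \<open>c\<^sup>j cnj(c)\<^sup>k\<close> without changing its value; for \<open>j \<noteq> k\<close> some
  unimodular \<open>c\<close> makes this factor equal to \<open>-1\<close>.\<close>

lemma monomials_orthogonal:
  assumes "\<alpha> > -1"
  shows "(\<integral>z. z ^ j * cnj z ^ k * indicator (ball 0 \<rho>) z \<partial>warea \<alpha>) = (if j = k then of_real (ball_moment \<alpha> \<rho> k) else 0)"
proof (cases "j = k")
  case True
  have "(\<integral>z. z ^ j * cnj z ^ k * indicator (ball 0 \<rho>) z \<partial>warea \<alpha>) =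
    (\<integral>z. complex_of_real ((cmod z) ^ (2 * k) * indicator (ball 0 \<rho>) z) \<partial>warea \<alpha>)"
  proof (rule Bochner_Integration.integral_cong)
    fix z
    have "complex_of_real ((cmod z) ^ (2 * k)) = (z * cnj z) ^ k"
      by (simp only: power_mult of_real_power complex_norm_square[symmetric])
    then show "z ^ j * cnj z ^ k * indicator (ball 0 \<rho>) z =
      complex_of_real ((cmod z) ^ (2 * k) * indicator (ball 0 \<rho>) z)"
      using True by (simp add: power_mult_distrib indicator_def)
  qed simp
  also have "\<dots> = of_real (ball_moment \<alpha> \<rho> k)" unfolding ball_moment_def by (rule integral_complex_of_real)
  finally show ?thesis using True by simp
next
  case False
  \<comment> \<open>chosen so that \<open>c\<^sup>j cnj(c)\<^sup>k = cis pi\<close>\<close>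
  define c where "c = cis (pi / (real j - real k))"
  have c: "cmod c = 1" by (simp add: c_def)
  have "c ^ j * cnj c ^ k = cis (real j * (pi / (real j - real k)) - real k * (pi / (real j - real k)))"
    by (simp only: c_def cis_cnj Complex.DeMoivre cis_mult mult_minus_right diff_conv_add_uminus)
  also have "real j * (pi / (real j - real k)) - real k * (pi / (real j - real k)) = pi"
    unfolding left_diff_distrib[symmetric] using False by simp
  finally have cm: "c ^ j * cnj c ^ k = -1" by simp
  let ?f = "\<lambda>z. z ^ j * cnj z ^ k * indicator (ball 0 \<rho>) z :: complex"
  have m: "(\<lambda>z. c * z) \<in> measurable (warea \<alpha>) (warea \<alpha>)"
    by (rule self_map_measurable) (use c in \<open>auto intro!: holomorphic_intros simp: norm_mult\<close>)
  have fm: "?f \<in> borel_measurable (warea \<alpha>)"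
    using power_indicator_integrable(1)[OF assms] by (rule borel_measurable_integrable)
  have "(\<integral>z. ?f z \<partial>warea \<alpha>) = (\<integral>z. ?f z \<partial>distr (warea \<alpha>) (warea \<alpha>) (\<lambda>z. c * z))"
    by (simp only: warea_rotate[OF assms c])
  also have "\<dots> = (\<integral>z. ?f (c * z) \<partial>warea \<alpha>)" by (rule integral_distr[OF m fm])
  also have "\<dots> = (\<integral>z. (c ^ j * cnj c ^ k) * ?f z \<partial>warea \<alpha>)"
    using c by (intro Bochner_Integration.integral_cong) (auto simp: power_mult_distrib indicator_def norm_mult)
  also have "\<dots> = (c ^ j * cnj c ^ k) * (\<integral>z. ?f z \<partial>warea \<alpha>)" by simp
  finally have "(\<integral>z. ?f z \<partial>warea \<alpha>) = - (\<integral>z. ?f z \<partial>warea \<alpha>)" unfolding cm by simp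
  then show ?thesis using False by simp
qed

lemma polynomial_norm_ball:
  assumes "\<alpha> > -1"
  shows "(\<integral>z. (cmod (\<Sum>k<n. a k * z ^ k))\<^sup>2 * indicator (ball 0 \<rho>) z \<partial>warea \<alpha>) =
    (\<Sum>k<n. (cmod (a k))\<^sup>2 * ball_moment \<alpha> \<rho> k)"
proof -
  have "complex_of_real (\<integral>z. (cmod (\<Sum>k<n. a k * z ^ k))\<^sup>2 * indicator (ball 0 \<rho>) z \<partial>warea \<alpha>) =
    (\<integral>z. complex_of_real ((cmod (\<Sum>k<n. a k * z ^ k))\<^sup>2 * indicator (ball 0 \<rho>) z) \<partial>warea \<alpha>)"
    by (rule integral_complex_of_real[symmetric])
  also have "\<dots> = (\<integral>z. (\<Sum>j<n. \<Sum>k<n. (a j * cnj (a k)) * (z ^ j * cnj z ^ k * indicator (ball 0 \<rho>) z)) \<partial>warea \<alpha>)"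
  proof (rule Bochner_Integration.integral_cong)
    fix z
    have "complex_of_real ((cmod (\<Sum>k<n. a k * z ^ k))\<^sup>2 * indicator (ball 0 \<rho>) z) =
      (\<Sum>j<n. a j * z ^ j) * cnj (\<Sum>k<n. a k * z ^ k) * indicator (ball 0 \<rho>) z"
      by (simp only: of_real_mult complex_norm_square) (auto simp: indicator_def)
    also have "\<dots> = (\<Sum>j<n. \<Sum>k<n. (a j * cnj (a k)) * (z ^ j * cnj z ^ k * indicator (ball 0 \<rho>) z))"
      unfolding cnj_sum complex_cnj_mult complex_cnj_power sum_distrib_right sum_distrib_left
      by (subst sum.swap, intro sum.cong refl) (simp only: mult_ac)
    finally show "complex_of_real ((cmod (\<Sum>k<n. a k * z ^ k))\<^sup>2 * indicator (ball 0 \<rho>) z) = \<dots>" .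
  qed simp
  also have "\<dots> = (\<Sum>j<n. \<Sum>k<n. (a j * cnj (a k)) * (if j = k then of_real (ball_moment \<alpha> \<rho> k) else 0))"
    using power_indicator_integrable(1)[OF assms]
    by (simp add: Bochner_Integration.integral_sum monomials_orthogonal[OF assms])
  also have "\<dots> = (\<Sum>j<n. (a j * cnj (a j)) * of_real (ball_moment \<alpha> \<rho> j))"
    by (simp add: if_distrib[of "\<lambda>x. _ * x"] sum.delta cong: if_cong)
  also have "\<dots> = complex_of_real (\<Sum>k<n. (cmod (a k))\<^sup>2 * ball_moment \<alpha> \<rho> k)"
    by (simp only: of_real_sum of_real_mult complex_norm_square)
  finally show ?thesis using of_real_eq_iff by blast
qed

text \<open>On a smaller disk the partial sums are uniformly bounded, so the identity for polynomials passes
  to the limit by dominated convergence.\<close>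

lemma parseval_ball:
  assumes "\<alpha> > -1" and f: "\<And>z. z \<in> disk \<Longrightarrow> (\<lambda>k. a k * z ^ k) sums f z"
    and \<rho>: "0 < \<rho>" "\<rho> < 1"
  shows "(\<lambda>k. (cmod (a k))\<^sup>2 * ball_moment \<alpha> \<rho> k) sums (\<integral>z. (cmod (f z))\<^sup>2 * indicator (ball 0 \<rho>) z \<partial>warea \<alpha>)"
    and "integrable (warea \<alpha>) (\<lambda>z. (cmod (f z))\<^sup>2 * indicator (ball 0 \<rho>) z)"
proof -
  define S where "S = (\<lambda>n z. \<Sum>k<n. a k * z ^ k)"
  have summ: "summable (\<lambda>k. cmod (a k) * \<rho> ^ k)"
  proof -
    \<comment> \<open>convergence at a radius beyond \<open>\<rho>\<close> gives absolute convergence at \<open>\<rho>\<close>\<close>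
    define \<sigma> where "\<sigma> = (1 + \<rho>) / 2"
    have \<sigma>: "\<rho> < \<sigma>" "\<sigma> < 1" "0 < \<sigma>" using \<rho> by (auto simp: \<sigma>_def)
    have "summable (\<lambda>k. a k * of_real \<sigma> ^ k)" using f[of "of_real \<sigma>"] \<sigma> by (auto intro: sums_summable)
    then have "summable (\<lambda>k. norm (a k * of_real \<rho> ^ k))"
      by (rule powser_insidea) (use \<rho> \<sigma> in auto)
    then show ?thesis using \<rho> by (simp add: norm_mult norm_power)
  qed
  define B where "B = (\<Sum>k. cmod (a k) * \<rho> ^ k)"
  have SB: "cmod (S n z) \<le> B" if "cmod z < \<rho>" for n z
  proof -
    have "cmod (S n z) \<le> (\<Sum>k<n. cmod (a k) * \<rho> ^ k)"
      unfolding S_def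
      by (rule order_trans[OF norm_sum]) (use that in \<open>auto intro!: sum_mono mult_left_mono power_mono simp: norm_mult norm_power\<close>)
    also have "\<dots> \<le> B" unfolding B_def using \<rho> by (intro sum_le_suminf summ) auto
    finally show ?thesis .
  qed
  have Slim: "(\<lambda>n. S n z) \<longlonglongrightarrow> f z" if "z \<in> disk" for z
    using f[OF that] by (simp add: sums_def S_def)
  have [measurable]: "ball 0 \<rho> \<in> sets (borel :: complex measure)" by simp
  have Sm [measurable]: "S n \<in> borel_measurable borel" for n unfolding S_def by measurable
  have fm [measurable]: "f \<in> borel_measurable (warea \<alpha>)"
    by (rule borel_measurable_LIMSEQ_metric[of S]) (use Slim in auto)
  let ?g = "\<lambda>n z. (cmod (S n z))\<^sup>2 * indicator (ball 0 \<rho>) z"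
  have lim: "AE z in warea \<alpha>. (\<lambda>n. ?g n z) \<longlonglongrightarrow> (cmod (f z))\<^sup>2 * indicator (ball 0 \<rho>) z"
    by (rule AE_I2) (auto intro!: tendsto_intros Slim)
  have gm: "?g n \<in> borel_measurable (warea \<alpha>)" for n by measurable
  have bd: "AE z in warea \<alpha>. norm (?g n z) \<le> B\<^sup>2" for n
    by (rule AE_I2) (auto simp: indicator_def intro!: power_mono SB)
  have Bi: "integrable (warea \<alpha>) (\<lambda>z. B\<^sup>2)"
    by (rule bounded_integrable_warea[OF assms(1), where B = "B\<^sup>2"]) auto
  have fm2: "(\<lambda>z. (cmod (f z))\<^sup>2 * indicator (ball 0 \<rho>) z) \<in> borel_measurable (warea \<alpha>)" by measurable
  have "(\<lambda>n. \<integral>z. ?g n z \<partial>warea \<alpha>) \<longlonglongrightarrow> (\<integral>z. (cmod (f z))\<^sup>2 * indicator (ball 0 \<rho>) z \<partial>warea \<alpha>)"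
    by (rule integral_dominated_convergence[OF fm2 gm Bi lim bd])
  then show "(\<lambda>k. (cmod (a k))\<^sup>2 * ball_moment \<alpha> \<rho> k) sums (\<integral>z. (cmod (f z))\<^sup>2 * indicator (ball 0 \<rho>) z \<partial>warea \<alpha>)"
    unfolding S_def polynomial_norm_ball[OF assms(1)] sums_def .
  show "integrable (warea \<alpha>) (\<lambda>z. (cmod (f z))\<^sup>2 * indicator (ball 0 \<rho>) z)"
    by (rule integrable_dominated_convergence[OF fm2 gm Bi lim bd])
qed

definition moment :: "real \<Rightarrow> nat \<Rightarrow> real" where
  "moment \<alpha> k = (\<integral>z. (cmod z) ^ (2 * k) \<partial>warea \<alpha>)"

lemma moment_eq_ball_moment: "moment \<alpha> k = ball_moment \<alpha> 1 k"
  unfolding moment_def ball_moment_def by (intro Bochner_Integration.integral_cong) auto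

lemma ball_moment_nonneg: "ball_moment \<alpha> \<rho> k \<ge> 0"
  unfolding ball_moment_def by (intro Bochner_Integration.integral_nonneg) auto

lemma ball_moment_ennreal:
  assumes "\<alpha> > -1"
  shows "ennreal (ball_moment \<alpha> \<rho> k) = (\<integral>\<^sup>+z. ennreal ((cmod z) ^ (2 * k)) * indicator (ball 0 \<rho>) z \<partial>warea \<alpha>)"
proof -
  have "(\<integral>\<^sup>+z. ennreal ((cmod z) ^ (2 * k) * indicator (ball 0 \<rho>) z) \<partial>warea \<alpha>) = ennreal (ball_moment \<alpha> \<rho> k)"
    unfolding ball_moment_def by (rule nn_integral_eq_integral[OF power_indicator_integrable(2)[OF assms]]) auto
  then show ?thesis by (simp add: ennreal_mult ennreal_indicator)
qed

text \<open>The smaller disks exhaust the unit disk, and both sides are the suprema of their restrictions to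
  smaller disks. As an identity in \<open>[0,\<infinity>]\<close> it also decides which power series are square integrable.\<close>

theorem parseval:
  assumes "\<alpha> > -1" and f: "\<And>z. z \<in> disk \<Longrightarrow> (\<lambda>k. a k * z ^ k) sums f z"
    and fm [measurable]: "f \<in> borel_measurable (warea \<alpha>)"
  shows "(\<integral>\<^sup>+z. ennreal ((cmod (f z))\<^sup>2) \<partial>warea \<alpha>) = (\<Sum>k. ennreal ((cmod (a k))\<^sup>2 * moment \<alpha> k))"
proof -
  define h where "h = (\<lambda>z. \<Sum>k. ennreal ((cmod (a k))\<^sup>2) * ennreal ((cmod z) ^ (2 * k)))"
  define \<rho> where "\<rho> = (\<lambda>n::nat. 1 - 1 / (real n + 2))"
  have \<rho>: "0 < \<rho> n" "\<rho> n < 1" for n by (auto simp: \<rho>_def)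
  have inc: "incseq \<rho>" unfolding \<rho>_def by (intro incseq_SucI) (auto simp: field_simps)
  have bm [measurable]: "ball 0 r \<in> sets (borel :: complex measure)" for r by simp
  have hm [measurable]: "h \<in> borel_measurable borel" unfolding h_def by measurable
  have eq: "(\<integral>\<^sup>+z. ennreal ((cmod (f z))\<^sup>2) * indicator (ball 0 r) z \<partial>warea \<alpha>) = (\<integral>\<^sup>+z. h z * indicator (ball 0 r) z \<partial>warea \<alpha>)"
    if r: "0 < r" "r < 1" for r
  proof -
    have "(\<integral>\<^sup>+z. ennreal ((cmod (f z))\<^sup>2) * indicator (ball 0 r) z \<partial>warea \<alpha>) =
      (\<integral>\<^sup>+z. ennreal ((cmod (f z))\<^sup>2 * indicator (ball 0 r) z) \<partial>warea \<alpha>)"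
      by (simp add: ennreal_mult ennreal_indicator)
    also have "\<dots> = ennreal (\<integral>z. (cmod (f z))\<^sup>2 * indicator (ball 0 r) z \<partial>warea \<alpha>)"
      by (rule nn_integral_eq_integral[OF parseval_ball(2)[OF assms(1) f r]]) auto
    also have "\<dots> = (\<Sum>k. ennreal ((cmod (a k))\<^sup>2 * ball_moment \<alpha> r k))"
      by (rule sums_unique, subst sums_ennreal)
         (auto intro!: mult_nonneg_nonneg Bochner_Integration.integral_nonneg ball_moment_nonneg parseval_ball(1)[OF assms(1) f r])
    also have "\<dots> = (\<Sum>k. \<integral>\<^sup>+z. ennreal ((cmod (a k))\<^sup>2) * (ennreal ((cmod z) ^ (2 * k)) * indicator (ball 0 r) z) \<partial>warea \<alpha>)"
      by (intro suminf_cong, subst nn_integral_cmult) (auto simp: ennreal_mult ball_moment_nonneg ball_moment_ennreal[OF assms(1)])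
    also have "\<dots> = (\<integral>\<^sup>+z. h z * indicator (ball 0 r) z \<partial>warea \<alpha>)"
      by (subst nn_integral_suminf[symmetric]) (auto simp: h_def mult.assoc simp flip: ennreal_suminf_multc)
    finally show ?thesis .
  qed
  have SUP_ind: "(SUP n. c * indicator (ball 0 (\<rho> n)) z) = (c::ennreal)" if "z \<in> disk" for z :: complex and c
  proof (rule antisym)
    show "(SUP n. c * indicator (ball 0 (\<rho> n)) z) \<le> c" by (rule SUP_least) (auto simp: indicator_def)
    have "1 - cmod z > 0" using that by simp
    then obtain n where "inverse (real (Suc n)) < 1 - cmod z" using reals_Archimedean by blast
    moreover have "1 / (real n + 2) \<le> inverse (real (Suc n))" by (simp add: field_simps)
    ultimately have "1 / (real n + 2) < 1 - cmod z" by linarith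
    then have "z \<in> ball 0 (\<rho> n)" by (simp add: \<rho>_def)
    then have "c = c * indicator (ball 0 (\<rho> n)) z" by simp
    also have "\<dots> \<le> (SUP n. c * indicator (ball 0 (\<rho> n)) z)" by (rule SUP_upper) auto
    finally show "c \<le> (SUP n. c * indicator (ball 0 (\<rho> n)) z)" .
  qed
  have mono: "incseq (\<lambda>n z. F z * indicator (ball 0 (\<rho> n)) z)" for F :: "complex \<Rightarrow> ennreal"
    using inc by (auto simp: incseq_def le_fun_def indicator_def intro: less_le_trans)
  have exh: "(\<integral>\<^sup>+z. F z \<partial>warea \<alpha>) = (SUP n. \<integral>\<^sup>+z. F z * indicator (ball 0 (\<rho> n)) z \<partial>warea \<alpha>)"
    if [measurable]: "F \<in> borel_measurable (warea \<alpha>)" for F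
  proof -
    have "(\<integral>\<^sup>+z. F z \<partial>warea \<alpha>) = (\<integral>\<^sup>+z. (SUP n. F z * indicator (ball 0 (\<rho> n)) z) \<partial>warea \<alpha>)"
      by (intro nn_integral_cong) (simp add: SUP_ind)
    also have "\<dots> = (SUP n. \<integral>\<^sup>+z. F z * indicator (ball 0 (\<rho> n)) z \<partial>warea \<alpha>)"
      by (rule nn_integral_monotone_convergence_SUP[OF mono]) measurable
    finally show ?thesis .
  qed
  have "(\<integral>\<^sup>+z. ennreal ((cmod (f z))\<^sup>2) \<partial>warea \<alpha>) =
    (SUP n. \<integral>\<^sup>+z. ennreal ((cmod (f z))\<^sup>2) * indicator (ball 0 (\<rho> n)) z \<partial>warea \<alpha>)"
    by (rule exh) measurable
  also have "\<dots> = (SUP n. \<integral>\<^sup>+z. h z * indicator (ball 0 (\<rho> n)) z \<partial>warea \<alpha>)"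
    by (simp only: eq[OF \<rho>])
  also have "\<dots> = (\<integral>\<^sup>+z. h z \<partial>warea \<alpha>)"
    by (rule exh[symmetric]) measurable
  also have "\<dots> = (\<Sum>k. \<integral>\<^sup>+z. ennreal ((cmod (a k))\<^sup>2) * ennreal ((cmod z) ^ (2 * k)) \<partial>warea \<alpha>)"
    unfolding h_def by (rule nn_integral_suminf) measurable
  also have "\<dots> = (\<Sum>k. ennreal ((cmod (a k))\<^sup>2 * moment \<alpha> k))"
  proof (rule suminf_cong)
    fix k
    have "(\<integral>\<^sup>+z. ennreal ((cmod z) ^ (2 * k)) \<partial>warea \<alpha>) = ennreal (moment \<alpha> k)"
      unfolding moment_eq_ball_moment ball_moment_ennreal[OF assms(1)] by (intro nn_integral_cong) auto
    then show "(\<integral>\<^sup>+z. ennreal ((cmod (a k))\<^sup>2) * ennreal ((cmod z) ^ (2 * k)) \<partial>warea \<alpha>) = ennreal ((cmod (a k))\<^sup>2 * moment \<alpha> k)"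
      by (subst nn_integral_cmult) (auto simp: ennreal_mult moment_eq_ball_moment ball_moment_nonneg)
  qed
  finally show ?thesis .
qed

section \<open>The Bergman space as a Hilbert space\<close>

lemma warea_open_pos:
  assumes "\<alpha> > -1" "open E" "E \<noteq> {}" "E \<subseteq> disk"
  shows "emeasure (warea \<alpha>) E > 0"
proof (rule ccontr)
  assume "\<not> emeasure (warea \<alpha>) E > 0"
  then have z: "emeasure (warea \<alpha>) E = 0" by simp
  have Eb [measurable]: "E \<in> sets borel" using assms by auto
  have "E \<in> sets (warea \<alpha>)" using assms Eb in_sets_warea by auto
  then have "(\<integral>\<^sup>+z. indicator E z \<partial>warea \<alpha>) = 0" using z by (subst nn_integral_indicator) auto
  moreover have "(\<integral>\<^sup>+z. indicator E z \<partial>warea \<alpha>) = (\<integral>\<^sup>+z. indicator E z * wdens \<alpha> z * indicator disk z \<partial>lborel)"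
    by (rule nn_integral_warea[OF assms(1)]) measurable
  moreover have "disk \<in> sets (borel :: complex measure)" by simp
  then have "(\<lambda>z. indicator E z * wdens \<alpha> z * indicator disk z) \<in> borel_measurable lborel" by measurable
  ultimately have "AE z in lborel. indicator E z * wdens \<alpha> z * indicator disk z = 0"
    using nn_integral_0_iff_AE[of "\<lambda>z. indicator E z * wdens \<alpha> z * indicator disk z" lborel] by simp
  then have "AE z in lborel. z \<notin> E"
  proof eventually_elim
    case (elim z)
    show "z \<notin> E"
    proof
      assume "z \<in> E"
      then have "z \<in> disk" using assms by auto
      then have "0 < 1 - (cmod z)\<^sup>2" by (simp add: abs_square_less_1)
      then have "(1 - (cmod z)\<^sup>2) powr \<alpha> > 0" by simp
      then have "wdens \<alpha> z > 0" using assms(1) by (simp add: wdens_def)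
      then show False using elim \<open>z \<in> E\<close> \<open>z \<in> disk\<close> by simp
    qed
  qed
  then have "emeasure lborel E = 0" using Eb by (subst (asm) AE_iff_measurable[of E]) auto
  moreover obtain x e where "e > 0" "ball x e \<subseteq> E" using assms by (meson ex_in_conv openE)
  then have "emeasure lborel (ball x e) \<le> emeasure lborel E" using Eb by (intro emeasure_mono) auto
  moreover have "emeasure lborel (ball x e) > 0" using \<open>e > 0\<close> by (simp add: emeasure_ball unit_ball_vol_2)
  ultimately show False by simp
qed

locale bergman_weight =
  fixes \<alpha> :: real
  assumes alpha: "\<alpha> > -1"
begin

abbreviation M where "M \<equiv> warea \<alpha>"
abbreviation A2 where "A2 \<equiv> vecs (bergman \<alpha>)"
abbreviation nrm where "nrm \<equiv> l2norm M"
abbreviation \<gamma> where "\<gamma> \<equiv> moment \<alpha>"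

lemma vnorm_bergman: "vnorm (bergman \<alpha>) = nrm"
  by (simp add: bergman_def l2norm_def fun_eq_iff)

lemma bergman_inner_eq: "bergman_inner \<alpha> = ip M"
  by (simp add: bergman_inner_def ip_def fun_eq_iff)

lemma disk_analytic_measurable: "f \<in> disk_analytic \<Longrightarrow> f \<in> borel_measurable M"
  by (intro measurable_warea disk_analytic_borel)

lemma A2_iff: "f \<in> A2 \<longleftrightarrow> f \<in> disk_analytic \<and> l2 M f"
  using disk_analytic_measurable by (auto simp: bergman_def l2_def)

lemma A2_l2: "f \<in> A2 \<Longrightarrow> l2 M f" by (simp add: A2_iff)

lemma disk_analytic_lincomb:
  "f \<in> disk_analytic \<Longrightarrow> g \<in> disk_analytic \<Longrightarrow> (\<lambda>z. a * f z + b * g z) \<in> disk_analytic"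
  by (auto simp: disk_analytic_def intro!: holomorphic_intros)

lemma A2_lincomb: "f \<in> A2 \<Longrightarrow> g \<in> A2 \<Longrightarrow> (\<lambda>z. a * f z + b * g z) \<in> A2"
  by (simp add: A2_iff disk_analytic_lincomb l2_lincomb)

text \<open>The annulus \<open>R < |z| < 1\<close> has positive mass. Since \<open>R\<close> is arbitrary, this forces every power series
  with \<open>\<Sum> |c\<^sub>k|\<^sup>2 \<gamma>\<^sub>k < \<infinity>\<close> to converge in the whole disk.\<close>

lemma moment_lower:
  assumes "0 \<le> R" "R < 1"
  obtains m where "m > 0" "\<And>k. R ^ (2 * k) * m \<le> \<gamma> k"
proof -
  interpret finite_measure M by (rule finite_measure_warea[OF alpha])
  define E where "E = {z::complex. R < cmod z \<and> cmod z < 1}"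
  have op: "open E" unfolding E_def by (intro open_Collect_conj open_Collect_less continuous_intros)
  have "complex_of_real ((1 + R) / 2) \<in> E" using assms unfolding E_def mem_Collect_eq norm_of_real by auto
  then have "E \<noteq> {}" by auto
  moreover have Ed: "E \<subseteq> disk" by (auto simp: E_def)
  ultimately have "emeasure M E > 0" using warea_open_pos[OF alpha op] by simp
  then have pos: "measure M E > 0" by (simp add: emeasure_eq_measure)
  have EM: "E \<in> sets M" using op Ed in_sets_warea by auto
  have "R ^ (2 * k) * measure M E \<le> \<gamma> k" for k
  proof -
    have "R ^ (2 * k) * measure M E = (\<integral>z. R ^ (2 * k) * indicator E z \<partial>M)"
      using Int_absorb2[OF Ed] by simp
    also have "\<dots> \<le> (\<integral>z. (cmod z) ^ (2 * k) \<partial>M)"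
    proof (rule Bochner_Integration.integral_mono)
      show "integrable M (\<lambda>z. R ^ (2 * k) * indicator E z)"
        using EM by (intro integrable_mult_right integrable_real_indicator) (auto simp: emeasure_eq_measure)
      show "integrable M (\<lambda>z. (cmod z) ^ (2 * k))"
        by (rule bounded_integrable_warea[OF alpha, where B = 1]) (auto simp: power_le_one)
      fix z show "R ^ (2 * k) * indicator E z \<le> (cmod z) ^ (2 * k)"
        using assms by (auto simp: indicator_def E_def intro!: power_mono)
    qed
    finally show ?thesis by (simp add: moment_def)
  qed
  then show ?thesis using that pos by blast
qed

lemma moment_pos: "\<gamma> k > 0"
proof -
  obtain m where m: "m > 0" "\<And>k. (1/2) ^ (2 * k) * m \<le> \<gamma> k"
    by (rule moment_lower[of "1/2"]) auto
  have "0 < (1/2) ^ (2 * k) * m" using m(1) by simp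
  then show ?thesis using m(2)[of k] by linarith
qed

definition coef :: "(complex \<Rightarrow> complex) \<Rightarrow> nat \<Rightarrow> complex" where
  "coef f k = (deriv ^^ k) f 0 / fact k"

lemma coef_sums: "f \<in> disk_analytic \<Longrightarrow> z \<in> disk \<Longrightarrow> (\<lambda>k. coef f k * z ^ k) sums f z"
  using holomorphic_power_series[of f 0 1 z] by (simp add: coef_def disk_analytic_def)

text \<open>Parseval's identity for the difference of the two series, whose sum is zero.\<close>

lemma coef_unique:
  assumes "f \<in> disk_analytic" "\<And>z. z \<in> disk \<Longrightarrow> (\<lambda>k. a k * z ^ k) sums f z"
  shows "coef f k = a k"
proof -
  define d where "d = (\<lambda>k. a k - coef f k)"
  have "(\<lambda>k. d k * z ^ k) sums 0" if "z \<in> disk" for z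
    using sums_diff[OF assms(2)[OF that] coef_sums[OF assms(1) that]] by (simp add: d_def algebra_simps)
  then have "(\<integral>\<^sup>+z. ennreal ((cmod 0)\<^sup>2) \<partial>M) = (\<Sum>k. ennreal ((cmod (d k))\<^sup>2 * \<gamma> k))"
    by (intro parseval[OF alpha]) auto
  then have "(\<Sum>k. ennreal ((cmod (d k))\<^sup>2 * \<gamma> k)) = 0" by simp
  moreover have "ennreal ((cmod (d k))\<^sup>2 * \<gamma> k) \<le> (\<Sum>k. ennreal ((cmod (d k))\<^sup>2 * \<gamma> k))"
    using sum_le_suminf[of "\<lambda>k. ennreal ((cmod (d k))\<^sup>2 * \<gamma> k)" "{k}"] by simp
  ultimately have "ennreal ((cmod (d k))\<^sup>2 * \<gamma> k) = 0" by simp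
  then have "(cmod (d k))\<^sup>2 * \<gamma> k \<le> 0" by (simp add: ennreal_eq_0_iff)
  moreover have "(cmod (d k))\<^sup>2 * \<gamma> k \<ge> 0" using moment_pos[of k] by simp
  ultimately have "d k = 0" using moment_pos[of k] by (metis antisym mult_eq_0_iff norm_eq_zero order_less_irrefl zero_eq_power2)
  then show ?thesis by (simp add: d_def)
qed

lemma coef_lincomb:
  assumes "f \<in> disk_analytic" "g \<in> disk_analytic"
  shows "coef (\<lambda>z. a * f z + b * g z) k = a * coef f k + b * coef g k"
proof (rule coef_unique[OF disk_analytic_lincomb[OF assms]])
  fix z assume "z \<in> disk"
  from sums_add[OF sums_mult[OF coef_sums[OF assms(1) this], of a] sums_mult[OF coef_sums[OF assms(2) this], of b]]
  show "(\<lambda>k. (a * coef f k + b * coef g k) * z ^ k) sums (a * f z + b * g z)"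
    by (simp add: algebra_simps)
qed

lemma parseval_A2:
  assumes "f \<in> A2"
  shows "(\<lambda>k. (cmod (coef f k))\<^sup>2 * \<gamma> k) sums (nrm f)\<^sup>2"
proof -
  have "ennreal ((nrm f)\<^sup>2) = (\<Sum>k. ennreal ((cmod (coef f k))\<^sup>2 * \<gamma> k))"
    using assms l2norm_ennreal[of M f] parseval[OF alpha coef_sums[of f] disk_analytic_measurable[of f]]
    by (simp add: A2_iff)
  then have "(\<lambda>k. ennreal ((cmod (coef f k))\<^sup>2 * \<gamma> k)) sums ennreal ((nrm f)\<^sup>2)"
    using summable_sums[OF summableI[of "\<lambda>k. ennreal ((cmod (coef f k))\<^sup>2 * \<gamma> k)"]] by simp
  then show ?thesis
    by (subst (asm) sums_ennreal) (auto intro: mult_nonneg_nonneg less_imp_le[OF moment_pos])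
qed

text \<open>This is completeness of the Bergman space in terms of Taylor coefficients.\<close>

lemma A2_from_coef:
  assumes "summable (\<lambda>k. (cmod (c k))\<^sup>2 * \<gamma> k)"
  obtains h where "h \<in> A2" "\<And>k. coef h k = c k"
proof -
  have conv: "summable (\<lambda>k. c k * z ^ k)" if z: "z \<in> disk" for z
  proof -
    define R where "R = (1 + cmod z) / 2"
    have R: "cmod z < R" "R < 1" "0 < R" using z norm_ge_zero[of z] by (auto simp: R_def simp del: norm_ge_zero)
    obtain m where m: "m > 0" "\<And>k. R ^ (2 * k) * m \<le> \<gamma> k" using moment_lower[of R] R by auto
    have "convergent (\<lambda>k. (cmod (c k))\<^sup>2 * \<gamma> k)"
      using summable_LIMSEQ_zero[OF assms] by (rule convergentI)
    then have "Bseq (\<lambda>k. (cmod (c k))\<^sup>2 * \<gamma> k)" by (rule convergent_imp_Bseq)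
    then obtain B where B': "B > 0" "\<And>k. norm ((cmod (c k))\<^sup>2 * \<gamma> k) \<le> B" by (auto elim: BseqE)
    have B: "(cmod (c k))\<^sup>2 * \<gamma> k \<le> B" for k using B'(2)[of k] unfolding real_norm_def by (rule abs_le_D1)
    have ck: "cmod (c k) * R ^ k \<le> sqrt (B / m)" for k
    proof (rule real_le_rsqrt)
      have "(cmod (c k))\<^sup>2 * (R ^ (2 * k) * m) \<le> B"
        using mult_left_mono[OF m(2)[of k], of "(cmod (c k))\<^sup>2"] B[of k] by simp
      then show "(cmod (c k) * R ^ k)\<^sup>2 \<le> B / m"
        using m(1) by (simp add: pos_le_divide_eq power_mult_distrib power_even_eq mult.assoc)
    qed
    have "summable (\<lambda>k. sqrt (B / m) * (cmod z / R) ^ k)"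
      using R by (intro summable_mult summable_geometric) auto
    then show ?thesis
    proof (rule summable_comparison_test')
      fix k :: nat
      have "norm (c k * z ^ k) = (cmod (c k) * R ^ k) * (cmod z / R) ^ k"
        using R by (simp add: norm_mult norm_power power_divide)
      also have "\<dots> \<le> sqrt (B / m) * (cmod z / R) ^ k"
        using ck R by (intro mult_right_mono) auto
      finally show "norm (c k * z ^ k) \<le> sqrt (B / m) * (cmod z / R) ^ k" .
    qed
  qed
  define h where "h = on_disk (\<lambda>z. \<Sum>k. c k * z ^ k)"
  have hs: "(\<lambda>k. c k * z ^ k) sums h z" if "z \<in> disk" for z
    using conv[OF that] that by (simp add: h_def on_disk_def summable_sums)
  have "h holomorphic_on disk"
    by (rule power_series_holomorphic[of 0 1 c]) (use hs in auto)
  then have ha: "h \<in> disk_analytic" by (auto simp: disk_analytic_def h_def on_disk_def)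
  have "(\<integral>\<^sup>+z. ennreal ((cmod (h z))\<^sup>2) \<partial>M) = (\<Sum>k. ennreal ((cmod (c k))\<^sup>2 * \<gamma> k))"
    by (rule parseval[OF alpha hs disk_analytic_measurable[OF ha]])
  also have "\<dots> < \<infinity>"
    using assms by (subst suminf_ennreal2) (auto intro: mult_nonneg_nonneg less_imp_le[OF moment_pos])
  finally have "h \<in> A2" using ha l2_iff_nn_integral[OF disk_analytic_measurable[OF ha]] by (simp add: A2_iff)
  then show ?thesis using that[of h] coef_unique[OF ha hs] by blast
qed

text \<open>\<open>tay n\<close> and \<open>tail n\<close> are the orthogonal projections onto the polynomials of degree less than \<open>n\<close> and
  onto the functions whose first \<open>n\<close> Taylor coefficients vanish.\<close>

definition tay :: "nat \<Rightarrow> (complex \<Rightarrow> complex) \<Rightarrow> complex \<Rightarrow> complex" where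
  "tay n f = on_disk (\<lambda>z. \<Sum>k<n. coef f k * z ^ k)"

definition tail :: "nat \<Rightarrow> (complex \<Rightarrow> complex) \<Rightarrow> complex \<Rightarrow> complex" where
  "tail n f = (\<lambda>z. f z - tay n f z)"

definition monomial :: "nat \<Rightarrow> complex \<Rightarrow> complex" where
  "monomial k = on_disk (\<lambda>z. z ^ k)"

lemma bounded_analytic_A2:
  assumes "f \<in> disk_analytic" "\<And>z. z \<in> disk \<Longrightarrow> cmod (f z) \<le> B" shows "f \<in> A2"
proof -
  have [measurable]: "f \<in> borel_measurable M" by (rule disk_analytic_measurable[OF assms(1)])
  have "integrable M (\<lambda>z. (cmod (f z))\<^sup>2)"
    by (rule bounded_integrable_warea[OF alpha, where B = "B\<^sup>2"]) (use assms in \<open>auto intro!: power_mono\<close>)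
  then show ?thesis using assms by (simp add: A2_iff l2_def)
qed

lemma monomial_A2: "monomial k \<in> A2"
  by (rule bounded_analytic_A2[where B = 1])
     (auto simp: monomial_def on_disk_def norm_power power_le_one intro!: on_disk_analytic holomorphic_intros)

lemma coef_monomial: "coef (monomial k) j = (if j = k then 1 else 0)"
proof (rule coef_unique)
  show "monomial k \<in> disk_analytic" using monomial_A2 by (simp add: A2_iff)
  fix z assume "z \<in> disk"
  then show "(\<lambda>j. (if j = k then 1 else 0) * z ^ j) sums monomial k z"
    using sums_single[of k "\<lambda>j. z ^ j"] by (simp add: monomial_def on_disk_def if_distrib[of "\<lambda>x. x * _"] cong: if_cong)
qed

lemma tay_Suc: "tay (Suc n) f = (\<lambda>z. 1 * tay n f z + coef f n * monomial n z)"
  by (auto simp: tay_def monomial_def on_disk_def fun_eq_iff)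

lemma tay_0: "tay 0 f = (\<lambda>z. 0)"
  by (auto simp: tay_def on_disk_def)

lemma zero_A2: "(\<lambda>z. 0) \<in> A2"
  by (rule bounded_analytic_A2[where B = 0]) (auto simp: disk_analytic_def)

lemma tay_A2: "tay n f \<in> A2"
proof (induction n)
  case (Suc n)
  then show ?case unfolding tay_Suc by (rule A2_lincomb[OF _ monomial_A2])
qed (simp add: tay_0 zero_A2)

lemma tail_alt: "tail n f = (\<lambda>z. 1 * f z + (-1) * tay n f z)"
  by (simp add: tail_def)

lemma tail_A2: "f \<in> A2 \<Longrightarrow> tail n f \<in> A2"
  unfolding tail_alt by (rule A2_lincomb) (auto intro: tay_A2)

lemma coef_tay: "coef (tay n f) k = (if k < n then coef f k else 0)"
proof (induction n)
  case 0
  then show ?case using coef_lincomb[of "\<lambda>z. 0" "\<lambda>z. 0" 0 0 k] zero_A2 by (simp add: tay_0 A2_iff)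
next
  case (Suc n)
  then show ?case
    unfolding tay_Suc using coef_lincomb[of "tay n f" "monomial n" 1 "coef f n" k] tay_A2 monomial_A2
    by (auto simp: A2_iff coef_monomial less_Suc_eq)
qed

lemma coef_tail: "f \<in> A2 \<Longrightarrow> coef (tail n f) k = (if k < n then 0 else coef f k)"
  unfolding tail_alt using coef_lincomb[of f "tay n f" 1 "-1" k] tay_A2
  by (auto simp: A2_iff coef_tay)

lemma nrm_tay: "(nrm (tay n f))\<^sup>2 = (\<Sum>k<n. (cmod (coef f k))\<^sup>2 * \<gamma> k)"
proof -
  have "(\<lambda>k. (cmod (coef (tay n f) k))\<^sup>2 * \<gamma> k) sums (\<Sum>k<n. (cmod (coef (tay n f) k))\<^sup>2 * \<gamma> k)"
    by (rule sums_finite) (auto simp: coef_tay)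
  also have "(\<Sum>k<n. (cmod (coef (tay n f) k))\<^sup>2 * \<gamma> k) = (\<Sum>k<n. (cmod (coef f k))\<^sup>2 * \<gamma> k)"
    by (simp add: coef_tay)
  finally show ?thesis using parseval_A2[OF tay_A2] sums_unique2 by blast
qed

lemma nrm_tail:
  assumes "f \<in> A2"
  shows "(nrm (tail n f))\<^sup>2 = (nrm f)\<^sup>2 - (\<Sum>k<n. (cmod (coef f k))\<^sup>2 * \<gamma> k)"
proof -
  have "(\<lambda>k. (cmod (coef f k))\<^sup>2 * \<gamma> k - (cmod (coef (tay n f) k))\<^sup>2 * \<gamma> k) sums ((nrm f)\<^sup>2 - (nrm (tay n f))\<^sup>2)"
    by (intro sums_diff parseval_A2 assms tay_A2)
  moreover have "(\<lambda>k. (cmod (coef f k))\<^sup>2 * \<gamma> k - (cmod (coef (tay n f) k))\<^sup>2 * \<gamma> k) =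
    (\<lambda>k. (cmod (coef (tail n f) k))\<^sup>2 * \<gamma> k)"
    by (auto simp: coef_tail[OF assms] coef_tay fun_eq_iff)
  ultimately show ?thesis
    using parseval_A2[OF tail_A2[OF assms], of n] sums_unique2 by (metis nrm_tay)
qed

lemma nrm_tail_le: "f \<in> A2 \<Longrightarrow> nrm (tail n f) \<le> nrm f"
proof -
  assume "f \<in> A2"
  then have "(nrm (tail n f))\<^sup>2 = (nrm f)\<^sup>2 - (nrm (tay n f))\<^sup>2" by (simp only: nrm_tail nrm_tay)
  then have "(nrm (tail n f))\<^sup>2 \<le> (nrm f)\<^sup>2" using zero_le_power2[of "nrm (tay n f)"] by linarith
  then show ?thesis by (rule power2_le_imp_le) simp
qed

lemma nrm_tay_le: "f \<in> A2 \<Longrightarrow> nrm (tay n f) \<le> nrm f"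
proof -
  assume "f \<in> A2"
  then have "(nrm (tail n f))\<^sup>2 = (nrm f)\<^sup>2 - (nrm (tay n f))\<^sup>2" by (simp only: nrm_tail nrm_tay)
  then have "(nrm (tay n f))\<^sup>2 \<le> (nrm f)\<^sup>2" using zero_le_power2[of "nrm (tail n f)"] by linarith
  then show ?thesis by (rule power2_le_imp_le) simp
qed

lemma nrm_tail_tendsto:
  assumes "f \<in> A2" shows "(\<lambda>n. nrm (tail n f)) \<longlonglongrightarrow> 0"
proof -
  have "(\<lambda>n. \<Sum>k<n. (cmod (coef f k))\<^sup>2 * \<gamma> k) \<longlonglongrightarrow> (nrm f)\<^sup>2"
    using parseval_A2[OF assms] by (simp add: sums_def)
  then have "(\<lambda>n. (nrm f)\<^sup>2 - (\<Sum>k<n. (cmod (coef f k))\<^sup>2 * \<gamma> k)) \<longlonglongrightarrow> (nrm f)\<^sup>2 - (nrm f)\<^sup>2"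
    by (intro tendsto_intros)
  then have "(\<lambda>n. sqrt ((nrm (tail n f))\<^sup>2)) \<longlonglongrightarrow> sqrt 0"
    unfolding nrm_tail[OF assms] by (intro tendsto_real_sqrt) simp
  then show ?thesis by simp
qed

text \<open>Polarization reduces the inner product to norms, and the same identity holds for each pair of
  coefficients.\<close>

lemma polarization_pointwise:
  fixes a b :: complex
  shows "4 * (a * cnj b) = of_real ((cmod (1 * a + 1 * b))\<^sup>2) - of_real ((cmod (1 * a + (-1) * b))\<^sup>2)
    + \<i> * of_real ((cmod (1 * a + \<i> * b))\<^sup>2) - \<i> * of_real ((cmod (1 * a + (-\<i>) * b))\<^sup>2)"
proof -
  have *: "4 * (a * b') = (a + b) * (a' + b') - (a - b) * (a' - b') + i * ((a + i * b) * (a' - i * b'))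
    - i * ((a - i * b) * (a' + i * b'))" if "i * i = -1" for a b a' b' i :: complex
    using that by algebra
  show ?thesis unfolding complex_norm_square using *[of \<i> a "cnj b" b "cnj a"] by simp
qed

lemma ip_sums:
  assumes "f \<in> A2" "g \<in> A2"
  shows "(\<lambda>k. coef f k * cnj (coef g k) * of_real (\<gamma> k)) sums ip M f g"
proof -
  define q where "q = (\<lambda>c z. 1 * f z + c * g z)"
  have qA: "q c \<in> A2" for c unfolding q_def by (intro A2_lincomb assms)
  have cq: "coef (q c) k = 1 * coef f k + c * coef g k" for c k
    unfolding q_def using coef_lincomb[of f g 1 c k] assms by (simp add: A2_iff)
  have ps: "(\<lambda>k. complex_of_real ((cmod (1 * coef f k + c * coef g k))\<^sup>2 * \<gamma> k)) sums of_real ((nrm (q c))\<^sup>2)" for c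
    using parseval_A2[OF qA[of c]] unfolding cq by (rule sums_of_real)
  have int: "integrable M (\<lambda>z. complex_of_real ((cmod (q c z))\<^sup>2))" for c
    using qA[of c] by (simp add: A2_iff l2_def integrable_of_real del: of_real_power)
  have "4 * ip M f g = (\<integral>z. 4 * (f z * cnj (g z)) \<partial>M)" unfolding ip_def by simp
  also have "\<dots> = (\<integral>z. (complex_of_real ((cmod (q 1 z))\<^sup>2) - complex_of_real ((cmod (q (-1) z))\<^sup>2)
    + \<i> * complex_of_real ((cmod (q \<i> z))\<^sup>2)) - \<i> * complex_of_real ((cmod (q (-\<i>) z))\<^sup>2) \<partial>M)"
    unfolding q_def polarization_pointwise by simp
  also have "\<dots> = of_real ((nrm (q 1))\<^sup>2) - of_real ((nrm (q (-1)))\<^sup>2) + \<i> * of_real ((nrm (q \<i>))\<^sup>2) - \<i> * of_real ((nrm (q (-\<i>)))\<^sup>2)"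
    unfolding l2norm_power2 integral_complex_of_real[symmetric]
    by (subst Bochner_Integration.integral_diff, (intro Bochner_Integration.integrable_add Bochner_Integration.integrable_diff integrable_mult_right int)+,
        subst Bochner_Integration.integral_add, (intro Bochner_Integration.integrable_diff integrable_mult_right int)+,
        subst Bochner_Integration.integral_diff, (intro int)+) (simp only: integral_mult_right_zero)
  finally have e: "4 * ip M f g = of_real ((nrm (q 1))\<^sup>2) - of_real ((nrm (q (-1)))\<^sup>2) + \<i> * of_real ((nrm (q \<i>))\<^sup>2) - \<i> * of_real ((nrm (q (-\<i>)))\<^sup>2)" .
  have "(\<lambda>k. of_real ((cmod (1 * coef f k + 1 * coef g k))\<^sup>2 * \<gamma> k) - of_real ((cmod (1 * coef f k + (-1) * coef g k))\<^sup>2 * \<gamma> k)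
    + \<i> * of_real ((cmod (1 * coef f k + \<i> * coef g k))\<^sup>2 * \<gamma> k) - \<i> * of_real ((cmod (1 * coef f k + (-\<i>) * coef g k))\<^sup>2 * \<gamma> k)) sums (4 * ip M f g)"
    unfolding e by (intro sums_diff sums_add sums_mult ps)
  also have "(\<lambda>k. of_real ((cmod (1 * coef f k + 1 * coef g k))\<^sup>2 * \<gamma> k) - of_real ((cmod (1 * coef f k + (-1) * coef g k))\<^sup>2 * \<gamma> k)
    + \<i> * of_real ((cmod (1 * coef f k + \<i> * coef g k))\<^sup>2 * \<gamma> k) - \<i> * of_real ((cmod (1 * coef f k + (-\<i>) * coef g k))\<^sup>2 * \<gamma> k))
    = (\<lambda>k. 4 * (coef f k * cnj (coef g k)) * of_real (\<gamma> k))"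
    unfolding polarization_pointwise of_real_mult by (simp only: algebra_simps)
  finally have "(\<lambda>k. (1/4) * (4 * (coef f k * cnj (coef g k)) * of_real (\<gamma> k))) sums ((1/4) * (4 * ip M f g))"
    by (rule sums_mult)
  then show ?thesis by (simp add: mult.assoc)
qed

text \<open>On polynomials \<open>L f = \<Sum> coef f k * l\<^sub>k\<close> with \<open>l\<^sub>k = L(z\<^sup>k)\<close>, and by boundedness this extends to the
  whole space. The representing function has coefficients \<open>c\<^sub>k = cnj(l\<^sub>k) / \<gamma>\<^sub>k\<close>; testing \<open>L\<close> on the partial
  sums of \<open>\<Sum> c\<^sub>k z\<^sup>k\<close> shows that these coefficients define an element of norm at most \<open>K\<close>.\<close>

theorem riesz:
  assumes lin: "\<And>f g a b. f \<in> A2 \<Longrightarrow> g \<in> A2 \<Longrightarrow> L (\<lambda>z. a * f z + b * g z) = a * L f + b * L g"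
    and bd: "\<And>f. f \<in> A2 \<Longrightarrow> cmod (L f) \<le> K * nrm f"
  obtains h where "h \<in> A2" "\<And>f. f \<in> A2 \<Longrightarrow> L f = ip M f h" "nrm h \<le> K"
proof -
  define l where "l = (\<lambda>k. L (monomial k))"
  have L0: "L (\<lambda>z. 0) = 0" using lin[OF zero_A2 zero_A2, of 0 0] by simp
  have Ltay: "L (tay n f) = (\<Sum>k<n. coef f k * l k)" for n f
  proof (induction n)
    case (Suc n)
    then show ?case unfolding tay_Suc using lin[OF tay_A2[of n f] monomial_A2[of n], of 1 "coef f n"] by (simp add: l_def)
  qed (simp add: tay_0 L0)
  have Lsums: "(\<lambda>k. coef f k * l k) sums L f" if f: "f \<in> A2" for f
  proof -
    have "(\<lambda>n. L (tail n f)) \<longlonglongrightarrow> 0"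
    proof (rule Lim_null_comparison)
      show "\<forall>\<^sub>F n in sequentially. norm (L (tail n f)) \<le> K * nrm (tail n f)" using bd tail_A2[OF f] by simp
      show "(\<lambda>n. K * nrm (tail n f)) \<longlonglongrightarrow> 0" using tendsto_mult_left[OF nrm_tail_tendsto[OF f], of K] by simp
    qed
    moreover have "L (tail n f) = L f - L (tay n f)" for n
      unfolding tail_alt using lin[OF f tay_A2, of 1 "-1"] by simp
    ultimately have "(\<lambda>n. L f - (L f - L (tay n f))) \<longlonglongrightarrow> L f - 0"
      by (intro tendsto_diff) auto
    then show ?thesis by (simp add: sums_def Ltay)
  qed
  define c where "c = (\<lambda>k. cnj (l k) / of_real (\<gamma> k))"
  have cl: "(cmod (c k))\<^sup>2 * \<gamma> k = (cmod (l k))\<^sup>2 / \<gamma> k" for k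
    using moment_pos[of k] by (simp add: c_def norm_divide power_divide power2_eq_square field_simps)
  have K0: "K \<ge> 0"
  proof -
    have "nrm (monomial 0) > 0"
    proof -
      have "(\<lambda>k. (cmod (coef (monomial 0) k))\<^sup>2 * \<gamma> k) sums (\<Sum>k\<in>{0}. (cmod (coef (monomial 0) k))\<^sup>2 * \<gamma> k)"
        by (rule sums_finite) (auto simp: coef_monomial)
      then have "(nrm (monomial 0))\<^sup>2 = \<gamma> 0" using parseval_A2[OF monomial_A2[of 0]] sums_unique2 by (force simp: coef_monomial)
      then show ?thesis using moment_pos[of 0] by (metis l2norm_nonneg less_le zero_eq_power2)
    qed
    moreover have "0 \<le> K * nrm (monomial 0)" using bd[OF monomial_A2[of 0]] norm_ge_zero order_trans by blast
    ultimately show ?thesis by (simp add: zero_le_mult_iff)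
  qed
  have part: "(\<Sum>k<n. (cmod (c k))\<^sup>2 * \<gamma> k) \<le> K\<^sup>2" for n
  proof -
    define S where "S = (\<Sum>k<n. (cmod (c k))\<^sup>2 * \<gamma> k)"
    have S0: "S \<ge> 0" unfolding S_def using moment_pos by (intro sum_nonneg mult_nonneg_nonneg) (auto intro: less_imp_le)
    define cn where "cn = (\<lambda>k. if k < n then c k else 0)"
    have "summable (\<lambda>k. (cmod (cn k))\<^sup>2 * \<gamma> k)"
      by (rule summable_finite[of "{..<n}"]) (auto simp: cn_def)
    then obtain g where g: "g \<in> A2" "\<And>k. coef g k = cn k" using A2_from_coef by metis
    have gt: "tay n g = g"
    proof -
      have "nrm (tail n g) = 0"
      proof -
        have "(\<lambda>k. (cmod (coef (tail n g) k))\<^sup>2 * \<gamma> k) = (\<lambda>k. 0)"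
          using coef_tail[OF g(1)] g(2) by (auto simp: cn_def)
        then have "(nrm (tail n g))\<^sup>2 = 0" using parseval_A2[OF tail_A2[OF g(1)], of n] sums_zero sums_unique2 by metis
        then show ?thesis by simp
      qed
      have "coef (tay n g) k = coef g k" for k using g(2) by (simp add: coef_tay cn_def)
      then have "tay n g z = g z" if "z \<in> disk" for z
        using coef_sums[of "tay n g" z] coef_sums[of g z] tay_A2 g(1) that sums_unique2 by (fastforce simp: A2_iff)
      moreover have "tay n g z = g z" if "z \<notin> disk" for z
        using tay_A2[of n g] g(1) that by (auto simp: A2_iff disk_analytic_def)
      ultimately show ?thesis by blast
    qed
    have "L g = (\<Sum>k<n. coef g k * l k)" using Ltay[of n g] gt by simp
    also have "\<dots> = of_real S"
      unfolding S_def of_real_sum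
    proof (rule sum.cong)
      fix k assume "k \<in> {..<n}"
      then have "coef g k * l k = cnj (l k) * l k / of_real (\<gamma> k)" by (simp add: g(2) cn_def c_def)
      also have "\<dots> = of_real ((cmod (l k))\<^sup>2 / \<gamma> k)" by (simp only: of_real_divide complex_norm_square mult.commute)
      finally show "coef g k * l k = of_real ((cmod (c k))\<^sup>2 * \<gamma> k)" using cl by simp
    qed simp
    finally have LS: "cmod (L g) = S" using S0 by simp
    have nS: "(nrm g)\<^sup>2 = S"
      using nrm_tay[of n g] gt by (simp add: S_def g(2) cn_def)
    have "S \<le> K * nrm g" using bd[OF g(1)] LS by simp
    then have "(nrm g) * nrm g \<le> K * nrm g" using nS by (simp add: power2_eq_square)
    then have "nrm g \<le> K" using K0 by (cases "nrm g = 0") (auto dest: mult_right_le_imp_le simp: less_le)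
    then have "(nrm g)\<^sup>2 \<le> K\<^sup>2" by (intro power_mono) auto
    then show ?thesis using nS S_def by simp
  qed
  have nn: "0 \<le> (cmod (c k))\<^sup>2 * \<gamma> k" for k using moment_pos[of k] by simp
  have sm: "summable (\<lambda>k. (cmod (c k))\<^sup>2 * \<gamma> k)"
    by (rule bounded_imp_summable[of _ "K\<^sup>2"]) (use nn part in \<open>auto simp: lessThan_Suc_atMost[symmetric] simp del: sum.lessThan_Suc\<close>)
  obtain h where h: "h \<in> A2" "\<And>k. coef h k = c k" using A2_from_coef[OF sm] by metis
  have "L f = ip M f h" if f: "f \<in> A2" for f
  proof -
    have "coef f k * cnj (coef h k) * of_real (\<gamma> k) = coef f k * l k" for k
      using moment_pos[of k] by (simp add: h(2) c_def)
    then show ?thesis using ip_sums[OF f h(1)] Lsums[OF f] sums_unique2 by (simp only:)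
  qed
  moreover have "nrm h \<le> K"
  proof -
    have "(nrm h)\<^sup>2 \<le> K\<^sup>2"
      using parseval_A2[OF h(1)] part unfolding h(2) sums_def by (intro LIMSEQ_le_const2) auto
    then show ?thesis using K0 by (rule power2_le_imp_le)
  qed
  ultimately show ?thesis using that h(1) by blast
qed

end

section \<open>Compact operators and essential norms on normed function spaces\<close>

definition normed_fs :: "fun_space \<Rightarrow> bool" where
  "normed_fs V \<longleftrightarrow>
     (\<lambda>z. 0) \<in> vecs V \<and>
     (\<forall>f\<in>vecs V. 0 \<le> vnorm V f) \<and>
     (\<forall>f\<in>vecs V. \<forall>a. vnorm V (\<lambda>z. a * f z) = cmod a * vnorm V f) \<and>
     (\<forall>f\<in>vecs V. \<forall>g\<in>vecs V. \<forall>a b. (\<lambda>z. a * f z + b * g z) \<in> vecs V \<and>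
        vnorm V (\<lambda>z. a * f z + b * g z) \<le> cmod a * vnorm V f + cmod b * vnorm V g)"

lemma normed_fsD:
  assumes "normed_fs V"
  shows normed_fs_zero: "(\<lambda>z. 0) \<in> vecs V"
    and normed_fs_nonneg: "f \<in> vecs V \<Longrightarrow> 0 \<le> vnorm V f"
    and normed_fs_scale: "f \<in> vecs V \<Longrightarrow> vnorm V (\<lambda>z. a * f z) = cmod a * vnorm V f"
    and normed_fs_lincomb: "f \<in> vecs V \<Longrightarrow> g \<in> vecs V \<Longrightarrow> (\<lambda>z. a * f z + b * g z) \<in> vecs V"
    and normed_fs_triangle: "f \<in> vecs V \<Longrightarrow> g \<in> vecs V \<Longrightarrow>
      vnorm V (\<lambda>z. a * f z + b * g z) \<le> cmod a * vnorm V f + cmod b * vnorm V g"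
  using assms unfolding normed_fs_def by auto

lemma normed_fs_more:
  assumes "normed_fs V" "f \<in> vecs V" "g \<in> vecs V"
  shows normed_fs_mult_mem: "(\<lambda>z. a * f z) \<in> vecs V"
    and normed_fs_add_mem: "(\<lambda>z. f z + g z) \<in> vecs V"
    and normed_fs_diff_mem: "(\<lambda>z. f z - g z) \<in> vecs V"
    and normed_fs_add_le: "vnorm V (\<lambda>z. f z + g z) \<le> vnorm V f + vnorm V g"
  using normed_fs_lincomb[OF assms, of a 0] normed_fs_lincomb[OF assms, of 1 1]
    normed_fs_lincomb[OF assms, of 1 "-1"] normed_fs_triangle[OF assms, of 1 1] by auto

lemma normed_fs_zero_norm: "normed_fs V \<Longrightarrow> vnorm V (\<lambda>z. 0) = 0"
  using normed_fs_scale[of V "\<lambda>z. 0" 0] normed_fs_zero by auto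

lemma linear_opD:
  assumes "linear_op V W T"
  shows linear_op_mem: "f \<in> vecs V \<Longrightarrow> T f \<in> vecs W"
    and linear_op_lincomb: "f \<in> vecs V \<Longrightarrow> g \<in> vecs V \<Longrightarrow> T (\<lambda>z. a * f z + b * g z) = (\<lambda>z. a * T f z + b * T g z)"
  using assms by (auto simp: linear_op_def)

lemma linear_op_more:
  assumes "linear_op V W T" "f \<in> vecs V" "g \<in> vecs V"
  shows linear_op_scale: "T (\<lambda>z. a * f z) = (\<lambda>z. a * T f z)"
    and linear_op_diff: "T (\<lambda>z. f z - g z) = (\<lambda>z. T f z - T g z)"
  using linear_op_lincomb[OF assms, of a 0] linear_op_lincomb[OF assms, of 1 "-1"] by auto

lemma linear_op_combine:
  assumes "normed_fs W" "linear_op V W S" "linear_op V W T"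
  shows "linear_op V W (\<lambda>f z. a * S f z + b * T f z)"
  using normed_fs_lincomb[OF assms(1)] linear_op_mem[OF assms(2)] linear_op_mem[OF assms(3)]
    linear_op_lincomb[OF assms(2)] linear_op_lincomb[OF assms(3)]
  unfolding linear_op_def by (auto simp: fun_eq_iff algebra_simps)

text \<open>A vector of norm zero has all its multiples in the unit ball, so its image must have norm zero;
  every other vector can be normalized.\<close>

lemma unit_ball_bound:
  assumes V: "normed_fs V" and W: "normed_fs W" and T: "linear_op V W T"
    and C: "\<And>f. f \<in> vecs V \<Longrightarrow> vnorm V f \<le> 1 \<Longrightarrow> vnorm W (T f) \<le> C" and f: "f \<in> vecs V"
  shows "vnorm W (T f) \<le> C * vnorm V f"
proof -
  have sc: "c * vnorm W (T f) \<le> C" if "c \<ge> 0" "c * vnorm V f \<le> 1" for c :: real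
  proof -
    have "(\<lambda>z. of_real c * f z) \<in> vecs V" by (rule normed_fs_mult_mem[OF V f f])
    moreover have "vnorm V (\<lambda>z. of_real c * f z) \<le> 1" using normed_fs_scale[OF V f, of "of_real c"] that by simp
    ultimately have "vnorm W (T (\<lambda>z. of_real c * f z)) \<le> C" by (rule C)
    then show ?thesis
      using linear_op_scale[OF T f f, of "of_real c"] normed_fs_scale[OF W linear_op_mem[OF T f], of "of_real c"] that(1) by simp
  qed
  show ?thesis
  proof (cases "vnorm V f = 0")
    case True
    have "vnorm W (T f) \<le> 0"
    proof (rule ccontr)
      assume "\<not> vnorm W (T f) \<le> 0"
      then have pos: "vnorm W (T f) > 0" by simp
      have "(\<bar>C\<bar> + 1) / vnorm W (T f) * vnorm W (T f) \<le> C" by (rule sc) (use pos True in auto)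
      then show False using pos by simp
    qed
    then show ?thesis using True by simp
  next
    case False
    then have pos: "vnorm V f > 0" using normed_fs_nonneg[OF V f] by simp
    have "1 / vnorm V f * vnorm W (T f) \<le> C" by (rule sc) (use pos in auto)
    then show ?thesis using pos by (simp add: field_simps)
  qed
qed

lemma op_norm_bound_unit:
  assumes "normed_fs V" "bounded_op V W T" and f: "f \<in> vecs V" "vnorm V f \<le> 1"
  shows "vnorm W (T f) \<le> op_norm V W T"
proof -
  obtain C where C: "\<And>f. f \<in> vecs V \<Longrightarrow> vnorm W (T f) \<le> C * vnorm V f" using assms(2) by (auto simp: bounded_op_def)
  show ?thesis
    unfolding op_norm_def
  proof (rule cSUP_upper)
    show "bdd_above ((\<lambda>f. vnorm W (T f)) ` {f \<in> vecs V. vnorm V f \<le> 1})"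
    proof (rule bdd_aboveI2)
      fix g assume "g \<in> {f \<in> vecs V. vnorm V f \<le> 1}"
      then have g: "g \<in> vecs V" "vnorm V g \<le> 1" by auto
      have "vnorm W (T g) \<le> C * vnorm V g" by (rule C[OF g(1)])
      also have "\<dots> \<le> \<bar>C\<bar> * 1" using g(2) normed_fs_nonneg[OF assms(1) g(1)] by (intro mult_mono) auto
      finally show "vnorm W (T g) \<le> \<bar>C\<bar>" by simp
    qed
  qed (use f in auto)
qed

lemma op_norm_bound:
  assumes "normed_fs V" "normed_fs W" "bounded_op V W T" "f \<in> vecs V"
  shows "vnorm W (T f) \<le> op_norm V W T * vnorm V f"
  by (rule unit_ball_bound[OF assms(1,2) _ _ assms(4)])
     (use assms(3) op_norm_bound_unit[OF assms(1,3)] in \<open>auto simp: bounded_op_def\<close>)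

lemma op_norm_le:
  assumes "normed_fs V" "\<And>f. f \<in> vecs V \<Longrightarrow> vnorm V f \<le> 1 \<Longrightarrow> vnorm W (T f) \<le> C"
  shows "op_norm V W T \<le> C"
  unfolding op_norm_def using assms normed_fs_zero[OF assms(1)] normed_fs_zero_norm[OF assms(1)]
  by (intro cSUP_least) (auto intro!: exI[of _ "\<lambda>z. 0"])

lemma op_norm_nonneg:
  assumes "normed_fs V" "normed_fs W" "bounded_op V W T"
  shows "op_norm V W T \<ge> 0"
proof -
  have lin: "linear_op V W T" using assms(3) by (simp add: bounded_op_def)
  have "vnorm W (T (\<lambda>z. 0)) \<le> op_norm V W T"
    by (rule op_norm_bound_unit[OF assms(1,3) normed_fs_zero[OF assms(1)]])
       (simp add: normed_fs_zero_norm[OF assms(1)])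
  moreover have "0 \<le> vnorm W (T (\<lambda>z. 0))"
    by (intro normed_fs_nonneg[OF assms(2)] linear_op_mem[OF lin] normed_fs_zero[OF assms(1)])
  ultimately show ?thesis by simp
qed

lemma bounded_opI_unit:
  assumes "normed_fs V" "normed_fs W" "linear_op V W T"
    "\<And>f. f \<in> vecs V \<Longrightarrow> vnorm V f \<le> 1 \<Longrightarrow> vnorm W (T f) \<le> C"
  shows "bounded_op V W T"
  using unit_ball_bound[OF assms] assms(3) unfolding bounded_op_def by blast

lemma bounded_op_combine:
  assumes "normed_fs V" "normed_fs W" "bounded_op V W S" "bounded_op V W T"
  shows "bounded_op V W (\<lambda>f z. a * S f z + b * T f z)"
proof -
  have lin: "linear_op V W S" "linear_op V W T" using assms by (auto simp: bounded_op_def)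
  have "vnorm W (\<lambda>z. a * S f z + b * T f z) \<le> cmod a * op_norm V W S + cmod b * op_norm V W T"
    if f: "f \<in> vecs V" "vnorm V f \<le> 1" for f
    by (rule order_trans[OF normed_fs_triangle[OF assms(2) linear_op_mem[OF lin(1) f(1)] linear_op_mem[OF lin(2) f(1)]]])
       (intro add_mono mult_left_mono op_norm_bound_unit assms f norm_ge_zero)
  then show ?thesis by (rule bounded_opI_unit[OF assms(1,2) linear_op_combine[OF assms(2) lin]])
qed

lemma bounded_op_diff:
  assumes "normed_fs V" "normed_fs W" "bounded_op V W S" "bounded_op V W T"
  shows "bounded_op V W (\<lambda>f z. S f z - T f z)"
  using bounded_op_combine[OF assms, of 1 "-1"] by simp

lemma bounded_op_comp:
  assumes "bounded_op V W S" "bounded_op W X T" "normed_fs V" "normed_fs W" "normed_fs X"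
  shows "bounded_op V X (\<lambda>f. T (S f))"
proof -
  have lin: "linear_op V W S" "linear_op W X T" using assms by (auto simp: bounded_op_def)
  have "linear_op V X (\<lambda>f. T (S f))"
    unfolding linear_op_def
    by (auto simp: linear_op_lincomb[OF lin(1)] linear_op_lincomb[OF lin(2)] linear_op_mem[OF lin(1)] linear_op_mem[OF lin(2)])
  moreover have "vnorm X (T (S f)) \<le> op_norm W X T * op_norm V W S"
    if f: "f \<in> vecs V" "vnorm V f \<le> 1" for f
    by (rule order_trans[OF op_norm_bound[OF assms(4,5,2) linear_op_mem[OF lin(1) f(1)]]])
       (intro mult_left_mono op_norm_bound_unit op_norm_nonneg assms f)
  ultimately show ?thesis by (rule bounded_opI_unit[OF assms(3,5)])
qed

text \<open>Otherwise there are unit vectors \<open>f\<^sub>n\<close> with \<open>\<parallel>K f\<^sub>n\<parallel> > n\<close>, and no subsequence of \<open>K f\<^sub>n\<close> converges.\<close>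

lemma compact_imp_bounded:
  assumes V: "normed_fs V" and W: "normed_fs W" and K: "compact_op V W K"
  shows "bounded_op V W K"
proof (rule ccontr)
  assume nb: "\<not> bounded_op V W K"
  have lin: "linear_op V W K" using K by (simp add: compact_op_def)
  have "\<exists>f. f \<in> vecs V \<and> vnorm V f \<le> 1 \<and> vnorm W (K f) > real n" for n
    using bounded_opI_unit[OF V W lin, of "real n"] nb by (metis not_le)
  then obtain f where f: "\<And>n. f n \<in> vecs V" "\<And>n. vnorm V (f n) \<le> 1" "\<And>n. vnorm W (K (f n)) > real n" by metis
  then obtain s h where s: "strict_mono (s :: nat \<Rightarrow> nat)" "h \<in> vecs W" "(\<lambda>n. vnorm W (\<lambda>z. K (f (s n)) z - h z)) \<longlonglongrightarrow> 0"
    using K unfolding compact_op_def by blast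
  have "\<forall>\<^sub>F n in sequentially. vnorm W (\<lambda>z. K (f (s n)) z - h z) < 1" using s(3) by (rule order_tendstoD) simp
  then obtain N where N: "\<And>n. n \<ge> N \<Longrightarrow> vnorm W (\<lambda>z. K (f (s n)) z - h z) < 1" by (auto simp: eventually_sequentially)
  obtain m where m: "real m \<ge> vnorm W h + 1" using real_arch_simple by blast
  let ?n = "max N m"
  have mem: "K (f (s ?n)) \<in> vecs W" by (rule linear_op_mem[OF lin f(1)])
  have "vnorm W (K (f (s ?n))) \<le> vnorm W (\<lambda>z. K (f (s ?n)) z - h z) + vnorm W h"
    using normed_fs_add_le[OF W normed_fs_diff_mem[OF W mem s(2)] s(2)] by simp
  also have "\<dots> < 1 + vnorm W h" using N[of ?n] by simp
  also have "\<dots> \<le> real m" using m by simp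
  also have "real m \<le> real (s ?n)" using strict_mono_imp_increasing[OF s(1), of ?n] by simp
  finally show False using f(3)[of "s ?n"] by simp
qed

lemma compact_op_add:
  assumes V: "normed_fs V" and W: "normed_fs W" and K: "compact_op V W K1" "compact_op V W K2"
  shows "compact_op V W (\<lambda>f z. K1 f z + K2 f z)"
proof -
  have lin: "linear_op V W K1" "linear_op V W K2" using K by (auto simp: compact_op_def)
  have "\<exists>s h. strict_mono s \<and> h \<in> vecs W \<and> (\<lambda>n. vnorm W (\<lambda>z. (K1 (f (s n)) z + K2 (f (s n)) z) - h z)) \<longlonglongrightarrow> 0"
    if f: "\<forall>n. f n \<in> vecs V" "\<exists>B. \<forall>n. vnorm V (f n) \<le> B" for f :: "nat \<Rightarrow> complex \<Rightarrow> complex"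
  proof -
    obtain s h where s: "strict_mono (s :: nat \<Rightarrow> nat)" "h \<in> vecs W" "(\<lambda>n. vnorm W (\<lambda>z. K1 (f (s n)) z - h z)) \<longlonglongrightarrow> 0"
      using K(1) f unfolding compact_op_def by blast
    have "(\<forall>n. f (s n) \<in> vecs V)" "\<exists>B. \<forall>n. vnorm V (f (s n)) \<le> B" using f by auto
    then obtain t k where t: "strict_mono (t :: nat \<Rightarrow> nat)" "k \<in> vecs W" "(\<lambda>n. vnorm W (\<lambda>z. K2 (f (s (t n))) z - k z)) \<longlonglongrightarrow> 0"
      using K(2)[unfolded compact_op_def, THEN conjunct2, rule_format, of "\<lambda>n. f (s n)"] by blast
    let ?u = "\<lambda>n z. K1 (f (s (t n))) z - h z" and ?v = "\<lambda>n z. K2 (f (s (t n))) z - k z"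
    have mem: "?u n \<in> vecs W" "?v n \<in> vecs W" for n
      using normed_fs_diff_mem[OF W linear_op_mem[OF lin(1)] s(2)] normed_fs_diff_mem[OF W linear_op_mem[OF lin(2)] t(2)] f(1) by auto
    have hk: "(\<lambda>z. h z + k z) \<in> vecs W" by (rule normed_fs_add_mem[OF W s(2) t(2)])
    have eq: "(\<lambda>z. (K1 (f (s (t n))) z + K2 (f (s (t n))) z) - (h z + k z)) = (\<lambda>z. ?u n z + ?v n z)" for n
      by (auto simp: fun_eq_iff)
    have "(\<lambda>n. vnorm W (\<lambda>z. ?u n z + ?v n z)) \<longlonglongrightarrow> 0"
    proof (rule Lim_null_comparison)
      show "\<forall>\<^sub>F n in sequentially. norm (vnorm W (\<lambda>z. ?u n z + ?v n z)) \<le> vnorm W (?u n) + vnorm W (?v n)"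
        using normed_fs_add_le[OF W mem] normed_fs_nonneg[OF W normed_fs_add_mem[OF W mem]]
        by (intro always_eventually allI) simp
      have "(\<lambda>n. vnorm W (?u n)) \<longlonglongrightarrow> 0" using LIMSEQ_subseq_LIMSEQ[OF s(3) t(1)] by (simp add: o_def)
      then show "(\<lambda>n. vnorm W (?u n) + vnorm W (?v n)) \<longlonglongrightarrow> 0" using tendsto_add[OF _ t(3)] by fastforce
    qed
    then show ?thesis
      using strict_mono_o[OF s(1) t(1)] hk
      by (intro exI[of _ "s \<circ> t"] exI[of _ "\<lambda>z. h z + k z"]) (simp add: eq)
  qed
  then show ?thesis
    using linear_op_combine[OF W lin, of 1 1] unfolding compact_op_def by simp
qed

lemma compact_op_comp:
  assumes V: "normed_fs V" "normed_fs V'" "normed_fs W'" "normed_fs W"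
    and A: "bounded_op V V' A" and K: "compact_op V' W' K" and B: "bounded_op W' W B"
  shows "compact_op V W (\<lambda>f. B (K (A f)))"
proof -
  have lin: "linear_op V V' A" "linear_op V' W' K" "linear_op W' W B" using A B K by (auto simp: compact_op_def bounded_op_def)
  have "linear_op V W (\<lambda>f. B (K (A f)))"
    unfolding linear_op_def
    by (auto simp: linear_op_lincomb[OF lin(1)] linear_op_lincomb[OF lin(2)] linear_op_lincomb[OF lin(3)]
        linear_op_mem[OF lin(1)] linear_op_mem[OF lin(2)] linear_op_mem[OF lin(3)])
  moreover have "\<exists>s h. strict_mono s \<and> h \<in> vecs W \<and> (\<lambda>n. vnorm W (\<lambda>z. B (K (A (f (s n)))) z - h z)) \<longlonglongrightarrow> 0"
    if f: "\<forall>n. f n \<in> vecs V" "\<exists>B. \<forall>n. vnorm V (f n) \<le> B" for f :: "nat \<Rightarrow> complex \<Rightarrow> complex"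
  proof -
    obtain b where b: "\<And>n. vnorm V (f n) \<le> b" using f(2) by auto
    have "\<forall>n. A (f n) \<in> vecs V'" using f(1) linear_op_mem[OF lin(1)] by auto
    moreover have "vnorm V' (A (f n)) \<le> op_norm V V' A * b" for n
      using op_norm_bound[OF V(1,2) A, of "f n"] f(1) mult_left_mono[OF b[of n] op_norm_nonneg[OF V(1,2) A]] by force
    ultimately obtain s h where s: "strict_mono (s :: nat \<Rightarrow> nat)" "h \<in> vecs W'" "(\<lambda>n. vnorm W' (\<lambda>z. K (A (f (s n))) z - h z)) \<longlonglongrightarrow> 0"
      using K[unfolded compact_op_def, THEN conjunct2, rule_format, of "\<lambda>n. A (f n)"] by blast
    have KA: "K (A (f (s n))) \<in> vecs W'" for n using f(1) linear_op_mem[OF lin(1)] linear_op_mem[OF lin(2)] by blast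
    have Bh: "B h \<in> vecs W" by (rule linear_op_mem[OF lin(3) s(2)])
    have eq: "(\<lambda>z. B (K (A (f (s n)))) z - B h z) = B (\<lambda>z. K (A (f (s n))) z - h z)" for n
      by (rule linear_op_diff[OF lin(3) KA s(2), symmetric])
    have mem: "(\<lambda>z. K (A (f (s n))) z - h z) \<in> vecs W'" for n by (rule normed_fs_diff_mem[OF V(3) KA s(2)])
    have "(\<lambda>n. vnorm W (\<lambda>z. B (K (A (f (s n)))) z - B h z)) \<longlonglongrightarrow> 0"
    proof (rule Lim_null_comparison)
      show "\<forall>\<^sub>F n in sequentially. norm (vnorm W (\<lambda>z. B (K (A (f (s n)))) z - B h z)) \<le> op_norm W' W B * vnorm W' (\<lambda>z. K (A (f (s n))) z - h z)"
        unfolding eq using op_norm_bound[OF V(3,4) B mem] normed_fs_nonneg[OF V(4) linear_op_mem[OF lin(3) mem]]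
        by (intro always_eventually allI) simp
      show "(\<lambda>n. op_norm W' W B * vnorm W' (\<lambda>z. K (A (f (s n))) z - h z)) \<longlonglongrightarrow> 0"
        using tendsto_mult_left[OF s(3), of "op_norm W' W B"] by simp
    qed
    then show ?thesis using s(1) Bh by blast
  qed
  ultimately show ?thesis unfolding compact_op_def by blast
qed

text \<open>A bounded sequence of complex numbers has a convergent subsequence.\<close>

lemma compact_op_rank_one:
  assumes V: "normed_fs V" and W: "normed_fs W" and v: "v \<in> vecs W"
    and lin: "\<And>f g a b. f \<in> vecs V \<Longrightarrow> g \<in> vecs V \<Longrightarrow> l (\<lambda>z. a * f z + b * g z) = a * l f + b * l g"
    and bd: "\<And>f. f \<in> vecs V \<Longrightarrow> cmod (l f) \<le> C * vnorm V f"
  shows "compact_op V W (\<lambda>f z. l f * v z)"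
proof -
  have lo: "linear_op V W (\<lambda>f z. l f * v z)"
    unfolding linear_op_def using normed_fs_mult_mem[OF W v v] by (auto simp: lin algebra_simps)
  have "\<exists>s h. strict_mono s \<and> h \<in> vecs W \<and> (\<lambda>n. vnorm W (\<lambda>z. l (f (s n)) * v z - h z)) \<longlonglongrightarrow> 0"
    if f: "\<forall>n. f n \<in> vecs V" "\<exists>B. \<forall>n. vnorm V (f n) \<le> B" for f :: "nat \<Rightarrow> complex \<Rightarrow> complex"
  proof -
    obtain b where b: "\<And>n. vnorm V (f n) \<le> b" using f(2) by auto
    have "cmod (l (f n)) \<le> \<bar>C\<bar> * b" for n
    proof -
      have "cmod (l (f n)) \<le> C * vnorm V (f n)" using bd f(1) by blast
      also have "\<dots> \<le> \<bar>C\<bar> * b" using b[of n] normed_fs_nonneg[OF V, of "f n"] f(1) by (intro mult_mono) auto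
      finally show ?thesis .
    qed
    then have "bounded (range (\<lambda>n. l (f n)))" by (auto simp: bounded_iff)
    then obtain x s where s: "strict_mono (s :: nat \<Rightarrow> nat)" "((\<lambda>n. l (f n)) \<circ> s) \<longlonglongrightarrow> x"
      using bounded_imp_convergent_subsequence by blast
    have "vnorm W (\<lambda>z. l (f (s n)) * v z - x * v z) = cmod (l (f (s n)) - x) * vnorm W v" for n
      using normed_fs_scale[OF W v, of "l (f (s n)) - x"] by (simp add: algebra_simps)
    moreover have "(\<lambda>n. cmod (l (f (s n)) - x) * vnorm W v) \<longlonglongrightarrow> 0 * vnorm W v"
      using s(2) by (intro tendsto_mult tendsto_const) (simp add: o_def tendsto_norm_zero LIM_zero)
    ultimately have "(\<lambda>n. vnorm W (\<lambda>z. l (f (s n)) * v z - x * v z)) \<longlonglongrightarrow> 0" by simp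
    then show ?thesis using s(1) normed_fs_mult_mem[OF W v v, of x] by blast
  qed
  then show ?thesis using lo unfolding compact_op_def by blast
qed

lemma compact_op_zero:
  assumes "normed_fs V" "normed_fs W" shows "compact_op V W (\<lambda>f z. 0)"
  using compact_op_rank_one[OF assms normed_fs_zero[OF assms(2)], of "\<lambda>f. 0" 0] by simp

lemma ess_norm_le:
  assumes "normed_fs V" "normed_fs W" "bounded_op V W T" "compact_op V W K"
  shows "ess_norm V W T \<le> op_norm V W (\<lambda>f z. T f z - K f z)"
  unfolding ess_norm_def
proof (rule cINF_lower)
  show "bdd_below ((\<lambda>K. op_norm V W (\<lambda>f z. T f z - K f z)) ` {K. compact_op V W K})"
    by (rule bdd_belowI2[of _ 0])
       (auto intro!: op_norm_nonneg[OF assms(1,2) bounded_op_diff[OF assms(1,2,3) compact_imp_bounded[OF assms(1,2)]]])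
qed (use assms in auto)

lemma ess_norm_greatest:
  assumes "normed_fs V" "normed_fs W" "\<And>K. compact_op V W K \<Longrightarrow> c \<le> op_norm V W (\<lambda>f z. T f z - K f z)"
  shows "c \<le> ess_norm V W T"
  unfolding ess_norm_def by (rule cINF_greatest) (use assms compact_op_zero in auto)

lemma ess_norm_nonneg:
  assumes "normed_fs V" "normed_fs W" "bounded_op V W T" shows "0 \<le> ess_norm V W T"
  by (rule ess_norm_greatest[OF assms(1,2)])
     (rule op_norm_nonneg[OF assms(1,2) bounded_op_diff[OF assms(1,2,3) compact_imp_bounded[OF assms(1,2)]]])

lemma ess_norm_approx:
  assumes "normed_fs V" "normed_fs W" "bounded_op V W T" "e > 0"
  obtains K where "compact_op V W K" "op_norm V W (\<lambda>f z. T f z - K f z) < ess_norm V W T + e"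
proof -
  have "\<not> (\<forall>K. compact_op V W K \<longrightarrow> ess_norm V W T + e \<le> op_norm V W (\<lambda>f z. T f z - K f z))"
    using ess_norm_greatest[OF assms(1,2), of "ess_norm V W T + e" T] assms(4) by force
  then show ?thesis using that by (meson not_le)
qed

text \<open>If \<open>K\<close> is compact, so is \<open>B K A + R\<close>, and \<open>T - (B K A + R) = B (T' - K) A\<close> has norm at most
  \<open>\<parallel>T' - K\<parallel>\<close> because \<open>A\<close> and \<open>B\<close> are contractions.\<close>

lemma ess_norm_transfer:
  assumes V: "normed_fs V" "normed_fs V'" "normed_fs W'" "normed_fs W"
    and A: "linear_op V V' A" "\<And>f. f \<in> vecs V \<Longrightarrow> vnorm V' (A f) \<le> vnorm V f"
    and B: "linear_op W' W B" "\<And>f. f \<in> vecs W' \<Longrightarrow> vnorm W (B f) \<le> vnorm W' f"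
    and T: "bounded_op V W T" "bounded_op V' W' T'"
    and R: "compact_op V W R"
    and eq: "\<And>f. f \<in> vecs V \<Longrightarrow> T f = (\<lambda>z. B (T' (A f)) z + R f z)"
  shows "ess_norm V W T \<le> ess_norm V' W' T'"
proof (rule ess_norm_greatest[OF V(2,3)])
  fix K assume K: "compact_op V' W' K"
  have bA: "bounded_op V V' A" using A by (auto simp: bounded_op_def intro!: exI[of _ 1])
  have bB: "bounded_op W' W B" using B by (auto simp: bounded_op_def intro!: exI[of _ 1])
  have lin: "linear_op V' W' T'" "linear_op V' W' K" using T K by (auto simp: bounded_op_def compact_op_def)
  have c: "compact_op V W (\<lambda>f z. B (K (A f)) z + R f z)"
    by (rule compact_op_add[OF V(1,4) compact_op_comp[OF V bA K bB] R])
  have bd: "bounded_op V' W' (\<lambda>f z. T' f z - K f z)" by (intro bounded_op_diff V T compact_imp_bounded K)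
  have "ess_norm V W T \<le> op_norm V W (\<lambda>f z. T f z - (B (K (A f)) z + R f z))"
    by (rule ess_norm_le[OF V(1,4) T(1) c])
  also have "\<dots> \<le> op_norm V' W' (\<lambda>f z. T' f z - K f z)"
  proof (rule op_norm_le[OF V(1)])
    fix f assume f: "f \<in> vecs V" "vnorm V f \<le> 1"
    have Af: "A f \<in> vecs V'" by (rule linear_op_mem[OF A(1) f(1)])
    have mem: "T' (A f) \<in> vecs W'" "K (A f) \<in> vecs W'" using linear_op_mem[OF lin(1) Af] linear_op_mem[OF lin(2) Af] by auto
    have "(\<lambda>z. T f z - (B (K (A f)) z + R f z)) = B (\<lambda>z. T' (A f) z - K (A f) z)"
      unfolding linear_op_diff[OF B(1) mem] eq[OF f(1)] by auto
    then have "vnorm W (\<lambda>z. T f z - (B (K (A f)) z + R f z)) \<le> vnorm W' (\<lambda>z. T' (A f) z - K (A f) z)"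
      using B(2)[OF normed_fs_diff_mem[OF V(3) mem]] by simp
    also have "\<dots> \<le> op_norm V' W' (\<lambda>f z. T' f z - K f z)"
      using op_norm_bound_unit[OF V(2) bd Af] A(2)[OF f(1)] f(2) by simp
    finally show "vnorm W (\<lambda>z. T f z - (B (K (A f)) z + R f z)) \<le> op_norm V' W' (\<lambda>f z. T' f z - K f z)" .
  qed
  finally show "ess_norm V W T \<le> op_norm V' W' (\<lambda>f z. T' f z - K f z)" .
qed

section \<open>Essential norms on the Bergman space\<close>

context bergman_weight
begin

abbreviation B where "B \<equiv> bergman \<alpha>"

lemma normed_fs_bergman: "normed_fs B"
  unfolding normed_fs_def vnorm_bergman
  using A2_lincomb l2norm_triangle[OF A2_l2 A2_l2] by (auto simp: zero_A2 l2norm_scale)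

lemma tay_lincomb:
  assumes "f \<in> A2" "g \<in> A2"
  shows "tay n (\<lambda>z. a * f z + b * g z) = (\<lambda>z. a * tay n f z + b * tay n g z)"
proof
  fix z
  have "coef (\<lambda>z. a * f z + b * g z) k = a * coef f k + b * coef g k" for k
    using assms by (intro coef_lincomb) (auto simp: A2_iff)
  then show "tay n (\<lambda>z. a * f z + b * g z) z = a * tay n f z + b * tay n g z"
    by (simp add: tay_def on_disk_def sum_distrib_left sum.distrib distrib_right mult.assoc)
qed

lemma tay_bounded: "bounded_op B B (tay n)"
  unfolding bounded_op_def linear_op_def vnorm_bergman
  using tay_A2 tay_lincomb nrm_tay_le by (auto intro!: exI[of _ 1])

lemma tail_bounded: "bounded_op B B (tail n)"
proof -
  have "bounded_op B B (\<lambda>f. f)"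
    unfolding bounded_op_def linear_op_def by (auto intro!: exI[of _ 1])
  from bounded_op_diff[OF normed_fs_bergman normed_fs_bergman this tay_bounded[of n]]
  show ?thesis unfolding tail_def .
qed

lemma coef_bound:
  assumes "f \<in> A2" shows "cmod (coef f k) \<le> (1 / sqrt (\<gamma> k)) * nrm f"
proof -
  have "(cmod (coef f k))\<^sup>2 * \<gamma> k \<le> (nrm f)\<^sup>2"
  proof -
    have "(nrm (tay (Suc k) f))\<^sup>2 \<le> (nrm f)\<^sup>2" using nrm_tay_le[OF assms] by (intro power_mono) auto
    moreover have "(cmod (coef f k))\<^sup>2 * \<gamma> k \<le> (\<Sum>j<Suc k. (cmod (coef f j))\<^sup>2 * \<gamma> j)"
      by (intro member_le_sum[of k "{..<Suc k}"]) (auto intro!: mult_nonneg_nonneg less_imp_le[OF moment_pos])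
    ultimately show ?thesis unfolding nrm_tay by linarith
  qed
  then have "sqrt ((cmod (coef f k))\<^sup>2 * \<gamma> k) \<le> sqrt ((nrm f)\<^sup>2)" by (rule real_sqrt_le_mono)
  then have "cmod (coef f k) * sqrt (\<gamma> k) \<le> nrm f" by (simp add: real_sqrt_mult)
  then show ?thesis using moment_pos[of k] by (simp add: field_simps)
qed

text \<open>Taylor sections have finite rank, so composing with one yields a compact operator.\<close>

lemma tay_compact:
  assumes "bounded_op B B S" shows "compact_op B B (\<lambda>f. S (tay n f))"
proof -
  note nb = normed_fs_bergman
  have c: "compact_op B B (\<lambda>f. tay n f)"
  proof (induction n)
    case 0
    show ?case unfolding tay_0 by (rule compact_op_zero[OF nb nb])
  next
    case (Suc n)
    have r: "compact_op B B (\<lambda>f z. coef f n * monomial n z)"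
    proof (rule compact_op_rank_one[OF nb nb monomial_A2])
      show "\<And>f. f \<in> A2 \<Longrightarrow> cmod (coef f n) \<le> (1 / sqrt (\<gamma> n)) * vnorm B f"
        unfolding vnorm_bergman by (rule coef_bound)
    qed (simp add: coef_lincomb A2_iff)
    show ?case unfolding tay_Suc using compact_op_add[OF nb nb Suc r] by simp
  qed
  have "bounded_op B B (\<lambda>f. f)"
    unfolding bounded_op_def linear_op_def by (auto intro!: exI[of _ 1])
  from compact_op_comp[OF nb nb nb nb this c assms] show ?thesis .
qed

text \<open>\<open>tail n\<close> is a self-adjoint projection, since it acts on coefficients by restriction.\<close>

lemma tail_orthogonal:
  assumes "f \<in> A2" "g \<in> A2" shows "ip M (tail n f) g = ip M (tail n f) (tail n g)"
    and "ip M (tail n f) (tail n g) = ip M f (tail n g)"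
proof -
  have "(\<lambda>k. coef (tail n f) k * cnj (coef g k) * of_real (\<gamma> k)) = (\<lambda>k. coef (tail n f) k * cnj (coef (tail n g) k) * of_real (\<gamma> k))"
    using assms by (auto simp: coef_tail)
  then show "ip M (tail n f) g = ip M (tail n f) (tail n g)"
    using ip_sums[OF tail_A2[OF assms(1)] assms(2), of n] ip_sums[OF tail_A2[OF assms(1)] tail_A2[OF assms(2)], of n n] sums_unique2 by metis
  have "(\<lambda>k. coef f k * cnj (coef (tail n g) k) * of_real (\<gamma> k)) = (\<lambda>k. coef (tail n f) k * cnj (coef (tail n g) k) * of_real (\<gamma> k))"
    using assms by (auto simp: coef_tail)
  then show "ip M (tail n f) (tail n g) = ip M f (tail n g)"
    using ip_sums[OF assms(1) tail_A2[OF assms(2)], of n] ip_sums[OF tail_A2[OF assms(1)] tail_A2[OF assms(2)], of n n] sums_unique2 by metis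
qed

lemma tail_idem: "f \<in> A2 \<Longrightarrow> tail n (tail n f) = tail n f"
proof -
  assume f: "f \<in> A2"
  have "tay n (tail n f) = (\<lambda>z. 0)"
    unfolding tay_def using coef_tail[OF f] by (auto simp: on_disk_def fun_eq_iff intro!: sum.neutral)
  then show ?thesis unfolding tail_def[of n "tail n f"] by simp
qed

text \<open>If the claim failed, a subsequence of the images \<open>K (tail n f\<^sub>n)\<close> would converge to some \<open>h\<close> of positive
  norm. But \<open>\<langle>K g, h\<rangle>\<close> is a bounded functional of \<open>g\<close>, hence represented by some \<open>v\<close>, and
  \<open>\<langle>tail n f\<^sub>n, v\<rangle> = \<langle>tail n f\<^sub>n, tail n v\<rangle>\<close> tends to zero.\<close>

lemma compact_tail_small:
  assumes K: "compact_op B B K" and e: "e > 0"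
  obtains n where "\<And>f. f \<in> A2 \<Longrightarrow> nrm f \<le> 1 \<Longrightarrow> nrm (K (tail n f)) \<le> e"
proof (rule ccontr)
  note nb = normed_fs_bergman
  assume "\<not> thesis"
  then have "\<forall>n. \<exists>f. f \<in> A2 \<and> nrm f \<le> 1 \<and> nrm (K (tail n f)) > e" using that by (meson not_le)
  then obtain f where f: "\<And>n. f n \<in> A2" "\<And>n. nrm (f n) \<le> 1" "\<And>n. nrm (K (tail n (f n))) > e" by metis
  let ?u = "\<lambda>n. tail n (f n)"
  have uA: "?u n \<in> A2" for n by (rule tail_A2[OF f(1)])
  have u1: "nrm (?u n) \<le> 1" for n using nrm_tail_le[OF f(1), of n n] f(2)[of n] by linarith
  have bK: "bounded_op B B K" by (rule compact_imp_bounded[OF nb nb K])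
  then have lin: "linear_op B B K" by (simp add: bounded_op_def)
  obtain s h where s: "strict_mono (s :: nat \<Rightarrow> nat)" "h \<in> A2" "(\<lambda>n. nrm (\<lambda>z. K (?u (s n)) z - h z)) \<longlonglongrightarrow> 0"
    using K[unfolded compact_op_def, THEN conjunct2, rule_format, of ?u] uA u1 unfolding vnorm_bergman by blast
  have KA: "K g \<in> A2" if "g \<in> A2" for g using linear_op_mem[OF lin that] .
  obtain v where v: "v \<in> A2" "\<And>g. g \<in> A2 \<Longrightarrow> ip M (K g) h = ip M g v"
  proof (rule riesz[of "\<lambda>g. ip M (K g) h" "op_norm B B K * nrm h"])
    show "ip M (K (\<lambda>z. a * f z + b * g z)) h = a * ip M (K f) h + b * ip M (K g) h" if "f \<in> A2" "g \<in> A2" for f g a b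
      unfolding linear_op_lincomb[OF lin that] using KA that s(2) by (intro ip_lincomb A2_l2)
    show "cmod (ip M (K f) h) \<le> op_norm B B K * nrm h * nrm f" if "f \<in> A2" for f
    proof -
      have "cmod (ip M (K f) h) \<le> nrm (K f) * nrm h" using KA that s(2) by (intro ip_Cauchy_Schwarz A2_l2)
      also have "\<dots> \<le> (op_norm B B K * nrm f) * nrm h"
        using op_norm_bound[OF nb nb bK that] by (intro mult_right_mono) (auto simp: vnorm_bergman)
      finally show ?thesis by (simp add: mult_ac)
    qed
  qed blast
  have 1: "(\<lambda>n. ip M (?u (s n)) v) \<longlonglongrightarrow> 0"
  proof (rule Lim_null_comparison)
    show "\<forall>\<^sub>F n in sequentially. norm (ip M (?u (s n)) v) \<le> nrm (tail (s n) v)"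
    proof (intro always_eventually allI)
      fix n
      have "cmod (ip M (?u (s n)) v) \<le> nrm (?u (s n)) * nrm (tail (s n) v)"
        unfolding tail_orthogonal(1)[OF f(1) v(1)] by (intro ip_Cauchy_Schwarz A2_l2 tail_A2 f v)
      also have "\<dots> \<le> 1 * nrm (tail (s n) v)" using u1 by (intro mult_right_mono) auto
      finally show "norm (ip M (?u (s n)) v) \<le> nrm (tail (s n) v)" by simp
    qed
    show "(\<lambda>n. nrm (tail (s n) v)) \<longlonglongrightarrow> 0"
      using LIMSEQ_subseq_LIMSEQ[OF nrm_tail_tendsto[OF v(1)] s(1)] by (simp add: o_def)
  qed
  let ?w = "\<lambda>n z. K (?u (s n)) z - h z"
  have wA: "?w n \<in> A2" for n by (rule normed_fs_diff_mem[OF nb KA[OF uA] s(2)])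
  have 2: "(\<lambda>n. ip M (?w n) h) \<longlonglongrightarrow> 0"
  proof (rule Lim_null_comparison)
    show "\<forall>\<^sub>F n in sequentially. norm (ip M (?w n) h) \<le> nrm (?w n) * nrm h"
      by (intro always_eventually allI ip_Cauchy_Schwarz A2_l2 wA s)
    show "(\<lambda>n. nrm (?w n) * nrm h) \<longlonglongrightarrow> 0" using tendsto_mult_right[OF s(3), of "nrm h"] by simp
  qed
  have "ip M (?w n) h = ip M (?u (s n)) v - of_real ((nrm h)\<^sup>2)" for n
    using ip_lincomb[OF A2_l2[OF KA[OF uA[of "s n"]]] A2_l2[OF s(2)] A2_l2[OF s(2)], of 1 "-1"] v(2)[OF uA]
    by (simp add: ip_self)
  then have "(\<lambda>n. ip M (?u (s n)) v - ip M (?w n) h) = (\<lambda>n. of_real ((nrm h)\<^sup>2))" by simp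
  moreover have "(\<lambda>n. ip M (?u (s n)) v - ip M (?w n) h) \<longlonglongrightarrow> 0 - 0" by (intro tendsto_diff 1 2)
  ultimately have "(\<lambda>n::nat. complex_of_real ((nrm h)\<^sup>2)) \<longlonglongrightarrow> 0" by (simp only: diff_zero)
  from LIMSEQ_unique[OF tendsto_const this] have "nrm h = 0" by simp
  have "\<forall>\<^sub>F n in sequentially. nrm (?w n) < e" using s(3) e by (rule order_tendstoD)
  then have "\<exists>n. nrm (?w n) < e" by (rule eventually_happens'[OF sequentially_bot])
  then obtain n where n: "nrm (?w n) < e" ..
  have "nrm (K (?u (s n))) \<le> nrm (?w n) + nrm h"
    using normed_fs_add_le[OF nb wA s(2), of n] by (simp add: vnorm_bergman)
  then show False using n f(3)[of "s n"] \<open>nrm h = 0\<close> by simp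
qed

text \<open>\<open>S\<close> and \<open>S \<circ> tail n\<close> differ by the compact operator \<open>S \<circ> tay n\<close>.\<close>

lemma ess_norm_le_tail:
  assumes S: "bounded_op B B S" and c: "\<And>f. f \<in> A2 \<Longrightarrow> nrm f \<le> 1 \<Longrightarrow> nrm (S (tail n f)) \<le> c"
  shows "ess_norm B B S \<le> c"
proof -
  note nb = normed_fs_bergman
  have lin: "linear_op B B S" using S by (simp add: bounded_op_def)
  have "ess_norm B B S \<le> op_norm B B (\<lambda>f z. S f z - S (tay n f) z)"
    by (rule ess_norm_le[OF nb nb S tay_compact[OF S]])
  also have "\<dots> \<le> c"
  proof (rule op_norm_le[OF nb])
    fix f assume f: "f \<in> vecs B" "vnorm B f \<le> 1"
    have "(\<lambda>z. S f z - S (tay n f) z) = S (tail n f)"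
      unfolding tail_def by (rule linear_op_diff[OF lin f(1) tay_A2, symmetric])
    then show "vnorm B (\<lambda>z. S f z - S (tay n f) z) \<le> c" using c f by (simp add: vnorm_bergman)
  qed
  finally show ?thesis .
qed

text \<open>Take a compact \<open>K\<close> with \<open>\<parallel>S - K\<parallel>\<close> close to the essential norm and split
  \<open>S \<circ> tail n = (S - K) \<circ> tail n + K \<circ> tail n\<close>, where the second summand is small for large \<open>n\<close>.\<close>

lemma tail_le_ess_norm:
  assumes S: "bounded_op B B S" and e: "e > 0"
  obtains n where "\<And>f. f \<in> A2 \<Longrightarrow> nrm f \<le> 1 \<Longrightarrow> nrm (S (tail n f)) \<le> ess_norm B B S + e"
proof -
  note nb = normed_fs_bergman
  obtain K where K: "compact_op B B K" "op_norm B B (\<lambda>f z. S f z - K f z) < ess_norm B B S + e/2"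
    using ess_norm_approx[OF nb nb S, of "e/2"] e by auto
  obtain n where n: "\<And>f. f \<in> A2 \<Longrightarrow> nrm f \<le> 1 \<Longrightarrow> nrm (K (tail n f)) \<le> e/2"
    using compact_tail_small[OF K(1), of "e/2"] e by auto
  have bK: "bounded_op B B K" by (rule compact_imp_bounded[OF nb nb K(1)])
  have bSK: "bounded_op B B (\<lambda>f z. S f z - K f z)" by (rule bounded_op_diff[OF nb nb S bK])
  have "nrm (S (tail n f)) \<le> ess_norm B B S + e" if f: "f \<in> A2" "nrm f \<le> 1" for f
  proof -
    have t: "tail n f \<in> A2" "nrm (tail n f) \<le> 1" using tail_A2[OF f(1)] nrm_tail_le[OF f(1), of n] f(2) by auto
    have m: "S (tail n f) \<in> A2" "K (tail n f) \<in> A2"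
      using S bK linear_op_mem t(1) unfolding bounded_op_def by blast+
    have "nrm (S (tail n f)) \<le> nrm (\<lambda>z. S (tail n f) z - K (tail n f) z) + nrm (K (tail n f))"
      using normed_fs_add_le[OF nb normed_fs_diff_mem[OF nb m] m(2)] by (simp add: vnorm_bergman)
    also have "nrm (\<lambda>z. S (tail n f) z - K (tail n f) z) \<le> op_norm B B (\<lambda>f z. S f z - K f z)"
      using op_norm_bound_unit[OF nb bSK t(1)] t(2) by (simp add: vnorm_bergman)
    also have "nrm (K (tail n f)) \<le> e/2" by (rule n[OF f])
    finally show ?thesis using K(2) by simp
  qed
  then show ?thesis using that by blast
qed

section \<open>The Toeplitz operator\<close>

text \<open>For fixed \<open>f\<close> the functional \<open>g \<mapsto> \<langle>D g, D f\<rangle>\<close> is bounded, and \<open>T f\<close> is the function representing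
  it. The inner product separates points, so these values determine \<open>T\<close> on the Bergman space and the
  definite description in \<open>toeplitz\<close> denotes this operator.\<close>

lemma toeplitz_spec:
  assumes D: "bounded_op B B D"
    and \<mu>: "\<And>f g. f \<in> A2 \<Longrightarrow> g \<in> A2 \<Longrightarrow> (\<integral>z. f z * cnj (g z) \<partial>\<mu>) = ip M (D f) (D g)"
  defines "T \<equiv> toeplitz \<alpha> \<mu>"
  shows "bounded_op B B T" and "\<And>f g. f \<in> A2 \<Longrightarrow> g \<in> A2 \<Longrightarrow> ip M (T f) g = ip M (D f) (D g)"
proof -
  note nb = normed_fs_bergman
  have lin: "linear_op B B D" using D by (simp add: bounded_op_def)
  have DA: "D g \<in> A2" if "g \<in> A2" for g using linear_op_mem[OF lin that] .
  define c where "c = op_norm B B D"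
  have c0: "c \<ge> 0" unfolding c_def by (rule op_norm_nonneg[OF nb nb D])
  have Dn: "nrm (D f) \<le> c * nrm f" if "f \<in> A2" for f
    using op_norm_bound[OF nb nb D that] by (simp add: vnorm_bergman c_def)
  have ex: "\<exists>h. h \<in> A2 \<and> (\<forall>g\<in>A2. ip M h g = ip M (D f) (D g)) \<and> nrm h \<le> c * c * nrm f" if f: "f \<in> A2" for f
  proof -
    obtain h where h: "h \<in> A2" "\<And>g. g \<in> A2 \<Longrightarrow> ip M (D g) (D f) = ip M g h" "nrm h \<le> c * c * nrm f"
    proof (rule riesz[of "\<lambda>g. ip M (D g) (D f)" "c * c * nrm f"])
      show "ip M (D (\<lambda>z. a * g z + b * k z)) (D f) = a * ip M (D g) (D f) + b * ip M (D k) (D f)" if "g \<in> A2" "k \<in> A2" for g k a b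
        unfolding linear_op_lincomb[OF lin that] using DA that f by (intro ip_lincomb A2_l2)
      show "cmod (ip M (D g) (D f)) \<le> c * c * nrm f * nrm g" if "g \<in> A2" for g
      proof -
        have "cmod (ip M (D g) (D f)) \<le> nrm (D g) * nrm (D f)" using DA that f by (intro ip_Cauchy_Schwarz A2_l2)
        also have "\<dots> \<le> (c * nrm g) * (c * nrm f)" using Dn that f c0 by (intro mult_mono) auto
        finally show ?thesis by (simp add: mult_ac)
      qed
    qed blast
    have "ip M h g = ip M (D f) (D g)" if "g \<in> A2" for g
      using h(2)[OF that] ip_commute[of M h g] ip_commute[of M "D f" "D g"] by simp
    then show ?thesis using h by blast
  qed
  then obtain T0 where T0: "\<And>f. f \<in> A2 \<Longrightarrow> T0 f \<in> A2" "\<And>f g. f \<in> A2 \<Longrightarrow> g \<in> A2 \<Longrightarrow> ip M (T0 f) g = ip M (D f) (D g)"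
    "\<And>f. f \<in> A2 \<Longrightarrow> nrm (T0 f) \<le> c * c * nrm f" by metis
  have uniq: "h = k" if hk: "h \<in> A2" "k \<in> A2" "\<And>g. g \<in> A2 \<Longrightarrow> ip M h g = ip M k g" for h k
  proof -
    let ?d = "\<lambda>z. 1 * h z + (-1) * k z"
    have dA: "?d \<in> A2" using hk by (intro A2_lincomb)
    have "ip M ?d ?d = 1 * ip M h ?d + (-1) * ip M k ?d" using hk dA by (intro ip_lincomb A2_l2)
    then have n0: "nrm ?d = 0" using hk(3)[OF dA] by (simp add: ip_self)
    have "coef ?d k = 0" for k
      using coef_bound[OF dA, of k] n0 by simp
    then have "?d z = 0" if "z \<in> disk" for z
    proof -
      have "?d \<in> disk_analytic" using dA A2_iff by blast
      from coef_sums[OF this that] have "(\<lambda>k. 0) sums ?d z"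
        using \<open>\<And>k. coef ?d k = 0\<close> by simp
      then show ?thesis by (rule sums_unique2[OF _ sums_zero])
    qed
    moreover have "?d z = 0" if "z \<notin> disk" for z using dA that by (auto simp: A2_iff disk_analytic_def)
    ultimately show ?thesis by (auto simp: fun_eq_iff)
  qed
  define P where "P = (\<lambda>T. T \<in> extensional A2 \<and> bounded_op B B T \<and>
     (\<forall>f\<in>A2. bergman_inner \<alpha> (T f) f \<in> \<real>\<^sub>\<ge>\<^sub>0) \<and>
     (\<forall>f\<in>A2. \<forall>g\<in>A2. bergman_inner \<alpha> (T f) g = (\<integral>z. f z * cnj (g z) \<partial>\<mu>)))"
  define T1 where "T1 = restrict T0 A2"
  have T1: "T1 f = T0 f" if "f \<in> A2" for f using that by (simp add: T1_def)
  have linT1: "linear_op B B T1"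
    unfolding linear_op_def
  proof (intro conjI ballI allI)
    fix f assume f: "f \<in> A2"
    then show "T1 f \<in> A2" by (simp add: T1 T0)
    fix g and a b :: complex assume g: "g \<in> A2"
    have fg: "(\<lambda>z. a * f z + b * g z) \<in> A2" by (rule A2_lincomb[OF f g])
    have "T0 (\<lambda>z. a * f z + b * g z) = (\<lambda>z. a * T0 f z + b * T0 g z)"
    proof (rule uniq)
      show "T0 (\<lambda>z. a * f z + b * g z) \<in> A2" by (rule T0(1)[OF fg])
      show "(\<lambda>z. a * T0 f z + b * T0 g z) \<in> A2" by (intro A2_lincomb T0 f g)
      fix k assume k: "k \<in> A2"
      have "ip M (T0 (\<lambda>z. a * f z + b * g z)) k = ip M (D (\<lambda>z. a * f z + b * g z)) (D k)" by (rule T0(2)[OF fg k])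
      also have "\<dots> = a * ip M (D f) (D k) + b * ip M (D g) (D k)"
        unfolding linear_op_lincomb[OF lin f g] by (intro ip_lincomb A2_l2 DA f g k)
      also have "\<dots> = a * ip M (T0 f) k + b * ip M (T0 g) k" by (simp add: T0 f g k)
      also have "\<dots> = ip M (\<lambda>z. a * T0 f z + b * T0 g z) k" by (intro ip_lincomb[symmetric] A2_l2 T0 f g k)
      finally show "ip M (T0 (\<lambda>z. a * f z + b * g z)) k = ip M (\<lambda>z. a * T0 f z + b * T0 g z) k" .
    qed
    then show "T1 (\<lambda>z. a * f z + b * g z) = (\<lambda>z. a * T1 f z + b * T1 g z)" by (simp add: T1 f g fg)
  qed
  have "P T1"
    unfolding P_def
  proof (intro conjI ballI)
    show "T1 \<in> extensional A2" by (simp add: T1_def)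
    show "bounded_op B B T1" unfolding bounded_op_def using linT1 T0(3) by (auto simp: T1 vnorm_bergman)
    show "bergman_inner \<alpha> (T1 f) f \<in> \<real>\<^sub>\<ge>\<^sub>0" if "f \<in> A2" for f
      using that by (simp add: T1 T0 bergman_inner_eq ip_self)
    show "bergman_inner \<alpha> (T1 f) g = (\<integral>z. f z * cnj (g z) \<partial>\<mu>)" if "f \<in> A2" "g \<in> A2" for f g
      using that by (simp add: T1 T0 bergman_inner_eq \<mu>)
  qed
  moreover have "T' = T1" if T': "P T'" for T'
  proof
    fix f
    show "T' f = T1 f"
    proof (cases "f \<in> A2")
      case True
      have "T' f \<in> A2" using T' True linear_op_mem unfolding P_def bounded_op_def by blast
      moreover have "ip M (T' f) g = ip M (T1 f) g" if "g \<in> A2" for g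
        using T' True that \<mu>[OF True that] by (simp add: P_def bergman_inner_eq T1 T0)
      ultimately show ?thesis using uniq[of "T' f" "T1 f"] T0(1)[OF True] T1[OF True] by simp
    next
      case False
      then show ?thesis using T' by (simp add: P_def T1_def extensional_def)
    qed
  qed
  ultimately have "P (THE T. P T)" by (rule theI)
  then have PT: "P T" unfolding T_def toeplitz_def P_def .
  then show "bounded_op B B T" by (simp add: P_def)
  show "ip M (T f) g = ip M (D f) (D g)" if "f \<in> A2" "g \<in> A2" for f g
    using PT that \<mu>[OF that] by (simp add: P_def bergman_inner_eq)
qed

text \<open>Write \<open>Q\<close> for \<open>tail n\<close>. In one direction \<open>\<parallel>D Q f\<parallel>\<^sup>2 = \<langle>T Q f, Q f\<rangle> \<le> \<parallel>T Q\<parallel>\<close> for \<open>\<parallel>f\<parallel> \<le> 1\<close>. In the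
  other, \<open>T - Q T Q\<close> is compact, and \<open>h = Q T Q f\<close> satisfies
  \<open>\<parallel>h\<parallel>\<^sup>2 = \<langle>D Q f, D Q h\<rangle> \<le> \<parallel>D Q\<parallel>\<^sup>2 \<parallel>f\<parallel> \<parallel>h\<parallel>\<close>.\<close>

theorem ess_norm_toeplitz:
  assumes D: "bounded_op B B D" and T: "bounded_op B B T"
    and TD: "\<And>f g. f \<in> A2 \<Longrightarrow> g \<in> A2 \<Longrightarrow> ip M (T f) g = ip M (D f) (D g)"
  shows "(ess_norm B B D)\<^sup>2 = ess_norm B B T"
proof (rule antisym)
  note nb = normed_fs_bergman
  have linD: "linear_op B B D" and linT: "linear_op B B T" using D T by (auto simp: bounded_op_def)
  have DA: "D g \<in> A2" if "g \<in> A2" for g using linear_op_mem[OF linD that] .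
  have TA: "T g \<in> A2" if "g \<in> A2" for g using linear_op_mem[OF linT that] .
  have eD: "ess_norm B B D \<ge> 0" and eT: "ess_norm B B T \<ge> 0" using ess_norm_nonneg[OF nb nb] D T by auto
  show "(ess_norm B B D)\<^sup>2 \<le> ess_norm B B T"
  proof (rule field_le_epsilon)
    fix e :: real assume e: "e > 0"
    obtain n where n: "\<And>f. f \<in> A2 \<Longrightarrow> nrm f \<le> 1 \<Longrightarrow> nrm (T (tail n f)) \<le> ess_norm B B T + e"
      using tail_le_ess_norm[OF T e] by blast
    have "ess_norm B B D \<le> sqrt (ess_norm B B T + e)"
    proof (rule ess_norm_le_tail[OF D, of n])
      fix f assume f: "f \<in> A2" "nrm f \<le> 1"
      let ?t = "tail n f"
      have t: "?t \<in> A2" "nrm ?t \<le> 1" using tail_A2[OF f(1)] nrm_tail_le[OF f(1), of n] f(2) by auto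
      have "complex_of_real ((nrm (D ?t))\<^sup>2) = ip M (T ?t) ?t" by (simp only: TD[OF t(1) t(1)] ip_self)
      then have "(nrm (D ?t))\<^sup>2 = cmod (ip M (T ?t) ?t)" by (metis norm_of_real abs_power2)
      also have "\<dots> \<le> nrm (T ?t) * nrm ?t" by (intro ip_Cauchy_Schwarz A2_l2 TA t)
      also have "\<dots> \<le> (ess_norm B B T + e) * 1" using n[OF f] t(2) e eT by (intro mult_mono) auto
      finally show "nrm (D ?t) \<le> sqrt (ess_norm B B T + e)" by (simp add: real_le_rsqrt)
    qed
    then have "(ess_norm B B D)\<^sup>2 \<le> (sqrt (ess_norm B B T + e))\<^sup>2" using eD by (intro power_mono)
    then show "(ess_norm B B D)\<^sup>2 \<le> ess_norm B B T + e" using e eT by simp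
  qed
  have sq: "ess_norm B B T \<le> (ess_norm B B D + e)\<^sup>2" if e: "e > 0" for e
  proof -
    obtain n where n: "\<And>f. f \<in> A2 \<Longrightarrow> nrm f \<le> 1 \<Longrightarrow> nrm (D (tail n f)) \<le> ess_norm B B D + e"
      using tail_le_ess_norm[OF D e] by blast
    define c where "c = ess_norm B B D + e"
    have c0: "c > 0" using e eD by (simp add: c_def)
    have nn: "nrm (D (tail n f)) \<le> c * nrm f" if "f \<in> A2" for f
    proof -
      have b: "bounded_op B B (\<lambda>f. D (tail n f))" by (rule bounded_op_comp[OF tail_bounded D nb nb nb])
      then have l: "linear_op B B (\<lambda>f. D (tail n f))" by (simp add: bounded_op_def)
      have "\<And>f. f \<in> vecs B \<Longrightarrow> vnorm B f \<le> 1 \<Longrightarrow> vnorm B (D (tail n f)) \<le> c"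
        using n by (simp add: vnorm_bergman c_def)
      from unit_ball_bound[OF nb nb l this that] show ?thesis by (simp add: vnorm_bergman)
    qed
    have bt: "bounded_op B B (\<lambda>f. tail n (T f))" by (rule bounded_op_comp[OF T tail_bounded nb nb nb])
    have bid: "bounded_op B B (\<lambda>f. f)" unfolding bounded_op_def linear_op_def by (auto intro!: exI[of _ 1])
    have K1: "compact_op B B (\<lambda>f. tay n (T f))" by (rule compact_op_comp[OF nb nb nb nb T tay_compact[OF bid] bid])
    have K: "compact_op B B (\<lambda>f z. tay n (T f) z + tail n (T (tay n f)) z)"
      by (rule compact_op_add[OF nb nb K1 tay_compact[OF bt]])
    have "ess_norm B B T \<le> op_norm B B (\<lambda>f z. T f z - (tay n (T f) z + tail n (T (tay n f)) z))"
      by (rule ess_norm_le[OF nb nb T K])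
    also have "\<dots> \<le> c\<^sup>2"
    proof (rule op_norm_le[OF nb])
      fix f assume f: "f \<in> vecs B" "vnorm B f \<le> 1"
      let ?u = "T (tail n f)"
      let ?h = "tail n ?u"
      have tf: "tail n f \<in> A2" "tay n f \<in> A2" using tail_A2[OF f(1)] tay_A2 by auto
      have uA: "?u \<in> A2" by (rule TA[OF tf(1)])
      have hA: "?h \<in> A2" by (rule tail_A2[OF uA])
      have lt: "linear_op B B (\<lambda>f. tail n (T f))" using bt by (simp add: bounded_op_def)
      have "?h = (\<lambda>z. tail n (T f) z - tail n (T (tay n f)) z)"
        using linear_op_diff[OF lt f(1) tf(2)] unfolding tail_def[of n f] .
      then have e1: "(\<lambda>z. T f z - (tay n (T f) z + tail n (T (tay n f)) z)) = ?h"
        by (simp add: tail_def[of n "T f"] fun_eq_iff)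
      have "complex_of_real ((nrm ?h)\<^sup>2) = ip M ?h ?h" by (rule ip_self[symmetric])
      also have "\<dots> = ip M ?u ?h" by (rule tail_orthogonal(2)[OF uA uA])
      also have "\<dots> = ip M (D (tail n f)) (D ?h)" by (rule TD[OF tf(1) hA])
      finally have "(nrm ?h)\<^sup>2 = cmod (ip M (D (tail n f)) (D ?h))" by (metis norm_of_real abs_power2)
      also have "\<dots> \<le> nrm (D (tail n f)) * nrm (D ?h)" by (intro ip_Cauchy_Schwarz A2_l2 DA tf hA)
      also have "\<dots> \<le> c * (c * nrm ?h)"
      proof (rule mult_mono)
        show "nrm (D (tail n f)) \<le> c" using n f by (simp add: vnorm_bergman c_def)
        show "nrm (D ?h) \<le> c * nrm ?h" using nn[OF hA] tail_idem[OF uA, of n] by simp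
      qed (use c0 in auto)
      finally have "nrm ?h * nrm ?h \<le> c\<^sup>2 * nrm ?h" by (simp add: power2_eq_square mult.assoc)
      then have "nrm ?h \<le> c\<^sup>2" by (cases "nrm ?h = 0") (auto dest: mult_right_le_imp_le simp: less_le)
      then show "vnorm B (\<lambda>z. T f z - (tay n (T f) z + tail n (T (tay n f)) z)) \<le> c\<^sup>2"
        unfolding e1 by (simp add: vnorm_bergman)
    qed
    finally show ?thesis by (simp add: c_def)
  qed
  have "(\<lambda>n. (ess_norm B B D + inverse (real (Suc n)))\<^sup>2) \<longlonglongrightarrow> (ess_norm B B D + 0)\<^sup>2"
    by (intro tendsto_intros LIMSEQ_inverse_real_of_nat)
  then show "ess_norm B B T \<le> (ess_norm B B D)\<^sup>2"
    using sq by (intro LIMSEQ_le_const[of _ _ "ess_norm B B T"]) (auto simp del: of_nat_Suc)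
qed

end

section \<open>Transfer between the Dirichlet and Bergman spaces\<close>

lemma deriv_on_disk: "z \<in> disk \<Longrightarrow> deriv (on_disk h) z = deriv h z"
proof (rule deriv_cong_ev[OF _ refl])
  assume "z \<in> disk"
  then have "\<forall>\<^sub>F w in nhds z. w \<in> disk" by (intro eventually_nhds_in_open) auto
  then show "\<forall>\<^sub>F w in nhds z. on_disk h w = h w" by eventually_elim (simp add: on_disk_def)
qed

lemma disk_analytic_DERIV: "f \<in> disk_analytic \<Longrightarrow> z \<in> disk \<Longrightarrow> (f has_field_derivative deriv f z) (at z)"
  unfolding disk_analytic_def by (auto intro: holomorphic_derivI)

context bergman_weight
begin

abbreviation DD where "DD \<equiv> dirichlet \<alpha>"
abbreviation D0 where "D0 \<equiv> dirichlet0 \<alpha>"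

definition dv :: "operator" where
  "dv f = on_disk (deriv f)"

lemma dv_analytic: "f \<in> disk_analytic \<Longrightarrow> dv f \<in> disk_analytic"
  unfolding dv_def by (intro on_disk_analytic holomorphic_deriv) (auto simp: disk_analytic_def)

lemma dv_square: "(\<integral>z. (cmod (deriv f z))\<^sup>2 \<partial>M) = (nrm (dv f))\<^sup>2"
  unfolding l2norm_power2 by (intro Bochner_Integration.integral_cong) (auto simp: dv_def on_disk_def)

lemma DD_iff: "f \<in> vecs DD \<longleftrightarrow> f \<in> disk_analytic \<and> dv f \<in> A2"
proof -
  have "integrable M (\<lambda>z. (cmod (deriv f z))\<^sup>2) \<longleftrightarrow> integrable M (\<lambda>z. (cmod (dv f z))\<^sup>2)"
    by (intro Bochner_Integration.integrable_cong) (auto simp: dv_def on_disk_def)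
  then show ?thesis
    using dv_analytic[of f] disk_analytic_measurable[of "dv f"] by (auto simp: dirichlet_def A2_iff l2_def)
qed

lemma vnorm_DD: "vnorm DD f = sqrt ((cmod (f 0))\<^sup>2 + (nrm (dv f))\<^sup>2)"
  by (simp add: dirichlet_def dv_square)

lemma D0_iff: "f \<in> vecs D0 \<longleftrightarrow> f \<in> vecs DD \<and> f 0 = 0"
  by (simp add: dirichlet0_def)

lemma vnorm_D0_DD: "vnorm D0 = vnorm DD"
  by (simp add: dirichlet0_def)

lemma vnorm_D0: "f \<in> vecs D0 \<Longrightarrow> vnorm D0 f = nrm (dv f)"
  by (simp add: vnorm_D0_DD vnorm_DD D0_iff)

lemma nrm_dv_le: "nrm (dv f) \<le> vnorm DD f"
  by (simp add: vnorm_DD real_le_rsqrt)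

lemma dv_lincomb:
  assumes "f \<in> disk_analytic" "g \<in> disk_analytic"
  shows "dv (\<lambda>z. a * f z + b * g z) = (\<lambda>z. a * dv f z + b * dv g z)"
proof
  fix z
  show "dv (\<lambda>z. a * f z + b * g z) z = a * dv f z + b * dv g z"
  proof (cases "z \<in> disk")
    case True
    have "((\<lambda>z. a * f z + b * g z) has_field_derivative a * deriv f z + b * deriv g z) (at z)"
      by (intro DERIV_add DERIV_cmult disk_analytic_DERIV assms True)
    then have "deriv (\<lambda>z. a * f z + b * g z) z = a * deriv f z + b * deriv g z" by (rule DERIV_imp_deriv)
    then show ?thesis using True by (simp add: dv_def on_disk_def)
  qed (simp add: dv_def on_disk_def)
qed

lemma DD_lincomb: "f \<in> vecs DD \<Longrightarrow> g \<in> vecs DD \<Longrightarrow> (\<lambda>z. a * f z + b * g z) \<in> vecs DD"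
  by (simp add: DD_iff disk_analytic_lincomb dv_lincomb A2_lincomb)

lemma normed_fs_DD: "normed_fs DD"
proof -
  have z: "(\<lambda>z. 0) \<in> vecs DD"
  proof -
    have "dv (\<lambda>z. 0) = (\<lambda>z. 0)" by (auto simp: dv_def on_disk_def fun_eq_iff)
    then show ?thesis using zero_A2 by (simp add: DD_iff A2_iff)
  qed
  have sc: "vnorm DD (\<lambda>z. a * f z) = cmod a * vnorm DD f" if "f \<in> vecs DD" for a f
  proof -
    have d: "dv (\<lambda>z. a * f z) = (\<lambda>z. a * dv f z)" using dv_lincomb[of f f a 0] that by (simp add: DD_iff)
    have "vnorm DD (\<lambda>z. a * f z) = sqrt ((cmod a)\<^sup>2 * ((cmod (f 0))\<^sup>2 + (nrm (dv f))\<^sup>2))"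
      unfolding vnorm_DD d by (simp add: l2norm_scale norm_mult power_mult_distrib algebra_simps)
    then show ?thesis by (simp add: real_sqrt_mult vnorm_DD)
  qed
  have tr: "vnorm DD (\<lambda>z. a * f z + b * g z) \<le> cmod a * vnorm DD f + cmod b * vnorm DD g"
    if "f \<in> vecs DD" "g \<in> vecs DD" for a b f g
  proof -
    have fa: "f \<in> disk_analytic" "g \<in> disk_analytic" and dA: "l2 M (dv f)" "l2 M (dv g)"
      using that by (auto simp: DD_iff A2_iff)
    have "vnorm DD (\<lambda>z. a * f z + b * g z) = sqrt ((cmod (a * f 0 + b * g 0))\<^sup>2 + (nrm (\<lambda>z. a * dv f z + b * dv g z))\<^sup>2)"
      unfolding vnorm_DD dv_lincomb[OF fa] ..
    also have "\<dots> \<le> sqrt ((cmod (a * f 0) + cmod (b * g 0))\<^sup>2 + (cmod a * nrm (dv f) + cmod b * nrm (dv g))\<^sup>2)"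
      by (intro real_sqrt_le_mono add_mono power_mono norm_triangle_ineq l2norm_triangle dA) auto
    also have "\<dots> \<le> sqrt ((cmod (a * f 0))\<^sup>2 + (cmod a * nrm (dv f))\<^sup>2) + sqrt ((cmod (b * g 0))\<^sup>2 + (cmod b * nrm (dv g))\<^sup>2)"
      by (rule real_sqrt_sum_squares_triangle_ineq)
    also have "\<dots> = cmod a * vnorm DD f + cmod b * vnorm DD g"
    proof -
      have "(cmod (c * h 0))\<^sup>2 + (cmod c * nrm (dv h))\<^sup>2 = (cmod c)\<^sup>2 * ((cmod (h 0))\<^sup>2 + (nrm (dv h))\<^sup>2)" for c h
        by (simp add: norm_mult power_mult_distrib algebra_simps)
      then show ?thesis by (simp add: real_sqrt_mult vnorm_DD)
    qed
    finally show ?thesis .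
  qed
  show ?thesis unfolding normed_fs_def using z sc tr DD_lincomb by (auto simp: vnorm_DD)
qed

lemma normed_fs_D0: "normed_fs D0"
  unfolding normed_fs_def vnorm_D0_DD
  using normed_fsD[OF normed_fs_DD] by (auto simp: D0_iff)

lemma dv_inj:
  assumes "f \<in> vecs D0" "g \<in> vecs D0" "dv f = dv g" shows "f = g"
proof
  fix z
  show "f z = g z"
  proof (cases "z \<in> disk")
    case True
    have fa: "f \<in> disk_analytic" "g \<in> disk_analytic" using assms by (auto simp: D0_iff DD_iff)
    have "((\<lambda>z. f z - g z) has_field_derivative 0) (at w)" if "w \<in> disk" for w
    proof -
      have "deriv f w = deriv g w" using fun_cong[OF assms(3), of w] that by (simp add: dv_def on_disk_def)
      then show ?thesis using DERIV_diff[OF disk_analytic_DERIV[OF fa(1) that] disk_analytic_DERIV[OF fa(2) that]] by simp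
    qed
    then have "(\<lambda>z. f z - g z) constant_on disk"
      by (intro has_field_derivative_0_imp_constant_on) auto
    then obtain c where c: "\<And>w. w \<in> disk \<Longrightarrow> f w - g w = c" by (auto simp: constant_on_def)
    have "c = 0" using c[of 0] assms by (simp add: D0_iff)
    then show ?thesis using c[OF True] by simp
  next
    case False
    then show ?thesis using assms by (simp add: D0_iff DD_iff disk_analytic_def)
  qed
qed

lemma primitive_exists:
  assumes "g \<in> A2" obtains p where "p \<in> vecs D0" "dv p = g"
proof -
  have gh: "g holomorphic_on disk" using assms by (simp add: A2_iff disk_analytic_def)
  obtain P where P: "\<And>z. z \<in> disk \<Longrightarrow> (P has_field_derivative g z) (at z within disk)"
    using holomorphic_convex_primitive'[OF _ _ gh] by (metis convex_ball open_ball)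
  then have P': "(P has_field_derivative g z) (at z)" if "z \<in> disk" for z
    using that at_within_open[of z disk] by (metis open_ball)
  define p where "p = on_disk (\<lambda>z. P z - P 0)"
  have hd: "((\<lambda>z. P z - P 0) has_field_derivative g z) (at z)" if "z \<in> disk" for z
    using DERIV_diff[OF P'[OF that] DERIV_const[of "P 0"]] by simp
  have "(\<lambda>z. P z - P 0) holomorphic_on disk"
    using hd by (intro holomorphic_onI) (metis field_differentiable_at_within field_differentiable_def)
  then have pa: "p \<in> disk_analytic" unfolding p_def by (rule on_disk_analytic)
  have "dv p z = g z" for z
  proof (cases "z \<in> disk")
    case True
    then have "deriv p z = g z" unfolding p_def using DERIV_imp_deriv[OF hd[OF True]] by (simp only: deriv_on_disk)
    then show ?thesis using True by (simp add: dv_def on_disk_def)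
  next
    case False
    then show ?thesis using assms by (simp add: dv_def on_disk_def A2_iff disk_analytic_def)
  qed
  then have "dv p = g" by blast
  moreover have "p \<in> vecs D0" using pa assms \<open>dv p = g\<close> by (simp add: D0_iff DD_iff) (simp add: p_def on_disk_def)
  ultimately show ?thesis using that by blast
qed

text \<open>The inverse of \<open>dv\<close>, which maps the Dirichlet functions vanishing at \<open>0\<close> isometrically onto the
  Bergman space (\<open>vnorm_D0\<close>, \<open>dv_inj\<close>, \<open>primitive_exists\<close>).\<close>

definition prim :: operator where
  "prim g = (SOME p. p \<in> vecs D0 \<and> dv p = g)"

lemma prim: "g \<in> A2 \<Longrightarrow> prim g \<in> vecs D0" "g \<in> A2 \<Longrightarrow> dv (prim g) = g"
proof -
  have "prim g \<in> vecs D0 \<and> dv (prim g) = g" if g: "g \<in> A2" for g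
  proof -
    obtain p where "p \<in> vecs D0 \<and> dv p = g" using primitive_exists[OF g] by blast
    then show ?thesis unfolding prim_def by (rule someI[where P = "\<lambda>p. p \<in> vecs D0 \<and> dv p = g"])
  qed
  then show "g \<in> A2 \<Longrightarrow> prim g \<in> vecs D0" "g \<in> A2 \<Longrightarrow> dv (prim g) = g" by auto
qed

lemma D0_dv: "f \<in> vecs D0 \<Longrightarrow> dv f \<in> A2"
  by (simp add: D0_iff DD_iff)

lemma linear_dv: "linear_op D0 B dv"
  unfolding linear_op_def using D0_dv dv_lincomb by (auto simp: D0_iff DD_iff)

lemma linear_prim: "linear_op B D0 prim"
  unfolding linear_op_def
proof (intro conjI ballI allI)
  fix f g :: "complex \<Rightarrow> complex" and a b :: complex
  assume f: "f \<in> A2" and g: "g \<in> A2"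
  have fg: "(\<lambda>z. a * f z + b * g z) \<in> A2" by (rule A2_lincomb[OF f g])
  show "prim (\<lambda>z. a * f z + b * g z) = (\<lambda>z. a * prim f z + b * prim g z)"
  proof (rule dv_inj)
    show "(\<lambda>z. a * prim f z + b * prim g z) \<in> vecs D0"
      by (rule normed_fs_lincomb[OF normed_fs_D0 prim(1)[OF f] prim(1)[OF g]])
    show "dv (prim (\<lambda>z. a * f z + b * g z)) = dv (\<lambda>z. a * prim f z + b * prim g z)"
      using prim[OF f] prim[OF g] prim(2)[OF fg] by (subst dv_lincomb) (auto simp: D0_iff DD_iff)
  qed (rule prim(1)[OF fg])
qed (rule prim(1))

definition sub0 :: operator where
  "sub0 f = on_disk (\<lambda>z. f z - f 0)"

lemma dv_sub0: "f \<in> disk_analytic \<Longrightarrow> dv (sub0 f) = dv f"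
proof
  fix z assume f: "f \<in> disk_analytic"
  show "dv (sub0 f) z = dv f z"
  proof (cases "z \<in> disk")
    case True
    have "((\<lambda>z. f z - f 0) has_field_derivative deriv f z) (at z)"
      using DERIV_diff[OF disk_analytic_DERIV[OF f True] DERIV_const[of "f 0"]] by simp
    then show ?thesis
      using True deriv_on_disk[OF True, of "\<lambda>z. f z - f 0"] by (simp add: dv_def sub0_def on_disk_def DERIV_imp_deriv)
  qed (simp add: dv_def on_disk_def)
qed

lemma sub0_D0: "f \<in> vecs DD \<Longrightarrow> sub0 f \<in> vecs D0"
proof -
  assume f: "f \<in> vecs DD"
  then have "f holomorphic_on disk" by (simp add: DD_iff disk_analytic_def)
  then have "sub0 f \<in> disk_analytic" unfolding sub0_def by (intro on_disk_analytic holomorphic_intros)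
  then show ?thesis using f dv_sub0[of f] by (simp add: D0_iff DD_iff) (simp add: sub0_def on_disk_def)
qed

lemma linear_sub0: "linear_op DD D0 sub0"
  unfolding linear_op_def using sub0_D0 by (auto simp: sub0_def on_disk_def fun_eq_iff algebra_simps)

lemma sub0_le: "f \<in> vecs DD \<Longrightarrow> vnorm D0 (sub0 f) \<le> vnorm DD f"
  using vnorm_D0[OF sub0_D0] dv_sub0[of f] nrm_dv_le[of f] by (simp add: DD_iff)

end

section \<open>Composition operators\<close>

locale bounded_composition = bergman_weight +
  fixes \<phi> :: "complex \<Rightarrow> complex"
  assumes holo: "\<phi> holomorphic_on disk" and maps: "\<phi> ` disk \<subseteq> disk"
    and nonconst: "\<not> \<phi> constant_on disk"
    and bounded: "bounded_op (dirichlet \<alpha>) (dirichlet \<alpha>) (comp_op \<phi>)"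
begin

abbreviation C where "C \<equiv> comp_op \<phi>"
abbreviation C0 where "C0 \<equiv> comp_op0 \<phi>"
abbreviation D where "D \<equiv> deriv_comp_op \<phi>"
abbreviation \<mu> where "\<mu> \<equiv> counting_fun_measure \<phi> \<alpha>"

lemma phi_disk: "z \<in> disk \<Longrightarrow> \<phi> z \<in> disk"
  using maps by blast

lemma dv_comp:
  assumes "f \<in> disk_analytic" shows "dv (C f) = D (dv f)"
proof
  fix z
  show "dv (C f) z = D (dv f) z"
  proof (cases "z \<in> disk")
    case True
    then have p: "\<phi> z \<in> disk" by (rule phi_disk)
    have "((\<lambda>z. f (\<phi> z)) has_field_derivative deriv f (\<phi> z) * deriv \<phi> z) (at z)"
      by (rule DERIV_chain2[OF disk_analytic_DERIV[OF assms p] holomorphic_derivI[OF holo open_ball True]])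
    then show ?thesis
      using True p deriv_on_disk[OF True, of "\<lambda>z. f (\<phi> z)"]
      by (simp add: dv_def comp_op_def deriv_comp_op_def on_disk_def DERIV_imp_deriv)
  qed (simp add: dv_def deriv_comp_op_def on_disk_def)
qed

lemma C_mem: "f \<in> vecs DD \<Longrightarrow> C f \<in> vecs DD"
  using bounded by (auto simp: bounded_op_def linear_op_def)

lemma C0_eq: "C0 f = sub0 (C f)"
  by (auto simp: comp_op0_def comp_op_def sub0_def on_disk_def fun_eq_iff)

lemma dv_C0: "f \<in> vecs DD \<Longrightarrow> dv (C0 f) = D (dv f)"
  using C_mem[of f] by (simp add: C0_eq dv_sub0 dv_comp DD_iff)

lemma bounded_id_D0: "bounded_op D0 DD (\<lambda>f. f)"
  unfolding bounded_op_def linear_op_def by (auto simp: vnorm_D0_DD D0_iff intro!: exI[of _ 1])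

lemma bounded_C0: "bounded_op D0 D0 C0"
proof -
  have "bounded_op DD D0 sub0"
    unfolding bounded_op_def using linear_sub0 sub0_le by (auto intro!: exI[of _ 1])
  from bounded_op_comp[OF bounded_op_comp[OF bounded_id_D0 bounded] this] show ?thesis
    using normed_fs_DD normed_fs_D0 unfolding C0_eq[abs_def] by blast
qed

lemma D_prim: "g \<in> A2 \<Longrightarrow> D g = dv (C0 (prim g))"
  using dv_C0[of "prim g"] prim[of g] by (simp add: D0_iff)

lemma bounded_D: "bounded_op B B D"
proof -
  have b1: "bounded_op B D0 prim"
    unfolding bounded_op_def using linear_prim vnorm_D0 prim by (auto intro!: exI[of _ 1] simp: vnorm_bergman)
  have b2: "bounded_op D0 B dv"
    unfolding bounded_op_def using linear_dv vnorm_D0 by (auto intro!: exI[of _ 1] simp: vnorm_bergman)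
  have "bounded_op B B (\<lambda>g. dv (C0 (prim g)))"
    using bounded_op_comp[OF bounded_op_comp[OF b1 bounded_C0] b2] normed_fs_bergman normed_fs_D0 by blast
  then obtain c where l: "linear_op B B (\<lambda>g. dv (C0 (prim g)))"
    and c: "\<And>f. f \<in> A2 \<Longrightarrow> nrm (dv (C0 (prim f))) \<le> c * nrm f"
    by (auto simp: bounded_op_def vnorm_bergman)
  have "linear_op B B D"
    unfolding linear_op_def
  proof (intro conjI ballI allI)
    show "D f \<in> A2" if "f \<in> A2" for f using linear_op_mem[OF l that] D_prim[OF that] by simp
    show "D (\<lambda>z. a * f z + b * g z) = (\<lambda>z. a * D f z + b * D g z)" for a b f g
      by (auto simp: deriv_comp_op_def on_disk_def fun_eq_iff algebra_simps)
  qed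
  then show ?thesis using c D_prim unfolding bounded_op_def vnorm_bergman by auto
qed

text \<open>Both inequalities are instances of \<open>ess_norm_transfer\<close>: on the one hand
  \<open>C f = C0 (f - f 0) + f (\<phi> 0)\<close>, on the other \<open>C0 f = C f - (C f) 0\<close>. Evaluation at \<open>\<phi> 0\<close> is a bounded
  functional because \<open>f (\<phi> 0)\<close> is the value of \<open>C f\<close> at \<open>0\<close>.\<close>

lemma ess_norm_C: "ess_norm DD DD C = ess_norm D0 D0 C0"
proof (rule antisym)
  let ?one = "on_disk (\<lambda>_. 1)"
  have one: "?one \<in> vecs DD"
  proof -
    have a: "?one \<in> disk_analytic" by (intro on_disk_analytic holomorphic_intros)
    have "dv ?one = (\<lambda>z. 0)"
    proof
      fix z show "dv ?one z = 0"
        using deriv_on_disk[of z "\<lambda>_. 1"] by (cases "z \<in> disk") (simp_all add: dv_def on_disk_def)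
    qed
    then show ?thesis using a zero_A2 by (simp add: DD_iff)
  qed
  have \<phi>0: "\<phi> 0 \<in> disk" by (rule phi_disk) simp
  obtain c where c: "\<And>f. f \<in> vecs DD \<Longrightarrow> vnorm DD (C f) \<le> c * vnorm DD f"
    using bounded by (auto simp: bounded_op_def)
  have R: "compact_op DD DD (\<lambda>f z. f (\<phi> 0) * ?one z)"
  proof (rule compact_op_rank_one[OF normed_fs_DD normed_fs_DD one])
    show "cmod (f (\<phi> 0)) \<le> c * vnorm DD f" if "f \<in> vecs DD" for f
    proof -
      have "cmod (f (\<phi> 0)) = cmod (C f 0)" by (simp add: comp_op_def on_disk_def)
      also have "\<dots> \<le> vnorm DD (C f)" by (simp add: vnorm_DD real_le_rsqrt)
      also have "\<dots> \<le> c * vnorm DD f" by (rule c[OF that])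
      finally show ?thesis .
    qed
  qed simp
  show "ess_norm DD DD C \<le> ess_norm D0 D0 C0"
  proof (rule ess_norm_transfer[OF normed_fs_DD normed_fs_D0 normed_fs_D0 normed_fs_DD linear_sub0 sub0_le, where B = "\<lambda>f. f"])
    show "linear_op D0 DD (\<lambda>f. f)" using bounded_id_D0 by (simp add: bounded_op_def)
    show "compact_op DD DD (\<lambda>f z. f (\<phi> 0) * ?one z)" by (rule R)
    show "C f = (\<lambda>z. C0 (sub0 f) z + f (\<phi> 0) * ?one z)" if "f \<in> vecs DD" for f
      using \<phi>0 phi_disk by (auto simp: comp_op_def comp_op0_def sub0_def on_disk_def fun_eq_iff)
  qed (use bounded bounded_C0 in \<open>auto simp: vnorm_D0_DD\<close>)
  show "ess_norm D0 D0 C0 \<le> ess_norm DD DD C"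
  proof (rule ess_norm_transfer[OF normed_fs_D0 normed_fs_DD normed_fs_DD normed_fs_D0, where A = "\<lambda>f. f" and B = sub0])
    show "linear_op D0 DD (\<lambda>f. f)" using bounded_id_D0 by (simp add: bounded_op_def)
    show "compact_op D0 D0 (\<lambda>f z. 0)" by (rule compact_op_zero[OF normed_fs_D0 normed_fs_D0])
  qed (use bounded bounded_C0 linear_sub0 sub0_le in \<open>auto simp: vnorm_D0_DD C0_eq\<close>)
qed

text \<open>\<open>dv\<close> and its inverse \<open>prim\<close> intertwine the two operators isometrically.\<close>

lemma ess_norm_C0: "ess_norm D0 D0 C0 = ess_norm B B D"
proof (rule antisym)
  have C0m: "C0 f \<in> vecs D0" if "f \<in> vecs D0" for f
    using bounded_C0 that by (auto simp: bounded_op_def linear_op_def)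
  have Dm: "D g \<in> A2" if "g \<in> A2" for g
    using bounded_D that by (auto simp: bounded_op_def linear_op_def)
  show "ess_norm D0 D0 C0 \<le> ess_norm B B D"
  proof (rule ess_norm_transfer[OF normed_fs_D0 normed_fs_bergman normed_fs_bergman normed_fs_D0 linear_dv _ linear_prim])
    show "C0 f = (\<lambda>z. prim (D (dv f)) z + 0)" if "f \<in> vecs D0" for f
    proof -
      have DA: "D (dv f) \<in> A2" by (rule Dm[OF D0_dv[OF that]])
      have "C0 f = prim (D (dv f))"
        by (rule dv_inj[OF C0m[OF that] prim(1)[OF DA]]) (use dv_C0[of f] prim(2)[OF DA] that in \<open>simp add: D0_iff\<close>)
      then show ?thesis by simp
    qed
  qed (use bounded_C0 bounded_D compact_op_zero[OF normed_fs_D0 normed_fs_D0] prim in \<open>auto simp: vnorm_D0 vnorm_bergman\<close>)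
  show "ess_norm B B D \<le> ess_norm D0 D0 C0"
  proof (rule ess_norm_transfer[OF normed_fs_bergman normed_fs_D0 normed_fs_D0 normed_fs_bergman linear_prim _ linear_dv])
    show "D f = (\<lambda>z. dv (C0 (prim f)) z + 0)" if "f \<in> vecs B" for f
      using D_prim[OF that] by simp
  qed (use bounded_C0 bounded_D compact_op_zero[OF normed_fs_bergman normed_fs_bergman] prim in \<open>auto simp: vnorm_D0 vnorm_bergman\<close>)
qed

lemma deriv_measurable: "deriv \<phi> \<in> borel_measurable M"
  by (rule holomorphic_measurable_warea) (use holo in \<open>auto intro: holomorphic_deriv\<close>)

lemma integral_\<mu>:
  assumes "f \<in> A2" "g \<in> A2"
  shows "(\<integral>z. f z * cnj (g z) \<partial>\<mu>) = ip M (D f) (D g)"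
proof -
  note [measurable] = deriv_measurable self_map_measurable[OF holo maps, of \<alpha>]
  have [measurable]: "f \<in> borel_measurable M" "g \<in> borel_measurable M"
    using assms disk_analytic_measurable by (auto simp: A2_iff)
  let ?d = "density M (\<lambda>z. ennreal ((cmod (deriv \<phi> z))\<^sup>2))"
  have "(\<integral>z. f z * cnj (g z) \<partial>\<mu>) = (\<integral>z. f z * cnj (g z) \<partial>distr ?d M \<phi>)"
    by (simp only: counting_fun_measure_eq_distr[OF alpha holo maps nonconst])
  also have "\<dots> = (\<integral>z. f (\<phi> z) * cnj (g (\<phi> z)) \<partial>?d)"
    by (rule integral_distr) measurable
  also have "\<dots> = (\<integral>z. (cmod (deriv \<phi> z))\<^sup>2 *\<^sub>R (f (\<phi> z) * cnj (g (\<phi> z))) \<partial>M)"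
    by (rule integral_density) (auto intro!: measurable_compose[OF self_map_measurable[OF holo maps]])
  also have "\<dots> = ip M (D f) (D g)"
    unfolding ip_def
  proof (rule Bochner_Integration.integral_cong)
    fix z assume "z \<in> space M"
    then show "(cmod (deriv \<phi> z))\<^sup>2 *\<^sub>R (f (\<phi> z) * cnj (g (\<phi> z))) = D f z * cnj (D g z)"
      unfolding scaleR_conv_of_real complex_norm_square by (simp add: deriv_comp_op_def on_disk_def mult_ac)
  qed simp
  finally show ?thesis .
qed

lemma nn_integral_\<mu>:
  assumes "f \<in> A2"
  shows "(\<integral>\<^sup>+z. ennreal ((cmod (f z))\<^sup>2) \<partial>\<mu>) = ennreal ((nrm (D f))\<^sup>2)"
proof -
  note [measurable] = deriv_measurable self_map_measurable[OF holo maps, of \<alpha>]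
  have [measurable]: "f \<in> borel_measurable M"
    using assms disk_analytic_measurable by (auto simp: A2_iff)
  have Df: "D f \<in> A2" using bounded_D assms by (auto simp: bounded_op_def linear_op_def)
  let ?d = "density M (\<lambda>z. ennreal ((cmod (deriv \<phi> z))\<^sup>2))"
  have "(\<integral>\<^sup>+z. ennreal ((cmod (f z))\<^sup>2) \<partial>\<mu>) = (\<integral>\<^sup>+z. ennreal ((cmod (f z))\<^sup>2) \<partial>distr ?d M \<phi>)"
    by (simp only: counting_fun_measure_eq_distr[OF alpha holo maps nonconst])
  also have "\<dots> = (\<integral>\<^sup>+z. ennreal ((cmod (f (\<phi> z)))\<^sup>2) \<partial>?d)"
    by (rule nn_integral_distr) measurable
  also have "\<dots> = (\<integral>\<^sup>+z. ennreal ((cmod (deriv \<phi> z))\<^sup>2) * ennreal ((cmod (f (\<phi> z)))\<^sup>2) \<partial>M)"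
    by (rule nn_integral_density) measurable
  also have "\<dots> = (\<integral>\<^sup>+z. ennreal ((cmod (D f z))\<^sup>2) \<partial>M)"
    by (intro nn_integral_cong)
       (simp add: deriv_comp_op_def on_disk_def norm_mult power_mult_distrib ennreal_mult mult.commute)
  also have "\<dots> = ennreal ((nrm (D f))\<^sup>2)" by (rule l2norm_ennreal[symmetric, OF A2_l2[OF Df]])
  finally show ?thesis .
qed

theorem ess_norm_D_toeplitz: "(ess_norm B B D)\<^sup>2 = ess_norm B B (toeplitz \<alpha> \<mu>)"
  using ess_norm_toeplitz[OF bounded_D toeplitz_spec[OF bounded_D integral_\<mu>]] by blast

end

section \<open>Geometry of Bergman disks\<close>

lemma mob_cmod_sym: "cmod (mob u w) = cmod (mob w u)"
proof -
  have "1 - cnj u * w = cnj (1 - cnj w * u)" by (simp add: mult.commute)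
  then have "cmod (1 - cnj u * w) = cmod (1 - cnj w * u)" by (metis complex_mod_cnj)
  then show ?thesis by (simp add: mob_def norm_divide norm_minus_commute)
qed

lemma one_minus_cmod_square: "cmod z < 1 \<Longrightarrow> 0 < 1 - (cmod z)\<^sup>2" "1 - (cmod z)\<^sup>2 \<le> 1"
  by (auto simp: abs_square_less_1)

lemma mob_denom_le: "cmod u < 1 \<Longrightarrow> cmod w \<le> 1 \<Longrightarrow> cmod (1 - cnj u * w) \<le> 2"
proof -
  assume "cmod u < 1" "cmod w \<le> 1"
  then have "cmod (cnj u * w) \<le> 1" by (simp add: norm_mult mult_le_one)
  then show ?thesis using norm_triangle_ineq4[of 1 "cnj u * w"] by simp
qed

lemma mob_denom_ge:
  assumes "cmod u < 1" "cmod w \<le> 1" shows "(1 - (cmod u)\<^sup>2) / 2 \<le> cmod (1 - cnj u * w)"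
proof -
  have "1 - (cmod u)\<^sup>2 = (1 - cmod u) * (1 + cmod u)" by (simp add: power2_eq_square algebra_simps)
  also have "\<dots> \<le> (1 - cmod u) * 2" using assms by (intro mult_left_mono) auto
  finally show ?thesis using mob_denom_bound(1)[OF assms] by simp
qed

text \<open>Write \<open>w = mob z u\<close> with \<open>|u| < \<rho>\<close>. Both estimates then reduce to the bounds
  \<open>1 - \<rho> \<le> |1 - cnj(z) u| \<le> 2\<close>.\<close>

lemma near_comparisons:
  assumes z: "cmod z < 1" and w: "cmod w < 1" and \<rho>: "cmod (mob z w) < \<rho>" "\<rho> < 1"
  shows "cmod (1 - cnj z * w) \<le> (1 - (cmod z)\<^sup>2) / (1 - \<rho>)"
    and "(1 - (cmod z)\<^sup>2) * (1 - \<rho>\<^sup>2) / 4 \<le> 1 - (cmod w)\<^sup>2"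
proof -
  define u where "u = mob z w"
  have u: "cmod u < 1" and wu: "w = mob z u" using mob_in_disk[OF z w] mob_mob[OF z w] by (auto simp: u_def)
  have nz: "1 - cnj z * u \<noteq> 0" using mob_denom_bound[of z u] z u by auto
  have "cmod z * cmod u \<le> 1 * \<rho>" using z \<rho> by (intro mult_mono) (auto simp: u_def)
  then have lo: "1 - \<rho> \<le> cmod (1 - cnj z * u)"
    using norm_triangle_ineq2[of 1 "cnj z * u"] by (simp add: norm_mult)
  have hi: "cmod (1 - cnj z * u) \<le> 2" using mob_denom_le[of z u] z u by simp
  have sz: "0 < 1 - (cmod z)\<^sup>2" by (rule one_minus_cmod_square(1)[OF z])
  have "1 - cnj z * w = (1 - cnj z * z) / (1 - cnj z * u)"
    unfolding wu using nz by (simp add: mob_def field_simps)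
  also have "1 - cnj z * z = of_real (1 - (cmod z)\<^sup>2)"
    by (simp only: of_real_diff of_real_1 complex_norm_square mult.commute)
  finally have "cmod (1 - cnj z * w) = (1 - (cmod z)\<^sup>2) / cmod (1 - cnj z * u)"
    using sz by (simp only: norm_divide norm_of_real abs_of_pos)
  also have "\<dots> \<le> (1 - (cmod z)\<^sup>2) / (1 - \<rho>)" using lo \<rho> sz by (intro divide_left_mono mult_pos_pos) auto
  finally show "cmod (1 - cnj z * w) \<le> (1 - (cmod z)\<^sup>2) / (1 - \<rho>)" .
  have "(cmod u)\<^sup>2 \<le> \<rho>\<^sup>2" using \<rho> by (intro power_mono) (auto simp: u_def)
  moreover have "(cmod (1 - cnj z * u))\<^sup>2 \<le> 2\<^sup>2" using hi by (intro power_mono) auto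
  ultimately have "(1 - (cmod z)\<^sup>2) * (1 - \<rho>\<^sup>2) / 4 \<le> (1 - (cmod z)\<^sup>2) * (1 - (cmod u)\<^sup>2) / (cmod (1 - cnj z * u))\<^sup>2"
    using sz nz one_minus_cmod_square(1)[OF u]
    by (intro frac_le mult_left_mono mult_nonneg_nonneg) auto
  then show "(1 - (cmod z)\<^sup>2) * (1 - \<rho>\<^sup>2) / 4 \<le> 1 - (cmod w)\<^sup>2"
    using one_minus_mob[OF z u] wu by simp
qed

lemma tanh_artanh_real:
  fixes x :: real assumes "\<bar>x\<bar> < 1" shows "tanh (artanh x) = x"
proof -
  have e: "exp (- 2 * artanh x) = (1 - x) / (1 + x)"
    using assms by (simp add: artanh_def exp_minus)
  show ?thesis unfolding tanh_real_altdef e using assms by (simp add: field_simps)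
qed

lemma bergman_disk_eq:
  assumes "cmod z < 1"
  shows "bergman_disk z r = {w \<in> disk. cmod (mob z w) < tanh r}"
proof -
  have "bergman_dist z w < r \<longleftrightarrow> cmod (mob z w) < tanh r" if "cmod w < 1" for w
  proof -
    have "\<bar>cmod (mob z w)\<bar> < 1" using mob_in_disk[OF assms that] by simp
    then have "tanh (artanh (cmod (mob z w))) = cmod (mob z w)" by (rule tanh_artanh_real)
    then show ?thesis unfolding bergman_dist_def mob_def[symmetric] by (metis tanh_real_less_iff)
  qed
  then show ?thesis by (auto simp: bergman_disk_def)
qed

locale bergman_radius = bergman_weight +
  fixes r :: real
  assumes r_pos: "r > 0"
begin

text \<open>The Euclidean radius of the Bergman disk about \<open>0\<close>.\<close>

definition \<rho> where "\<rho> = tanh r"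
definition p where "p = 2 + \<alpha>"
definition ball_mass where "ball_mass = ball_moment \<alpha> \<rho> 0"

abbreviation s :: "complex \<Rightarrow> real" where "s z \<equiv> 1 - (cmod z)\<^sup>2"

lemma rho: "0 < \<rho>" "\<rho> < 1"
  using r_pos by (auto simp: \<rho>_def tanh_real_lt_1)

lemma rho_square: "\<rho>\<^sup>2 < 1"
  using abs_square_less_1[of \<rho>] rho by simp

lemma p_pos: "p > 0" using alpha by (simp add: p_def)

lemma ball_mass_ennreal: "ennreal ball_mass = (\<integral>\<^sup>+z. indicator (ball 0 \<rho>) z \<partial>M)"
  unfolding ball_mass_def ball_moment_ennreal[OF alpha] by simp

lemma ball_mass_pos: "ball_mass > 0"
proof -
  have bs: "ball (0::complex) \<rho> \<subseteq> disk" using rho by auto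
  then have "ball 0 \<rho> \<in> sets M" by (intro in_sets_warea[THEN iffD2] conjI) simp
  then have "ennreal ball_mass = emeasure M (ball 0 \<rho>)" unfolding ball_mass_ennreal by simp
  moreover have "emeasure M (ball 0 \<rho>) > 0" by (rule warea_open_pos[OF alpha]) (use rho bs in auto)
  ultimately show ?thesis by (metis ennreal_less_zero_iff)
qed

lemma mob_jac_eq: "mob_jac \<alpha> z w = (s z / (cmod (1 - cnj z * w))\<^sup>2) powr p"
  by (simp add: mob_jac_def p_def)

lemma bergman_disk_sets: "cmod z < 1 \<Longrightarrow> bergman_disk z r \<in> sets borel" "bergman_disk z r \<subseteq> disk"
proof -
  assume z: "cmod z < 1"
  have "(\<lambda>w. cmod (mob z w)) \<in> borel_measurable borel" by measurable
  from measurable_sets[OF this, of "{..<tanh r}"]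
  have "disk \<inter> (\<lambda>w. cmod (mob z w)) -` {..<tanh r} \<in> sets borel" by (intro sets.Int) auto
  also have "disk \<inter> (\<lambda>w. cmod (mob z w)) -` {..<tanh r} = bergman_disk z r"
    unfolding bergman_disk_eq[OF z] by auto
  finally show "bergman_disk z r \<in> sets borel" .
qed (auto simp: bergman_disk_def)

text \<open>\<open>mob z\<close> maps \<open>bergman_disk z r\<close> onto the Euclidean disk of radius \<open>\<rho>\<close>, on which the Jacobian lies
  between constant multiples of \<open>(1 - |z|\<^sup>2)\<^sup>2\<^sup>+\<^sup>\<alpha>\<close>.\<close>

lemma bergman_disk_measure:
  assumes z: "cmod z < 1"
  shows "ennreal (ball_mass * (s z / 4) powr p) \<le> emeasure M (bergman_disk z r)"
    and "emeasure M (bergman_disk z r) \<le> ennreal (ball_mass * (s z / (1 - \<rho>)\<^sup>2) powr p)"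
proof -
  have bs: "bergman_disk z r \<in> sets M" using bergman_disk_sets[of z] z by (intro in_sets_warea[THEN iffD2] conjI)
  have [measurable]: "mob_jac \<alpha> z \<in> borel_measurable borel" unfolding mob_jac_def by measurable
  have [measurable]: "ball 0 \<rho> \<in> sets (borel :: complex measure)" by simp
  have "emeasure M (bergman_disk z r) = (\<integral>\<^sup>+w. indicator (bergman_disk z r) w \<partial>M)"
    by (rule nn_integral_indicator[OF bs, symmetric])
  also have "\<dots> = (\<integral>\<^sup>+w. indicator (ball 0 \<rho>) (mob z w) \<partial>M)"
    by (intro nn_integral_cong) (auto simp: bergman_disk_eq[OF z] \<rho>_def indicator_def)
  also have "\<dots> = (\<integral>\<^sup>+u. indicator (ball 0 \<rho>) u * ennreal (mob_jac \<alpha> z u) \<partial>M)"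
    by (rule nn_integral_mob[OF alpha z]) measurable
  finally have e: "emeasure M (bergman_disk z r) = (\<integral>\<^sup>+u. indicator (ball 0 \<rho>) u * ennreal (mob_jac \<alpha> z u) \<partial>M)" .
  have c: "(\<integral>\<^sup>+u. indicator (ball 0 \<rho>) u * ennreal c \<partial>M) = ennreal (ball_mass * c)" if "c \<ge> 0" for c
    using that ball_mass_pos by (subst nn_integral_multc) (auto simp: ball_mass_ennreal[symmetric] ennreal_mult)
  have sz: "s z > 0" by (rule one_minus_cmod_square(1)[OF z])
  have "(\<integral>\<^sup>+u. indicator (ball 0 \<rho>) u * ennreal ((s z / 4) powr p) \<partial>M) \<le> (\<integral>\<^sup>+u. indicator (ball 0 \<rho>) u * ennreal (mob_jac \<alpha> z u) \<partial>M)"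
  proof (rule nn_integral_mono)
    fix u assume "u \<in> space M"
    then have u: "cmod u < 1" by simp
    have nz: "1 - cnj z * u \<noteq> 0" using mob_denom_bound[of z u] z u by auto
    have "(cmod (1 - cnj z * u))\<^sup>2 \<le> 2\<^sup>2" using mob_denom_le[of z u] z u by (intro power_mono) auto
    then have "s z / 4 \<le> s z / (cmod (1 - cnj z * u))\<^sup>2" using sz nz by (intro divide_left_mono) auto
    then have "(s z / 4) powr p \<le> mob_jac \<alpha> z u" unfolding mob_jac_eq using sz p_pos by (intro powr_mono2) auto
    then show "indicator (ball 0 \<rho>) u * ennreal ((s z / 4) powr p) \<le> indicator (ball 0 \<rho>) u * ennreal (mob_jac \<alpha> z u)"
      by (intro mult_left_mono ennreal_leI) auto
  qed
  then show "ennreal (ball_mass * (s z / 4) powr p) \<le> emeasure M (bergman_disk z r)" unfolding e by (subst (asm) c) auto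
  have "(\<integral>\<^sup>+u. indicator (ball 0 \<rho>) u * ennreal (mob_jac \<alpha> z u) \<partial>M) \<le> (\<integral>\<^sup>+u. indicator (ball 0 \<rho>) u * ennreal ((s z / (1 - \<rho>)\<^sup>2) powr p) \<partial>M)"
  proof (rule nn_integral_mono)
    fix u :: complex
    show "indicator (ball 0 \<rho>) u * ennreal (mob_jac \<alpha> z u) \<le> indicator (ball 0 \<rho>) u * ennreal ((s z / (1 - \<rho>)\<^sup>2) powr p)"
    proof (cases "u \<in> ball 0 \<rho>")
      case True
      have "cmod z * cmod u \<le> 1 * \<rho>" using z True by (intro mult_mono) auto
      then have lo: "1 - \<rho> \<le> cmod (1 - cnj z * u)"
        using norm_triangle_ineq2[of 1 "cnj z * u"] by (simp add: norm_mult)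
      then have "(1 - \<rho>)\<^sup>2 \<le> (cmod (1 - cnj z * u))\<^sup>2" using rho by (intro power_mono) auto
      then have "s z / (cmod (1 - cnj z * u))\<^sup>2 \<le> s z / (1 - \<rho>)\<^sup>2"
        using sz rho lo by (intro divide_left_mono mult_pos_pos) auto
      then have "mob_jac \<alpha> z u \<le> (s z / (1 - \<rho>)\<^sup>2) powr p" unfolding mob_jac_eq using sz p_pos by (intro powr_mono2) auto
      then show ?thesis by (intro mult_left_mono ennreal_leI) auto
    qed simp
  qed
  then show "emeasure M (bergman_disk z r) \<le> ennreal (ball_mass * (s z / (1 - \<rho>)\<^sup>2) powr p)" unfolding e by (subst (asm) c) auto
qed

section \<open>Test functions\<close>

text \<open>The reproducing kernel at \<open>z\<close>, multiplied by a power of \<open>1 - |z|\<^sup>2\<close> such that its squared modulus is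
  the Moebius Jacobian. The principal branch of the logarithm is available since \<open>1 - cnj(z) w\<close> has
  positive real part.\<close>

definition kern :: "complex \<Rightarrow> complex \<Rightarrow> complex" where
  "kern z = on_disk (\<lambda>w. of_real (s z powr (p/2)) * exp (- of_real p * Ln (1 - cnj z * w)))"

lemma kern_analytic: assumes "cmod z < 1" shows "kern z \<in> disk_analytic"
  unfolding kern_def
proof (intro on_disk_analytic holomorphic_intros)
  fix w assume "w \<in> disk"
  then have "cmod z * cmod w \<le> cmod z * 1" by (intro mult_left_mono) auto
  then have "cmod (cnj z * w) < 1" using assms by (simp add: norm_mult)
  then have "Re (cnj z * w) < 1" using complex_Re_le_cmod[of "cnj z * w"] by linarith
  then show "1 - cnj z * w \<notin> \<real>\<^sub>\<le>\<^sub>0" by (auto simp: complex_nonpos_Reals_iff)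
qed

lemma kern_cmod:
  assumes "cmod z < 1" "cmod w < 1"
  shows "cmod (kern z w) = s z powr (p/2) * (cmod (1 - cnj z * w)) powr (-p)"
    and "(cmod (kern z w))\<^sup>2 = mob_jac \<alpha> z w"
proof -
  have nz: "1 - cnj z * w \<noteq> 0" using mob_denom_bound[of z w] assms by auto
  have sz: "s z > 0" by (rule one_minus_cmod_square(1)[OF assms(1)])
  show e: "cmod (kern z w) = s z powr (p/2) * (cmod (1 - cnj z * w)) powr (-p)"
    using assms nz by (simp add: kern_def on_disk_def norm_mult powr_def)
  have "(s z powr (p/2))\<^sup>2 = s z powr p" by (simp add: power2_eq_square powr_add[symmetric])
  moreover have "((cmod (1 - cnj z * w)) powr (-p))\<^sup>2 = 1 / ((cmod (1 - cnj z * w))\<^sup>2) powr p"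
    using nz by (simp add: power2_eq_square powr_mult powr_minus field_simps)
  ultimately show "(cmod (kern z w))\<^sup>2 = mob_jac \<alpha> z w"
    unfolding e mob_jac_eq power_mult_distrib using sz nz by (simp add: powr_divide)
qed

text \<open>By \<open>kern_cmod\<close> the squared norm is the integral of a Jacobian, that is, the total mass of \<open>A\<^sub>\<alpha>\<close>.\<close>

lemma kern_A2: assumes z: "cmod z < 1" shows "kern z \<in> A2" "(nrm (kern z))\<^sup>2 = \<gamma> 0"
proof -
  have a: "kern z \<in> disk_analytic" by (rule kern_analytic[OF z])
  have g0: "ennreal (\<gamma> 0) = (\<integral>\<^sup>+v. 1 \<partial>M)"
    unfolding moment_eq_ball_moment ball_moment_ennreal[OF alpha] by (intro nn_integral_cong) auto
  have "(\<integral>\<^sup>+w. ennreal ((cmod (kern z w))\<^sup>2) \<partial>M) = (\<integral>\<^sup>+w. 1 * ennreal (mob_jac \<alpha> z w) \<partial>M)"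
    using kern_cmod(2)[OF z] by (intro nn_integral_cong) auto
  also have "\<dots> = (\<integral>\<^sup>+v. 1 \<partial>M)" by (rule nn_integral_mob[OF alpha z, symmetric]) auto
  finally have e: "(\<integral>\<^sup>+w. ennreal ((cmod (kern z w))\<^sup>2) \<partial>M) = ennreal (\<gamma> 0)" using g0 by simp
  then show A: "kern z \<in> A2"
    using a l2_iff_nn_integral[OF disk_analytic_measurable[OF a]] by (simp add: A2_iff)
  have "ennreal ((nrm (kern z))\<^sup>2) = ennreal (\<gamma> 0)" using l2norm_ennreal[OF A2_l2[OF A]] e by simp
  then show "(nrm (kern z))\<^sup>2 = \<gamma> 0" using moment_pos[of 0] ennreal_inj[of "(nrm (kern z))\<^sup>2" "\<gamma> 0"] by simp
qed

text \<open>Cauchy's estimate on the circle \<open>|w| = 1/2\<close>, where \<open>|1 - cnj(z) w| \<ge> 1/2\<close>. The power of \<open>1 - |z|\<^sup>2\<close>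
  makes every coefficient vanish in the limit \<open>|z| \<rightarrow> 1\<close>.\<close>

lemma kern_coef:
  assumes z: "cmod z < 1" shows "cmod (coef (kern z) k) \<le> 2 ^ k * (s z powr (p/2) * (1/2) powr (-p))"
proof -
  let ?B = "s z powr (p/2) * (1/2) powr (-p)"
  have hol: "kern z holomorphic_on disk" using kern_analytic[OF z] by (simp add: disk_analytic_def)
  have "norm ((deriv ^^ k) (kern z) 0) \<le> fact k * ?B / (1/2) ^ k"
  proof (rule Cauchy_inequality)
    show "kern z holomorphic_on ball 0 (1/2)" by (rule holomorphic_on_subset[OF hol]) auto
    show "continuous_on (cball 0 (1/2)) (kern z)"
      by (rule holomorphic_on_imp_continuous_on, rule holomorphic_on_subset[OF hol]) auto
    fix w :: complex assume "norm (0 - w) = 1/2"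
    then have w: "cmod w = 1/2" by simp
    have "cmod z * cmod w \<le> 1 * (1/2)" using z w by (intro mult_mono) auto
    then have "1/2 \<le> cmod (1 - cnj z * w)"
      using norm_triangle_ineq2[of 1 "cnj z * w"] by (simp add: norm_mult)
    then have "(cmod (1 - cnj z * w)) powr (-p) \<le> (1/2) powr (-p)" using p_pos by (intro powr_mono2') auto
    then show "norm (kern z w) \<le> ?B" unfolding kern_cmod(1)[OF z, of w, unfolded w, simplified]
      using kern_cmod(1)[OF z, of w] w by (auto intro: mult_left_mono)
  qed simp
  then show ?thesis by (simp add: coef_def norm_divide field_simps power_divide)
qed

lemma kern_tay: "\<exists>Cn\<ge>0. \<forall>z. cmod z < 1 \<longrightarrow> (nrm (tay n (kern z)))\<^sup>2 \<le> Cn * s z powr p"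
proof (intro exI conjI allI impI)
  let ?C = "\<Sum>k<n. (2 ^ k * (1/2) powr (-p))\<^sup>2 * \<gamma> k"
  show "?C \<ge> 0" by (intro sum_nonneg mult_nonneg_nonneg less_imp_le[OF moment_pos]) auto
  fix z :: complex assume z: "cmod z < 1"
  have "(nrm (tay n (kern z)))\<^sup>2 \<le> (\<Sum>k<n. (2 ^ k * (s z powr (p/2) * (1/2) powr (-p)))\<^sup>2 * \<gamma> k)"
    unfolding nrm_tay
    by (intro sum_mono mult_right_mono power_mono kern_coef z less_imp_le[OF moment_pos]) auto
  also have "\<dots> = ?C * (s z powr (p/2))\<^sup>2"
    by (simp add: sum_distrib_left sum_distrib_right power_mult_distrib mult_ac)
  also have "(s z powr (p/2))\<^sup>2 = s z powr p" by (simp add: power2_eq_square powr_add[symmetric])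
  finally show "(nrm (tay n (kern z)))\<^sup>2 \<le> ?C * s z powr p" .
qed

section \<open>A submean value inequality and smallness of tails on compact sets\<close>

text \<open>Parseval's identity for \<open>f \<circ> mob u\<close> on the disk of radius \<open>\<rho>\<close>, of which only the constant term
  is kept; the Moebius change of variables turns that disk into the Bergman disk about \<open>u\<close>.\<close>

lemma submean:
  assumes f: "f \<in> A2" and u: "cmod u < 1"
  shows "ennreal (ball_mass * (cmod (f u))\<^sup>2) \<le>
    ennreal ((4 / s u) powr p) * (\<integral>\<^sup>+w. ennreal ((cmod (f w))\<^sup>2) * indicator {..<\<rho>} (cmod (mob u w)) \<partial>M)"
proof -
  have fa: "f \<in> disk_analytic" using f by (simp add: A2_iff)
  have [measurable]: "f \<in> borel_measurable borel" by (rule disk_analytic_borel[OF fa])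
  have [measurable]: "mob_jac \<alpha> u \<in> borel_measurable borel" unfolding mob_jac_def by measurable
  have md: "mob u v \<in> disk" if "v \<in> disk" for v using mob_in_disk[OF u] that by auto
  have mh: "mob u holomorphic_on disk"
    by (rule holomorphic_onI) (metis u mob_deriv field_differentiable_def field_differentiable_at_within mem_ball_0)
  have gh: "(\<lambda>v. f (mob u v)) holomorphic_on disk"
  proof -
    have fh: "f holomorphic_on disk" using fa by (simp add: disk_analytic_def)
    have "mob u ` disk \<subseteq> disk" using md by blast
    from holomorphic_on_compose_gen[OF mh fh this] show ?thesis by (simp add: o_def)
  qed
  define g where "g = on_disk (\<lambda>v. f (mob u v))"
  have ga: "g \<in> disk_analytic" unfolding g_def by (rule on_disk_analytic[OF gh])
  have "(\<lambda>k. coef g k * 0 ^ k) sums g 0" by (rule coef_sums[OF ga]) simp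
  moreover have "(\<lambda>k. coef g k * 0 ^ k) sums (\<Sum>k\<in>{0}. coef g k * 0 ^ k)" by (rule sums_finite) auto
  ultimately have c0: "coef g 0 = f u" using sums_unique2 by (fastforce simp: g_def on_disk_def mob_def)
  have "(cmod (coef g 0))\<^sup>2 * ball_moment \<alpha> \<rho> 0 \<le> (\<integral>z. (cmod (g z))\<^sup>2 * indicator (ball 0 \<rho>) z \<partial>M)"
  proof -
    note ps = parseval_ball(1)[OF alpha coef_sums[OF ga] rho]
    have "(\<Sum>k\<in>{0}. (cmod (coef g k))\<^sup>2 * ball_moment \<alpha> \<rho> k) \<le> (\<Sum>k. (cmod (coef g k))\<^sup>2 * ball_moment \<alpha> \<rho> k)"
      by (rule sum_le_suminf[OF sums_summable[OF ps]]) (auto intro: mult_nonneg_nonneg ball_moment_nonneg)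
    then show ?thesis using sums_unique[OF ps] by simp
  qed
  then have "ennreal (ball_mass * (cmod (f u))\<^sup>2) \<le> ennreal (\<integral>z. (cmod (g z))\<^sup>2 * indicator (ball 0 \<rho>) z \<partial>M)"
    unfolding c0 ball_mass_def by (intro ennreal_leI) (simp add: mult.commute)
  also have "\<dots> = (\<integral>\<^sup>+v. ennreal ((cmod (g v))\<^sup>2 * indicator (ball 0 \<rho>) v) \<partial>M)"
    by (rule nn_integral_eq_integral[symmetric, OF parseval_ball(2)[OF alpha coef_sums[OF ga] rho]]) auto
  also have "\<dots> = (\<integral>\<^sup>+v. ennreal ((cmod (f (mob u v)))\<^sup>2) * indicator {..<\<rho>} (cmod (mob u (mob u v))) \<partial>M)"
    using mob_mob[OF u] by (intro nn_integral_cong) (auto simp: g_def on_disk_def indicator_def)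
  also have "\<dots> = (\<integral>\<^sup>+w. (ennreal ((cmod (f w))\<^sup>2) * indicator {..<\<rho>} (cmod (mob u w))) * ennreal (mob_jac \<alpha> u w) \<partial>M)"
    by (rule nn_integral_mob[OF alpha u]) measurable
  also have "\<dots> \<le> (\<integral>\<^sup>+w. ennreal ((4 / s u) powr p) * (ennreal ((cmod (f w))\<^sup>2) * indicator {..<\<rho>} (cmod (mob u w))) \<partial>M)"
  proof (rule nn_integral_mono)
    fix w assume "w \<in> space M"
    then have w: "cmod w < 1" by simp
    have su: "s u > 0" by (rule one_minus_cmod_square(1)[OF u])
    have "(s u / 2)\<^sup>2 \<le> (cmod (1 - cnj u * w))\<^sup>2" using mob_denom_ge[of u w] u w su by (intro power_mono) auto
    then have "s u / (cmod (1 - cnj u * w))\<^sup>2 \<le> s u / (s u / 2)\<^sup>2"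
      using su mob_denom_bound[of u w] u w by (intro divide_left_mono mult_pos_pos) auto
    also have "\<dots> = 4 / s u"
    proof -
      have "x / (x / 2)\<^sup>2 = 4 / x" if "x > 0" for x :: real using that by (simp add: power2_eq_square)
      then show ?thesis using su by blast
    qed
    finally have "mob_jac \<alpha> u w \<le> (4 / s u) powr p" unfolding mob_jac_eq using su p_pos by (intro powr_mono2) auto
    then show "(ennreal ((cmod (f w))\<^sup>2) * indicator {..<\<rho>} (cmod (mob u w))) * ennreal (mob_jac \<alpha> u w) \<le>
      ennreal ((4 / s u) powr p) * (ennreal ((cmod (f w))\<^sup>2) * indicator {..<\<rho>} (cmod (mob u w)))"
      by (subst mult.commute) (intro mult_right_mono ennreal_leI; simp)
  qed
  also have "\<dots> = ennreal ((4 / s u) powr p) * (\<integral>\<^sup>+w. ennreal ((cmod (f w))\<^sup>2) * indicator {..<\<rho>} (cmod (mob u w)) \<partial>M)"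
    by (rule nn_integral_cmult) measurable
  finally show ?thesis .
qed

end

context bergman_weight
begin

text \<open>The ratio of the \<open>k\<close>-th moment of a smaller disk to that of the unit disk decays geometrically in
  \<open>k\<close>, and only coefficients with \<open>k \<ge> n\<close> occur in the tail.\<close>

lemma tail_small_on_compact:
  assumes R: "0 < R" "R < 1" and e: "e > 0"
  obtains n where "\<And>f. f \<in> A2 \<Longrightarrow> nrm f \<le> 1 \<Longrightarrow>
    (\<integral>\<^sup>+z. ennreal ((cmod (tail n f z))\<^sup>2) * indicator (ball 0 R) z \<partial>M) \<le> ennreal e"
proof -
  define R' where "R' = (1 + R) / 2"
  have R': "R < R'" "R' < 1" "0 < R'" using R by (auto simp: R'_def)
  obtain m where m: "m > 0" "\<And>k. R' ^ (2 * k) * m \<le> \<gamma> k" using moment_lower[of R'] R' by auto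
  define q where "q = (R / R')\<^sup>2"
  have q: "0 < q" "q < 1" using R R' by (auto simp: q_def power_less_one_iff)
  \<comment> \<open>\<open>ball_moment \<alpha> R k \<le> R\<^sup>2\<^sup>k ball_moment \<alpha> R 0\<close> while \<open>\<gamma> k \<ge> R'\<^sup>2\<^sup>k m\<close>\<close>
  define A where "A = ball_moment \<alpha> R 0 / m"
  have A: "A \<ge> 0" using m by (simp add: A_def ball_moment_nonneg)
  have mb: "ball_moment \<alpha> R k \<le> A * q ^ k * \<gamma> k" for k
  proof -
    have "ball_moment \<alpha> R k \<le> (\<integral>z. R ^ (2 * k) * ((cmod z) ^ (2 * 0) * indicator (ball 0 R) z) \<partial>M)"
      unfolding ball_moment_def
      by (rule Bochner_Integration.integral_mono[OF power_indicator_integrable(2)[OF alpha]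
            integrable_mult_right[OF power_indicator_integrable(2)[OF alpha]]])
         (use R in \<open>auto intro!: power_mono simp: indicator_def\<close>)
    also have "\<dots> = R ^ (2 * k) * ball_moment \<alpha> R 0" unfolding ball_moment_def by simp
    also have "\<dots> = A * q ^ k * (R' ^ (2 * k) * m)"
      using m R' by (simp add: A_def q_def power_divide power_mult[symmetric])
    also have "\<dots> \<le> A * q ^ k * \<gamma> k" using A q m by (intro mult_left_mono) auto
    finally show ?thesis .
  qed
  have "(\<lambda>n. A * q ^ n) \<longlonglongrightarrow> A * 0" using q by (intro tendsto_mult tendsto_const LIMSEQ_realpow_zero) auto
  then have "\<forall>\<^sub>F n in sequentially. A * q ^ n < e" using e by (intro order_tendstoD(2)) auto
  then have "\<exists>n. A * q ^ n < e" by (rule eventually_happens'[OF sequentially_bot])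
  then obtain n where n: "A * q ^ n < e" ..
  have "(\<integral>\<^sup>+z. ennreal ((cmod (tail n f z))\<^sup>2) * indicator (ball 0 R) z \<partial>M) \<le> ennreal e"
    if f: "f \<in> A2" "nrm f \<le> 1" for f
  proof -
    let ?t = "tail n f"
    have tA: "?t \<in> A2" by (rule tail_A2[OF f(1)])
    then have ta: "?t \<in> disk_analytic" by (simp add: A2_iff)
    note ps = parseval_ball[OF alpha coef_sums[OF ta] R]
    have "(\<integral>z. (cmod (?t z))\<^sup>2 * indicator (ball 0 R) z \<partial>M) \<le> A * q ^ n * (nrm ?t)\<^sup>2"
    proof (rule sums_le[OF _ ps(1) sums_mult[OF parseval_A2[OF tA]]])
      fix k
      show "(cmod (coef ?t k))\<^sup>2 * ball_moment \<alpha> R k \<le> A * q ^ n * ((cmod (coef ?t k))\<^sup>2 * \<gamma> k)"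
      proof (cases "k < n")
        case False
        have "ball_moment \<alpha> R k \<le> A * q ^ k * \<gamma> k" by (rule mb)
        also have "\<dots> \<le> A * q ^ n * \<gamma> k"
          using False q A less_imp_le[OF moment_pos[of k]] by (intro mult_right_mono mult_left_mono power_decreasing) auto
        finally have "(cmod (coef ?t k))\<^sup>2 * ball_moment \<alpha> R k \<le> (cmod (coef ?t k))\<^sup>2 * (A * q ^ n * \<gamma> k)"
          by (intro mult_left_mono) auto
        then show ?thesis by (simp add: mult_ac)
      qed (simp add: coef_tail[OF f(1)])
    qed
    also have "\<dots> \<le> A * q ^ n * 1"
    proof (intro mult_left_mono)
      have "nrm ?t \<le> 1" using nrm_tail_le[OF f(1), of n] f(2) by linarith
      then show "(nrm ?t)\<^sup>2 \<le> 1" by (simp add: power_le_one)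
    qed (use A q in auto)
    also have "\<dots> \<le> e" using n by simp
    finally have le: "(\<integral>z. (cmod (?t z))\<^sup>2 * indicator (ball 0 R) z \<partial>M) \<le> e" .
    have "(\<integral>\<^sup>+z. ennreal ((cmod (?t z))\<^sup>2) * indicator (ball 0 R) z \<partial>M) = (\<integral>\<^sup>+z. ennreal ((cmod (?t z))\<^sup>2 * indicator (ball 0 R) z) \<partial>M)"
      by (simp add: ennreal_mult ennreal_indicator)
    also have "\<dots> = ennreal (\<integral>z. (cmod (?t z))\<^sup>2 * indicator (ball 0 R) z \<partial>M)"
      by (rule nn_integral_eq_integral[OF ps(2)]) auto
    also have "\<dots> \<le> ennreal e" using le by (rule ennreal_leI)
    finally show ?thesis .
  qed
  then show ?thesis using that by blast
qed

end

section \<open>Averages of the counting function\<close>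

locale composition_radius = bounded_composition \<alpha> \<phi> + bergman_radius \<alpha> r
  for \<alpha> :: real and \<phi> :: "complex \<Rightarrow> complex" and r :: real
begin

definition avg :: "complex \<Rightarrow> ennreal" where
  "avg z = (\<integral>\<^sup>+w\<in>bergman_disk z r. counting_fun \<phi> \<alpha> w \<partial>area) / emeasure M (bergman_disk z r)"

abbreviation to_boundary :: "complex filter" where
  "to_boundary \<equiv> filtercomap cmod (at_left 1)"

lemma D_A2: "f \<in> A2 \<Longrightarrow> D f \<in> A2"
  using bounded_D by (auto simp: bounded_op_def linear_op_def)

text \<open>The mass of \<open>\<mu>\<close> is \<open>\<parallel>D 1\<parallel>\<^sup>2\<close>.\<close>

lemma mu_disk_finite: "emeasure \<mu> disk < \<infinity>"
proof -
  have "emeasure \<mu> disk = (\<integral>\<^sup>+z. ennreal ((cmod (monomial 0 z))\<^sup>2) \<partial>\<mu>)"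
  proof -
    have "(\<integral>\<^sup>+z. ennreal ((cmod (monomial 0 z))\<^sup>2) \<partial>\<mu>) = (\<integral>\<^sup>+z. 1 \<partial>\<mu>)"
      by (intro nn_integral_cong) (simp add: monomial_def on_disk_def)
    then show ?thesis by simp
  qed
  also have "\<dots> = ennreal ((nrm (D (monomial 0)))\<^sup>2)" by (rule nn_integral_\<mu>[OF monomial_A2])
  finally show ?thesis by simp
qed

lemma sets_mu: "E \<in> sets borel \<Longrightarrow> E \<subseteq> disk \<Longrightarrow> E \<in> sets \<mu>"
  using in_sets_warea[of E \<alpha>] by simp

lemma measurable_mu [measurable (raw)]: "f \<in> borel_measurable borel \<Longrightarrow> f \<in> borel_measurable \<mu>"
  by (subst measurable_cong_sets[OF sets_counting_fun_measure refl]) (rule measurable_restrict_space1)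

lemma mu_eq_area:
  assumes "E \<in> sets borel" "E \<subseteq> disk"
  shows "emeasure \<mu> E = ennreal (1 + \<alpha>) * (\<integral>\<^sup>+w\<in>E. counting_fun \<phi> \<alpha> w \<partial>area)"
proof -
  note [measurable] = counting_fun_measurable[OF holo nonconst, of \<alpha>] assms(1)
  have "disk \<in> sets (borel :: complex measure)" by simp
  note [measurable] = this
  have "emeasure \<mu> E = (\<integral>\<^sup>+w. indicator E w \<partial>\<mu>)"
    by (rule nn_integral_indicator[OF sets_mu[OF assms], symmetric])
  also have "\<dots> = (\<integral>\<^sup>+w. ennreal ((1 + \<alpha>) / pi) * (indicator E w * counting_fun \<phi> \<alpha> w * indicator disk w) \<partial>lborel)"
    by (rule nn_integral_counting_fun_measure_area[OF alpha holo nonconst]) measurable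
  also have "\<dots> = (\<integral>\<^sup>+w. ennreal (1 + \<alpha>) * (ennreal (1 / pi) * (counting_fun \<phi> \<alpha> w * indicator E w) * indicator disk w) \<partial>lborel)"
  proof (rule nn_integral_cong)
    fix w :: complex
    have "ennreal ((1 + \<alpha>) / pi) = ennreal (1 + \<alpha>) * ennreal (1 / pi)"
      using alpha by (subst ennreal_mult[symmetric]) auto
    then show "ennreal ((1 + \<alpha>) / pi) * (indicator E w * counting_fun \<phi> \<alpha> w * indicator disk w) =
      ennreal (1 + \<alpha>) * (ennreal (1 / pi) * (counting_fun \<phi> \<alpha> w * indicator E w) * indicator disk w)"
      by (simp add: mult_ac)
  qed
  also have "\<dots> = ennreal (1 + \<alpha>) * (\<integral>\<^sup>+w. ennreal (1 / pi) * (counting_fun \<phi> \<alpha> w * indicator E w) * indicator disk w \<partial>lborel)"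
    by (rule nn_integral_cmult) measurable
  also have "(\<integral>\<^sup>+w. ennreal (1 / pi) * (counting_fun \<phi> \<alpha> w * indicator E w) * indicator disk w \<partial>lborel) =
    (\<integral>\<^sup>+w\<in>E. counting_fun \<phi> \<alpha> w \<partial>area)"
    by (rule nn_integral_area[symmetric]) measurable
  finally show ?thesis .
qed

lemma s_pos: "cmod z < 1 \<Longrightarrow> s z > 0" by (rule one_minus_cmod_square(1))

text \<open>Everything in the definition of the averages is finite, so the estimates can be carried out with
  real numbers.\<close>

lemma average_real:
  assumes z: "cmod z < 1"
  obtains x a where "0 \<le> x" "0 < a" "emeasure \<mu> (bergman_disk z r) = ennreal ((1 + \<alpha>) * x)"
    "emeasure M (bergman_disk z r) = ennreal a" "avg z = ennreal (x / a)"
    "ball_mass * (s z / 4) powr p \<le> a" "a \<le> ball_mass * (s z / (1 - \<rho>)\<^sup>2) powr p"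
proof -
  note b = bergman_disk_sets(1)[OF z] bergman_disk_sets(2)[of z]
  let ?X = "\<integral>\<^sup>+w\<in>bergman_disk z r. counting_fun \<phi> \<alpha> w \<partial>area"
  have "emeasure \<mu> (bergman_disk z r) \<le> emeasure \<mu> disk" using b sets_mu[of disk] by (intro emeasure_mono) auto
  then have "ennreal (1 + \<alpha>) * ?X < \<infinity>" using mu_disk_finite mu_eq_area[OF b] by (auto intro: le_less_trans)
  then have "?X < \<infinity>" using alpha by (auto simp: ennreal_mult_less_top)
  then obtain x where x: "0 \<le> x" "?X = ennreal x" by (cases ?X) auto
  note am = bergman_disk_measure[OF z]
  have "emeasure M (bergman_disk z r) < \<infinity>" using am(2) by (auto intro: le_less_trans)
  then obtain a where a: "0 \<le> a" "emeasure M (bergman_disk z r) = ennreal a"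
    by (cases "emeasure M (bergman_disk z r)") auto
  have "ball_mass * (s z / 4) powr p > 0" using s_pos[OF z] ball_mass_pos by simp
  moreover have lo: "ball_mass * (s z / 4) powr p \<le> a" using am(1) a by (simp add: ennreal_le_iff)
  ultimately have a0: "a > 0" by linarith
  have hi: "a \<le> ball_mass * (s z / (1 - \<rho>)\<^sup>2) powr p"
    using am(2) a ball_mass_pos by (simp add: ennreal_le_iff)
  have "avg z = ennreal (x / a)" unfolding avg_def x(2) a(2) using x(1) a0 by (simp add: divide_ennreal)
  moreover have "emeasure \<mu> (bergman_disk z r) = ennreal ((1 + \<alpha>) * x)"
    unfolding mu_eq_area[OF b] x(2) using alpha x(1) by (simp add: ennreal_mult)
  ultimately show ?thesis using that x(1) a0 a(2) lo hi by blast
qed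

section \<open>Lower bound\<close>

definition lower_const :: real where "lower_const = (4 / (1 - \<rho>)\<^sup>2) powr p / ((1 + \<alpha>) * ball_mass)"

lemma lower_const_pos: "lower_const > 0"
  unfolding lower_const_def using rho alpha ball_mass_pos by (intro divide_pos_pos mult_pos_pos) auto

text \<open>On \<open>bergman_disk z r\<close> the function \<open>|kern z|\<^sup>2\<close> is at least a constant times the reciprocal of the
  measure of that disk; integrate over the disk against \<open>\<mu>\<close>.\<close>

lemma avg_le_kern:
  assumes z: "cmod z < 1"
  shows "avg z \<le> ennreal (lower_const * (nrm (D (kern z)))\<^sup>2)"
proof -
  obtain x a where xa: "0 \<le> x" "0 < a" "emeasure \<mu> (bergman_disk z r) = ennreal ((1 + \<alpha>) * x)"
    "avg z = ennreal (x / a)" "ball_mass * (s z / 4) powr p \<le> a" using average_real[OF z] by metis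
  have sz: "s z > 0" by (rule s_pos[OF z])
  define k where "k = ((1 - \<rho>)\<^sup>2 / s z) powr p"
  have k0: "k > 0" using sz rho by (simp add: k_def)
  note b = bergman_disk_sets(1)[OF z] bergman_disk_sets(2)[of z]
  have "ennreal k * emeasure \<mu> (bergman_disk z r) = (\<integral>\<^sup>+w. ennreal k * indicator (bergman_disk z r) w \<partial>\<mu>)"
    using sets_mu[OF b] by (simp add: nn_integral_cmult_indicator)
  also have "\<dots> \<le> (\<integral>\<^sup>+w. ennreal ((cmod (kern z w))\<^sup>2) \<partial>\<mu>)"
  proof (rule nn_integral_mono)
    fix w
    show "ennreal k * indicator (bergman_disk z r) w \<le> ennreal ((cmod (kern z w))\<^sup>2)"
    proof (cases "w \<in> bergman_disk z r")
      case True
      then have w: "cmod w < 1" "cmod (mob z w) < \<rho>" by (auto simp: bergman_disk_eq[OF z] \<rho>_def)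
      have nz: "1 - cnj z * w \<noteq> 0" using mob_denom_bound[of z w] z w by auto
      have "(cmod (1 - cnj z * w))\<^sup>2 \<le> (s z / (1 - \<rho>))\<^sup>2"
        using near_comparisons(1)[OF z w rho(2)] by (intro power_mono) auto
      then have "s z / (s z / (1 - \<rho>))\<^sup>2 \<le> s z / (cmod (1 - cnj z * w))\<^sup>2"
        using sz nz rho by (intro divide_left_mono mult_pos_pos) auto
      moreover have "y / (y / t)\<^sup>2 = t\<^sup>2 / y" if "y > 0" "t > 0" for y t :: real
        using that by (simp add: power2_eq_square)
      then have "s z / (s z / (1 - \<rho>))\<^sup>2 = (1 - \<rho>)\<^sup>2 / s z" using sz rho by simp
      ultimately have "k \<le> mob_jac \<alpha> z w" unfolding k_def mob_jac_eq using sz rho p_pos by (intro powr_mono2) auto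
      then show ?thesis using True kern_cmod(2)[OF z w(1)] by (simp add: ennreal_leI)
    qed simp
  qed
  also have "\<dots> = ennreal ((nrm (D (kern z)))\<^sup>2)" by (rule nn_integral_\<mu>[OF kern_A2(1)[OF z]])
  finally have "ennreal (k * ((1 + \<alpha>) * x)) \<le> ennreal ((nrm (D (kern z)))\<^sup>2)"
    using k0 xa alpha by (simp add: ennreal_mult)
  then have kx: "k * ((1 + \<alpha>) * x) \<le> (nrm (D (kern z)))\<^sup>2" by (simp add: ennreal_le_iff)
  have "x / a \<le> x / (ball_mass * (s z / 4) powr p)"
    using xa sz ball_mass_pos by (intro divide_left_mono mult_pos_pos) auto
  also have "\<dots> = lower_const * (k * ((1 + \<alpha>) * x))"
  proof -
    have e: "(4 / (1 - \<rho>)\<^sup>2) powr p * k = 1 / (s z / 4) powr p"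
    proof -
      have "(4 / (1 - \<rho>)\<^sup>2) powr p * k = (4 / (1 - \<rho>)\<^sup>2 * ((1 - \<rho>)\<^sup>2 / s z)) powr p"
        unfolding k_def using sz rho by (intro powr_mult[symmetric])
      also have "4 / (1 - \<rho>)\<^sup>2 * ((1 - \<rho>)\<^sup>2 / s z) = 1 / (s z / 4)" using rho by simp
      also have "(1 / (s z / 4)) powr p = 1 / (s z / 4) powr p" using sz by (simp add: powr_divide)
      finally show ?thesis .
    qed
    have "lower_const * (k * ((1 + \<alpha>) * x)) = ((4 / (1 - \<rho>)\<^sup>2) powr p * k) * x / ball_mass"
      using alpha ball_mass_pos by (simp add: lower_const_def)
    then show ?thesis unfolding e by simp
  qed
  also have "\<dots> \<le> lower_const * (nrm (D (kern z)))\<^sup>2" using kx lower_const_pos by (intro mult_left_mono) auto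
  finally show ?thesis unfolding xa(4) by (rule ennreal_leI)
qed

lemma eventually_disk: "\<forall>\<^sub>F z in to_boundary. cmod z < 1"
  unfolding eventually_filtercomap
  by (intro exI[of _ "\<lambda>x. x < 1"]) (auto simp: eventually_at_left_field intro: exI[of _ 0])

lemma s_tendsto: "((\<lambda>z. s z powr p) \<longlongrightarrow> 0) to_boundary"
proof -
  have "((\<lambda>x::real. 1 - x\<^sup>2) \<longlongrightarrow> 1 - 1\<^sup>2) (at_left 1)" by (intro tendsto_intros)
  then have l: "((\<lambda>x::real. 1 - x\<^sup>2) \<longlongrightarrow> 0) (at_left 1)" by simp
  have "\<forall>\<^sub>F x in at_left (1::real). 0 \<le> 1 - x\<^sup>2"
    unfolding eventually_at_left_field
    by (intro exI[of _ 0]) (auto simp: power_le_one)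
  then have "((\<lambda>x::real. (1 - x\<^sup>2) powr p) \<longlongrightarrow> 0) (at_left 1)"
    using l p_pos by (intro tendsto_zero_powrI[OF l tendsto_const]) auto
  from filterlim_compose[OF this filterlim_filtercomap[of cmod "at_left 1"]] show ?thesis .
qed

text \<open>\<open>D (kern z)\<close> is the sum of \<open>D (tail n (kern z))\<close>, controlled by the essential norm for suitable \<open>n\<close>, and of
  \<open>D (tay n (kern z))\<close>, which tends to zero as \<open>|z| \<rightarrow> 1\<close> by \<open>kern_tay\<close>.\<close>

lemma limsup_le_ess:
  "Limsup to_boundary avg \<le> ennreal (lower_const * \<gamma> 0 * (ess_norm B B D)\<^sup>2)"
proof -
  define E where "E = ess_norm B B D"
  note nb = normed_fs_bergman
  have step: "Limsup to_boundary avg \<le> ennreal (lower_const * ((E + e) * sqrt (\<gamma> 0) + e)\<^sup>2)" if e: "e > 0" for e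
  proof (rule Limsup_bounded)
    obtain n where n: "\<And>f. f \<in> A2 \<Longrightarrow> nrm f \<le> 1 \<Longrightarrow> nrm (D (tail n f)) \<le> E + e"
      using tail_le_ess_norm[OF bounded_D e] unfolding E_def by blast
    have b: "bounded_op B B (\<lambda>f. D (tail n f))" by (rule bounded_op_comp[OF tail_bounded bounded_D nb nb nb])
    then have l: "linear_op B B (\<lambda>f. D (tail n f))" by (simp add: bounded_op_def)
    have nn: "nrm (D (tail n f)) \<le> (E + e) * nrm f" if "f \<in> A2" for f
      using unit_ball_bound[OF nb nb l _ that, of "E + e"] n by (simp add: vnorm_bergman)
    obtain Cn where Cn: "Cn \<ge> 0" "\<And>z. cmod z < 1 \<Longrightarrow> (nrm (tay n (kern z)))\<^sup>2 \<le> Cn * s z powr p"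
      using kern_tay[of n] by auto
    define d where "d = op_norm B B D"
    have d0: "d \<ge> 0" unfolding d_def by (rule op_norm_nonneg[OF nb nb bounded_D])
    have dn: "nrm (D f) \<le> d * nrm f" if "f \<in> A2" for f
      using op_norm_bound[OF nb nb bounded_D that] by (simp add: vnorm_bergman d_def)
    have "((\<lambda>z. d * sqrt (Cn * s z powr p)) \<longlongrightarrow> d * sqrt (Cn * 0)) to_boundary"
      by (intro tendsto_intros s_tendsto)
    then have "\<forall>\<^sub>F z in to_boundary. d * sqrt (Cn * s z powr p) < e" using e by (intro order_tendstoD(2)) auto
    then show "\<forall>\<^sub>F z in to_boundary. avg z \<le> ennreal (lower_const * ((E + e) * sqrt (\<gamma> 0) + e)\<^sup>2)"
      using eventually_disk
    proof eventually_elim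
      case (elim z)
      then have z: "cmod z < 1" by simp
      let ?k = "kern z"
      have kA: "?k \<in> A2" and kn: "nrm ?k = sqrt (\<gamma> 0)"
        using kern_A2[OF z] by (auto simp: real_sqrt_unique)
      have "D (tail n ?k) = (\<lambda>z. D ?k z - D (tay n ?k) z)"
        unfolding tail_def using bounded_D unfolding bounded_op_def by (blast intro: linear_op_diff kA tay_A2)
      then have "D ?k = (\<lambda>z. D (tail n ?k) z + D (tay n ?k) z)" by (simp add: fun_eq_iff)
      then have "nrm (D ?k) \<le> nrm (D (tail n ?k)) + nrm (D (tay n ?k))"
        using normed_fs_add_le[OF nb D_A2[OF tail_A2[OF kA]] D_A2[OF tay_A2], of n n ?k] by (simp add: vnorm_bergman)
      also have "nrm (D (tail n ?k)) \<le> (E + e) * sqrt (\<gamma> 0)" using nn[OF kA] kn by simp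
      also have "nrm (D (tay n ?k)) \<le> d * nrm (tay n ?k)" by (rule dn[OF tay_A2])
      also have "d * nrm (tay n ?k) \<le> d * sqrt (Cn * s z powr p)"
        using Cn(2)[OF z] d0 by (intro mult_left_mono real_le_rsqrt) auto
      also have "\<dots> \<le> e" using elim by simp
      finally have "nrm (D ?k) \<le> (E + e) * sqrt (\<gamma> 0) + e" by simp
      then have "(nrm (D ?k))\<^sup>2 \<le> ((E + e) * sqrt (\<gamma> 0) + e)\<^sup>2" by (intro power_mono) auto
      then have "lower_const * (nrm (D ?k))\<^sup>2 \<le> lower_const * ((E + e) * sqrt (\<gamma> 0) + e)\<^sup>2"
        using lower_const_pos by (intro mult_left_mono) auto
      then show ?case using avg_le_kern[OF z] by (meson ennreal_leI order_trans)
    qed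
  qed
  let ?e = "\<lambda>n. inverse (real (Suc n))"
  have "(\<lambda>n. lower_const * ((E + ?e n) * sqrt (\<gamma> 0) + ?e n)\<^sup>2) \<longlonglongrightarrow> lower_const * ((E + 0) * sqrt (\<gamma> 0) + 0)\<^sup>2"
    by (intro tendsto_intros LIMSEQ_inverse_real_of_nat)
  then have "(\<lambda>n. ennreal (lower_const * ((E + ?e n) * sqrt (\<gamma> 0) + ?e n)\<^sup>2)) \<longlonglongrightarrow> ennreal (lower_const * ((E + 0) * sqrt (\<gamma> 0) + 0)\<^sup>2)"
    by (rule tendsto_ennrealI)
  then have "Limsup to_boundary avg \<le> ennreal (lower_const * ((E + 0) * sqrt (\<gamma> 0) + 0)\<^sup>2)"
    by (rule LIMSEQ_le_const) (use step in \<open>auto simp del: of_nat_Suc\<close>)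
  also have "lower_const * ((E + 0) * sqrt (\<gamma> 0) + 0)\<^sup>2 = lower_const * \<gamma> 0 * E\<^sup>2"
    using less_imp_le[OF moment_pos[of 0]] by (simp add: power_mult_distrib)
  finally show ?thesis unfolding E_def .
qed

section \<open>Upper bound\<close>

definition fubini_const :: real where "fubini_const = (16 / (1 - \<rho>\<^sup>2)) powr p / ball_mass"

lemma fubini_const_pos: "fubini_const > 0"
  unfolding fubini_const_def using rho_square ball_mass_pos by (intro divide_pos_pos) auto

text \<open>Integrate the submean value inequality against \<open>\<mu>\<close> and exchange the integrals. The relation
  \<open>|mob u w| < \<rho>\<close> is symmetric, and under it \<open>1 - |u|\<^sup>2\<close> is bounded below by a multiple of \<open>1 - |w|\<^sup>2\<close>.\<close>

lemma averaged_embedding: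
  assumes f: "f \<in> A2"
  shows "(\<integral>\<^sup>+u. ennreal ((cmod (f u))\<^sup>2) \<partial>\<mu>) \<le>
    (\<integral>\<^sup>+w. ennreal ((cmod (f w))\<^sup>2) * (ennreal (fubini_const * (1 / s w) powr p) * emeasure \<mu> (bergman_disk w r)) \<partial>M)"
proof -
  have fb [measurable]: "f \<in> borel_measurable borel" using f by (intro disk_analytic_borel) (simp add: A2_iff)
  interpret M: finite_measure M by (rule finite_measure_warea[OF alpha])
  interpret \<mu>: finite_measure \<mu> using mu_disk_finite by (intro finite_measureI) (auto simp: top.not_eq_extremum)
  interpret P: pair_sigma_finite M \<mu> ..
  have idM [measurable]: "(\<lambda>x. x) \<in> borel_measurable M" by (rule measurable_warea) simp
  have idmu [measurable]: "(\<lambda>x. x) \<in> borel_measurable \<mu>" by (rule measurable_mu) simp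
  let ?I = "\<lambda>u w. indicator {..<\<rho>} (cmod (mob u w)) :: ennreal"
  let ?h = "\<lambda>u. ennreal ((4 / s u) powr p / ball_mass)"
  let ?H = "\<lambda>w u. ?h u * (ennreal ((cmod (f w))\<^sup>2) * ?I u w)"
  have mobm: "(\<lambda>x. mob (snd x) (fst x)) \<in> borel_measurable (M \<Otimes>\<^sub>M \<mu>)"
    unfolding mob_def by measurable
  have Hm: "(\<lambda>(w, u). ?H w u) \<in> borel_measurable (M \<Otimes>\<^sub>M \<mu>)"
    unfolding case_prod_beta using mobm by measurable
  have "(\<integral>\<^sup>+u. ennreal ((cmod (f u))\<^sup>2) \<partial>\<mu>) \<le> (\<integral>\<^sup>+u. (\<integral>\<^sup>+w. ?H w u \<partial>M) \<partial>\<mu>)"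
  proof (rule nn_integral_mono)
    fix u assume "u \<in> space \<mu>"
    then have u: "cmod u < 1" by simp
    let ?X = "\<integral>\<^sup>+w. ennreal ((cmod (f w))\<^sup>2) * ?I u w \<partial>M"
    have "ennreal ((cmod (f u))\<^sup>2) = ennreal (1 / ball_mass) * ennreal (ball_mass * (cmod (f u))\<^sup>2)"
      using ball_mass_pos by (subst ennreal_mult[symmetric]) auto
    also have "\<dots> \<le> ennreal (1 / ball_mass) * (ennreal ((4 / s u) powr p) * ?X)"
      by (intro mult_left_mono submean[OF f u]) auto
    also have "\<dots> = ?h u * ?X"
      using ball_mass_pos by (simp add: mult.assoc[symmetric] ennreal_mult[symmetric])
    also have "\<dots> = (\<integral>\<^sup>+w. ?H w u \<partial>M)" by (rule nn_integral_cmult[symmetric]) measurable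
    finally show "ennreal ((cmod (f u))\<^sup>2) \<le> (\<integral>\<^sup>+w. ?H w u \<partial>M)" .
  qed
  also have "\<dots> = (\<integral>\<^sup>+w. (\<integral>\<^sup>+u. ?H w u \<partial>\<mu>) \<partial>M)" by (rule P.Fubini'[OF Hm])
  also have "\<dots> \<le> (\<integral>\<^sup>+w. ennreal ((cmod (f w))\<^sup>2) * (ennreal (fubini_const * (1 / s w) powr p) * emeasure \<mu> (bergman_disk w r)) \<partial>M)"
  proof (rule nn_integral_mono)
    fix w assume "w \<in> space M"
    then have w: "cmod w < 1" by simp
    note b = sets_mu[OF bergman_disk_sets(1)[OF w] bergman_disk_sets(2)]
    have "(\<integral>\<^sup>+u. ?H w u \<partial>\<mu>) \<le> (\<integral>\<^sup>+u. (ennreal ((cmod (f w))\<^sup>2) * ennreal (fubini_const * (1 / s w) powr p)) * indicator (bergman_disk w r) u \<partial>\<mu>)"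
    proof (rule nn_integral_mono)
      fix u assume "u \<in> space \<mu>"
      then have u: "cmod u < 1" by simp
      show "?H w u \<le> (ennreal ((cmod (f w))\<^sup>2) * ennreal (fubini_const * (1 / s w) powr p)) * indicator (bergman_disk w r) u"
      proof (cases "cmod (mob u w) < \<rho>")
        case True
        then have wu: "cmod (mob w u) < \<rho>" by (simp add: mob_cmod_sym[of w u])
        then have "u \<in> bergman_disk w r" using u by (simp add: bergman_disk_eq[OF w] \<rho>_def)
        moreover have "(4 / s u) powr p / ball_mass \<le> fubini_const * (1 / s w) powr p"
        proof -
          have q: "1 - \<rho>\<^sup>2 > 0" using rho by (simp add: abs_square_less_1)
          have "4 / s u \<le> 4 / (s w * (1 - \<rho>\<^sup>2) / 4)"
            using near_comparisons(2)[OF w u wu rho(2)] s_pos[OF w] s_pos[OF u] q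
            by (intro divide_left_mono mult_pos_pos) auto
          also have "\<dots> = 16 / (1 - \<rho>\<^sup>2) * (1 / s w)" by simp
          finally have "(4 / s u) powr p \<le> (16 / (1 - \<rho>\<^sup>2) * (1 / s w)) powr p"
            using s_pos[OF u] p_pos by (intro powr_mono2) auto
          also have "\<dots> = (16 / (1 - \<rho>\<^sup>2)) powr p * (1 / s w) powr p"
            by (rule powr_mult)
          finally show ?thesis using ball_mass_pos by (simp add: fubini_const_def field_simps)
        qed
        ultimately show ?thesis using True
          by (simp add: mult.commute[of "ennreal ((cmod (f w))\<^sup>2)"] mult_right_mono ennreal_leI)
      qed simp
    qed
    also have "\<dots> = ennreal ((cmod (f w))\<^sup>2) * (ennreal (fubini_const * (1 / s w) powr p) * emeasure \<mu> (bergman_disk w r))"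
      unfolding nn_integral_cmult_indicator[OF b] by (simp add: mult.assoc)
    finally show "(\<integral>\<^sup>+u. ?H w u \<partial>\<mu>) \<le> \<dots>" .
  qed
  finally show ?thesis .
qed

definition upper_const :: real where "upper_const = fubini_const * ((1 + \<alpha>) * ball_mass * (1 / (1 - \<rho>)\<^sup>2) powr p)"

lemma upper_const_pos: "upper_const > 0"
  unfolding upper_const_def using fubini_const_pos alpha ball_mass_pos rho by (intro mult_pos_pos) auto

lemma weight_le_avg:
  assumes z: "cmod z < 1"
  shows "ennreal (fubini_const * (1 / s z) powr p) * emeasure \<mu> (bergman_disk z r) \<le> ennreal upper_const * avg z"
proof -
  obtain x a where xa: "0 \<le> x" "0 < a" "emeasure \<mu> (bergman_disk z r) = ennreal ((1 + \<alpha>) * x)"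
    "avg z = ennreal (x / a)" "a \<le> ball_mass * (s z / (1 - \<rho>)\<^sup>2) powr p" using average_real[OF z] by metis
  have sz: "s z > 0" by (rule s_pos[OF z])
  have "x = a * (x / a)" using xa by simp
  also have "\<dots> \<le> (ball_mass * (s z / (1 - \<rho>)\<^sup>2) powr p) * (x / a)" using xa by (intro mult_right_mono) auto
  finally have "fubini_const * (1 / s z) powr p * ((1 + \<alpha>) * x) \<le> fubini_const * (1 / s z) powr p * ((1 + \<alpha>) * ((ball_mass * (s z / (1 - \<rho>)\<^sup>2) powr p) * (x / a)))"
    using fubini_const_pos alpha by (intro mult_left_mono) auto
  also have "\<dots> = fubini_const * ((1 + \<alpha>) * ball_mass * ((1 / s z) powr p * (s z / (1 - \<rho>)\<^sup>2) powr p)) * (x / a)"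
    by (simp only: mult_ac)
  also have "(1 / s z) powr p * (s z / (1 - \<rho>)\<^sup>2) powr p = (1 / s z * (s z / (1 - \<rho>)\<^sup>2)) powr p"
    using sz by (intro powr_mult[symmetric])
  also have "1 / s z * (s z / (1 - \<rho>)\<^sup>2) = 1 / (1 - \<rho>)\<^sup>2" using sz by simp
  finally have "fubini_const * (1 / s z) powr p * ((1 + \<alpha>) * x) \<le> upper_const * (x / a)" by (simp add: upper_const_def)
  then have "ennreal (fubini_const * (1 / s z) powr p * ((1 + \<alpha>) * x)) \<le> ennreal (upper_const * (x / a))" by (rule ennreal_leI)
  also have "ennreal (upper_const * (x / a)) = ennreal upper_const * ennreal (x / a)"
    using upper_const_pos xa by (intro ennreal_mult) auto
  also have "ennreal (fubini_const * (1 / s z) powr p * ((1 + \<alpha>) * x)) = ennreal (fubini_const * (1 / s z) powr p) * ennreal ((1 + \<alpha>) * x)"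
    using fubini_const_pos xa alpha by (intro ennreal_mult) auto
  finally show ?thesis unfolding xa(3,4) .
qed

text \<open>Outside a disk of radius \<open>R\<close> the averages are at most slightly larger than their upper limit; inside it
  the weight in \<open>averaged_embedding\<close> is bounded and \<open>tail_small_on_compact\<close> applies.\<close>

lemma ess_le_limsup:
  "ennreal ((ess_norm B B D)\<^sup>2) \<le> ennreal upper_const * Limsup to_boundary avg"
proof (cases "Limsup to_boundary avg")
  case top
  then show ?thesis using upper_const_pos by (simp add: ennreal_mult_top)
next
  case (real L)
  note nb = normed_fs_bergman
  define E where "E = ess_norm B B D"
  have E0: "E \<ge> 0" unfolding E_def by (rule ess_norm_nonneg[OF nb nb bounded_D])
  have step: "E\<^sup>2 \<le> upper_const * (L + e) + e" if e: "e > 0" for e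
  proof -
    have "Limsup to_boundary avg < ennreal (L + e)" unfolding real(2) using real(1) e by (simp add: ennreal_less_iff)
    then have "\<forall>\<^sub>F z in to_boundary. avg z < ennreal (L + e)" by (rule Limsup_lessD)
    then obtain Q where Q: "eventually Q (at_left (1::real))" "\<And>z. Q (cmod z) \<Longrightarrow> avg z < ennreal (L + e)"
      unfolding eventually_filtercomap by blast
    then obtain b where b: "b < 1" "\<And>y. b < y \<Longrightarrow> y < 1 \<Longrightarrow> Q y"
      unfolding eventually_at_left_field by blast
    define R where "R = (1 + max b 0) / 2"
    have R: "0 < R" "R < 1" "b < R" using b(1) by (auto simp: R_def)
    have av: "avg z \<le> ennreal (L + e)" if "R \<le> cmod z" "cmod z < 1" for z
      using Q(2)[OF b(2)] that R by (simp add: less_imp_le)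
    obtain m where m: "0 \<le> m" "emeasure \<mu> disk = ennreal m"
      using mu_disk_finite by (cases "emeasure \<mu> disk") auto
    define K where "K = fubini_const * (1 / (1 - R\<^sup>2)) powr p * m"
    have K0: "K \<ge> 0" using fubini_const_pos m by (simp add: K_def)
    \<comment> \<open>the weight is at most \<open>K\<close> on the disk of radius \<open>R\<close>, so \<open>K * e' \<le> e\<close> is the error allowed there\<close>
    define e' where "e' = e / (K + 1)"
    have e': "e' > 0" "K * e' \<le> e" using e K0 by (auto simp: e'_def field_simps)
    obtain n where n: "\<And>f. f \<in> A2 \<Longrightarrow> nrm f \<le> 1 \<Longrightarrow>
      (\<integral>\<^sup>+z. ennreal ((cmod (tail n f z))\<^sup>2) * indicator (ball 0 R) z \<partial>M) \<le> ennreal e'"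
      using tail_small_on_compact[OF R(1,2) e'(1)] by blast
    have wt: "ennreal (fubini_const * (1 / s w) powr p) * emeasure \<mu> (bergman_disk w r) \<le>
      ennreal (upper_const * (L + e)) + ennreal K * indicator (ball 0 R) w" if w: "cmod w < 1" for w
    proof (cases "cmod w < R")
      case True
      have "(cmod w)\<^sup>2 \<le> R\<^sup>2" using True by (intro power_mono) auto
      moreover have "R\<^sup>2 < 1" using R by (simp add: abs_square_less_1)
      ultimately have "1 / s w \<le> 1 / (1 - R\<^sup>2)" using s_pos[OF w] by (intro divide_left_mono mult_pos_pos) auto
      then have "(1 / s w) powr p \<le> (1 / (1 - R\<^sup>2)) powr p" using s_pos[OF w] p_pos by (intro powr_mono2) auto
      then have "fubini_const * (1 / s w) powr p \<le> fubini_const * (1 / (1 - R\<^sup>2)) powr p" using fubini_const_pos by (intro mult_left_mono) auto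
      moreover have "emeasure \<mu> (bergman_disk w r) \<le> ennreal m"
        unfolding m(2)[symmetric] using bergman_disk_sets(2)[of w] sets_mu[of disk] by (intro emeasure_mono) auto
      ultimately have "ennreal (fubini_const * (1 / s w) powr p) * emeasure \<mu> (bergman_disk w r) \<le> ennreal (fubini_const * (1 / (1 - R\<^sup>2)) powr p) * ennreal m"
        by (intro mult_mono) (auto intro: ennreal_leI)
      also have "\<dots> = ennreal K" unfolding K_def using fubini_const_pos m by (intro ennreal_mult[symmetric]) auto
      finally show ?thesis using True by (simp add: add_increasing)
    next
      case False
      have "ennreal (fubini_const * (1 / s w) powr p) * emeasure \<mu> (bergman_disk w r) \<le> ennreal upper_const * avg w" by (rule weight_le_avg[OF w])
      also have "\<dots> \<le> ennreal upper_const * ennreal (L + e)" using av[of w] False w by (intro mult_left_mono) auto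
      also have "\<dots> = ennreal (upper_const * (L + e))" using upper_const_pos real(1) e by (intro ennreal_mult[symmetric]) auto
      finally show ?thesis by (simp add: add_increasing2)
    qed
    have c0: "upper_const * (L + e) \<ge> 0" using upper_const_pos real(1) e by simp
    have "E \<le> sqrt (upper_const * (L + e) + e)"
      unfolding E_def
    proof (rule ess_norm_le_tail[OF bounded_D, of n])
      fix g assume g: "g \<in> A2" "nrm g \<le> 1"
      let ?t = "tail n g"
      have tA: "?t \<in> A2" by (rule tail_A2[OF g(1)])
      have tb [measurable]: "?t \<in> borel_measurable borel" using tA by (intro disk_analytic_borel) (simp add: A2_iff)
      have [measurable]: "ball 0 R \<in> sets (borel :: complex measure)" by simp
      have t1: "nrm ?t \<le> 1" using nrm_tail_le[OF g(1), of n] g(2) by linarith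
      have "ennreal ((nrm (D ?t))\<^sup>2) = (\<integral>\<^sup>+u. ennreal ((cmod (?t u))\<^sup>2) \<partial>\<mu>)" by (rule nn_integral_\<mu>[OF tA, symmetric])
      also have "\<dots> \<le> (\<integral>\<^sup>+w. ennreal ((cmod (?t w))\<^sup>2) * (ennreal (fubini_const * (1 / s w) powr p) * emeasure \<mu> (bergman_disk w r)) \<partial>M)"
        by (rule averaged_embedding[OF tA])
      also have "\<dots> \<le> (\<integral>\<^sup>+w. ennreal (upper_const * (L + e)) * ennreal ((cmod (?t w))\<^sup>2) + ennreal K * (ennreal ((cmod (?t w))\<^sup>2) * indicator (ball 0 R) w) \<partial>M)"
      proof (rule nn_integral_mono)
        fix w assume "w \<in> space M"
        then have "ennreal ((cmod (?t w))\<^sup>2) * (ennreal (fubini_const * (1 / s w) powr p) * emeasure \<mu> (bergman_disk w r)) \<le>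
          ennreal ((cmod (?t w))\<^sup>2) * (ennreal (upper_const * (L + e)) + ennreal K * indicator (ball 0 R) w)"
          by (intro mult_left_mono wt) auto
        also have "\<dots> = ennreal (upper_const * (L + e)) * ennreal ((cmod (?t w))\<^sup>2) + ennreal K * (ennreal ((cmod (?t w))\<^sup>2) * indicator (ball 0 R) w)"
          by (simp only: distrib_left mult_ac)
        finally show "ennreal ((cmod (?t w))\<^sup>2) * (ennreal (fubini_const * (1 / s w) powr p) * emeasure \<mu> (bergman_disk w r)) \<le> \<dots>" .
      qed
      also have "\<dots> = ennreal (upper_const * (L + e)) * (\<integral>\<^sup>+w. ennreal ((cmod (?t w))\<^sup>2) \<partial>M) +
        ennreal K * (\<integral>\<^sup>+w. ennreal ((cmod (?t w))\<^sup>2) * indicator (ball 0 R) w \<partial>M)"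
        by (subst nn_integral_add) (auto simp: nn_integral_cmult)
      also have "\<dots> \<le> ennreal (upper_const * (L + e)) * ennreal 1 + ennreal K * ennreal e'"
      proof (intro add_mono mult_left_mono)
        have "ennreal ((nrm ?t)\<^sup>2) \<le> ennreal 1" using t1 by (intro ennreal_leI) (simp add: power_le_one)
        then show "(\<integral>\<^sup>+w. ennreal ((cmod (?t w))\<^sup>2) \<partial>M) \<le> ennreal 1" using l2norm_ennreal[OF A2_l2[OF tA]] by simp
        show "(\<integral>\<^sup>+w. ennreal ((cmod (?t w))\<^sup>2) * indicator (ball 0 R) w \<partial>M) \<le> ennreal e'" by (rule n[OF g])
      qed auto
      also have "\<dots> = ennreal (upper_const * (L + e) + K * e')"
        using c0 K0 e'(1) by (simp add: ennreal_mult ennreal_plus)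
      also have "\<dots> \<le> ennreal (upper_const * (L + e) + e)" using e'(2) by (intro ennreal_leI) simp
      finally have "(nrm (D ?t))\<^sup>2 \<le> upper_const * (L + e) + e"
        by (subst (asm) ennreal_le_iff) (use c0 e in auto)
      then show "nrm (D ?t) \<le> sqrt (upper_const * (L + e) + e)" by (rule real_le_rsqrt)
    qed
    then have "E\<^sup>2 \<le> (sqrt (upper_const * (L + e) + e))\<^sup>2" using E0 by (intro power_mono)
    then show ?thesis using c0 e by simp
  qed
  let ?e = "\<lambda>n. inverse (real (Suc n))"
  have "(\<lambda>n. upper_const * (L + ?e n) + ?e n) \<longlonglongrightarrow> upper_const * (L + 0) + 0"
    by (intro tendsto_intros LIMSEQ_inverse_real_of_nat)
  then have "E\<^sup>2 \<le> upper_const * (L + 0) + 0"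
    by (rule LIMSEQ_le_const) (use step in \<open>auto simp del: of_nat_Suc\<close>)
  then have "ennreal (E\<^sup>2) \<le> ennreal (upper_const * L)" by (intro ennreal_leI) simp
  then show ?thesis unfolding real(2) E_def using upper_const_pos real(1) by (simp add: ennreal_mult)
qed

end

theorem theorem3p5:
  fixes \<alpha> r :: real
  assumes "\<alpha> > -1" and "r > 0"
  shows "\<exists>c>0. \<exists>C>0. \<forall>\<phi> :: complex \<Rightarrow> complex.
    \<phi> holomorphic_on disk \<and> \<phi> ` disk \<subseteq> disk \<and> \<not> \<phi> constant_on disk \<and>
    bounded_op (dirichlet \<alpha>) (dirichlet \<alpha>) (comp_op \<phi>) \<longrightarrow>
      (ess_norm (dirichlet \<alpha>) (dirichlet \<alpha>) (comp_op \<phi>))\<^sup>2 =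
        (ess_norm (dirichlet0 \<alpha>) (dirichlet0 \<alpha>) (comp_op0 \<phi>))\<^sup>2 \<and>
      (ess_norm (dirichlet0 \<alpha>) (dirichlet0 \<alpha>) (comp_op0 \<phi>))\<^sup>2 =
        (ess_norm (bergman \<alpha>) (bergman \<alpha>) (deriv_comp_op \<phi>))\<^sup>2 \<and>
      (ess_norm (bergman \<alpha>) (bergman \<alpha>) (deriv_comp_op \<phi>))\<^sup>2 =
        ess_norm (bergman \<alpha>) (bergman \<alpha>) (toeplitz \<alpha> (counting_fun_measure \<phi> \<alpha>)) \<and>
      ennreal c * limsup_average \<phi> \<alpha> r
        \<le> ennreal (ess_norm (bergman \<alpha>) (bergman \<alpha>) (toeplitz \<alpha> (counting_fun_measure \<phi> \<alpha>))) \<and>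
      ennreal (ess_norm (bergman \<alpha>) (bergman \<alpha>) (toeplitz \<alpha> (counting_fun_measure \<phi> \<alpha>)))
        \<le> ennreal C * limsup_average \<phi> \<alpha> r"
proof -
  \<comment> \<open>the constants are formed before a symbol \<open>\<phi>\<close> is fixed, so they depend on \<open>\<alpha>\<close> and \<open>r\<close> alone\<close>
  interpret W: bergman_radius \<alpha> r using assms by unfold_locales
  define k where "k = (4 / (1 - W.\<rho>)\<^sup>2) powr W.p / ((1 + \<alpha>) * W.ball_mass) * moment \<alpha> 0"
  define C where "C = (16 / (1 - W.\<rho>\<^sup>2)) powr W.p / W.ball_mass * ((1 + \<alpha>) * W.ball_mass * (1 / (1 - W.\<rho>)\<^sup>2) powr W.p)"
  have k: "k > 0"
    unfolding k_def using W.rho assms W.ball_mass_pos W.moment_pos by (intro divide_pos_pos mult_pos_pos) auto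
  have C: "C > 0"
    unfolding C_def using W.rho W.rho_square assms W.ball_mass_pos by (intro divide_pos_pos mult_pos_pos) auto
  have k': "1 / k > 0" using k by simp
  show ?thesis
  proof (rule exI[of _ "1 / k"], rule conjI[OF k' exI[of _ C]], intro conjI allI impI)
    fix \<phi> :: "complex \<Rightarrow> complex"
    assume \<phi>: "\<phi> holomorphic_on disk \<and> \<phi> ` disk \<subseteq> disk \<and> \<not> \<phi> constant_on disk \<and>
      bounded_op (dirichlet \<alpha>) (dirichlet \<alpha>) (comp_op \<phi>)"
    interpret X: composition_radius \<alpha> \<phi> r using \<phi> by unfold_locales auto
    have lim: "limsup_average \<phi> \<alpha> r = Limsup X.to_boundary X.avg"
      unfolding limsup_average_def X.avg_def[abs_def] ..
    let ?T = "ess_norm (bergman \<alpha>) (bergman \<alpha>) (toeplitz \<alpha> (counting_fun_measure \<phi> \<alpha>))"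
    show "(ess_norm (dirichlet \<alpha>) (dirichlet \<alpha>) (comp_op \<phi>))\<^sup>2 = (ess_norm (dirichlet0 \<alpha>) (dirichlet0 \<alpha>) (comp_op0 \<phi>))\<^sup>2"
      by (simp add: X.ess_norm_C)
    show "(ess_norm (dirichlet0 \<alpha>) (dirichlet0 \<alpha>) (comp_op0 \<phi>))\<^sup>2 = (ess_norm (bergman \<alpha>) (bergman \<alpha>) (deriv_comp_op \<phi>))\<^sup>2"
      by (simp add: X.ess_norm_C0)
    show T: "(ess_norm (bergman \<alpha>) (bergman \<alpha>) (deriv_comp_op \<phi>))\<^sup>2 = ?T"
      by (rule X.ess_norm_D_toeplitz)
    have "limsup_average \<phi> \<alpha> r \<le> ennreal (k * ?T)"
      using X.limsup_le_ess unfolding lim T k_def X.lower_const_def by (simp only:)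
    then have "ennreal (1 / k) * limsup_average \<phi> \<alpha> r \<le> ennreal (1 / k) * ennreal (k * ?T)" by (intro mult_left_mono) auto
    also have "\<dots> = ennreal ?T" using k T by (subst ennreal_mult[symmetric]) (auto simp flip: T)
    finally show "ennreal (1 / k) * limsup_average \<phi> \<alpha> r \<le> ennreal ?T" .
    show "ennreal ?T \<le> ennreal C * limsup_average \<phi> \<alpha> r"
      using X.ess_le_limsup unfolding lim T C_def X.upper_const_def X.fubini_const_def by (simp only:)
  qed (rule C)
qed

end
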